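(* For $n\in\mathbb{N}$ let $Z_n\subseteq\{0,1\}^\infty$ be the sofic shift presented by the labeled graph $G_n$ with vertices $v_0,v_1,\dots,v_{10^n-1}$ (indices of vertices are read modulo $10^n$, so $v_{10^n}=v_0$) and the following labeled edges: (i) for every $0\le k<10^n$, an edge from $v_k$ to $v_{k+1}$ with label $0$; (ii) for every $1\le k\le 10^n-2^n$, an edge from $v_k$ to $v_{k+1}$ with label $1$; (iii) an edge from $v_{10^n-2^n}$ to $v_{10^n-2^n+2}$ with label $0$. Let $Z=\bigcap_{n=1}^\infty Z_n$. Then the shift space $Z$ is hereditary, topologically mixing, proximal, has positive topological entropy, and its ergodic measures $\mathcal{M}^e_\sigma(Z)$ are entropy-dense in $\mathcal{M}_\sigma(Z)$.
   Context: $\{0,1\}^\infty$ is the set of sequences $x=(x_i)_{i\ge 0}$ with the product topology (compatible metric $\rho$); $\sigma(x)_j=x_{j+1}$. A shift space is a nonempty closed set $X$ with $\sigma(X)\subseteq X$. The sofic shift presented by a labeled graph is the set of all label sequences of infinite paths in the graph. $\mathcal{B}(X)$ is the set of finite words appearing in elements of $X$, and $\mathcal{B}_n(X)$ is the set of those of length $n$. $X\subseteq\{0,1\}^\infty$ is hereditary if for every $x\in X$ and $y\in\{0,1\}^\infty$ with $y_i\le x_i$ for all $i\ge 0$ we have $y\in X$. $X$ is topologically mixing if for any $u,w\in\mathcal{B}(X)$ there is $N\ge0$ such that for each $n\ge N$ there is $v\in\mathcal{B}_n(X)$ with $uvw\in\mathcal{B}(X)$. $X$ is proximal if $\liminf_{n\to\infty}\rho(\sigma^n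 x,\sigma^n y)=0$ for all $x,y\in X$. $\mathcal{M}_\sigma(X)$ is the set of $\sigma$-invariant Borel probability measures on $X$ with the weak$^*$ topology, $\mathcal{M}^e_\sigma(X)$ its subset of ergodic measures, and $h(\mu)$ the Kolmogorov–Sinai entropy. Ergodic measures of $X$ are entropy-dense if for every $\mu\in\mathcal{M}_\sigma(X)$, every neighborhood $U$ of $\mu$ in $\mathcal{M}_\sigma(X)$ and every $\varepsilon>0$ there is $\nu\in U\cap\mathcal{M}^e_\sigma(X)$ with $|h(\nu)-h(\mu)|<\varepsilon$. *)

theory Defs
  imports "HOL-Probability.Probability"
begin

text \<open>The symbols 0 and 1 are \<^const>\<open>False\<close> and \<^const>\<open>True\<close>, with
  \<^prop>\<open>False \<le> True\<close>. The type \<^typ>\<open>nat \<Rightarrow> bool\<close> carries the product of the discrete topologies.\<close>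

type_synonym bseq = "nat \<Rightarrow> bool"

definition shift :: "bseq \<Rightarrow> bseq" where
  "shift x = (\<lambda>i. x (Suc i))"

definition rho :: "bseq \<Rightarrow> bseq \<Rightarrow> real" where
  "rho x y = (if x = y then 0 else (1/2) ^ (LEAST i. x i \<noteq> y i))"

lemma rho_less_iff: "rho x y < (1/2) ^ k \<longleftrightarrow> (\<forall>i\<le>k. x i = y i)"
proof (cases "x = y")
  case False
  then obtain j where j: "x j \<noteq> y j" by auto
  define m where "m = (LEAST i. x i \<noteq> y i)"
  have m: "x m \<noteq> y m" unfolding m_def using j by (rule LeastI)
  have less: "x i = y i" if "i < m" for i
    using not_less_Least[of i "\<lambda>i. x i \<noteq> y i"] that by (auto simp: m_def)
  have "rho x y < (1/2) ^ k \<longleftrightarrow> k < m"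
    using False by (simp only: rho_def m_def[symmetric] if_False) simp
  also have "\<dots> \<longleftrightarrow> (\<forall>i\<le>k. x i = y i)"
    using m less by (meson le_less_trans not_le)
  finally show ?thesis .
qed (auto simp: rho_def)

lemma rho_commute: "rho x y = rho y x"
proof -
  have "(\<lambda>i. x i \<noteq> y i) = (\<lambda>i. y i \<noteq> x i)" by auto
  then show ?thesis by (simp add: rho_def eq_commute)
qed

interpretation rho: Metric_space UNIV rho
proof
  fix x y z :: bseq
  show "0 \<le> rho x y" by (simp add: rho_def)
  show "rho x y = rho y x" by (rule rho_commute)
  show "rho x y = 0 \<longleftrightarrow> x = y" by (simp add: rho_def)
  have "rho x z \<le> max (rho x y) (rho y z)"
  proof (cases "x = z")
    case False
    define m where "m = (LEAST i. x i \<noteq> z i)"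
    have xz: "rho x z = (1/2) ^ m" using False by (simp add: rho_def m_def)
    show ?thesis
    proof (rule ccontr)
      assume "\<not> ?thesis"
      then have "rho x y < (1/2) ^ m" "rho y z < (1/2) ^ m" by (auto simp: xz)
      then have "rho x z < (1/2) ^ m" by (simp add: rho_less_iff)
      then show False by (simp add: xz)
    qed
  next
    case True
    then have "rho x z = 0" by (simp add: rho_def)
    moreover have "0 \<le> rho x y" by (simp add: rho_def)
    ultimately show ?thesis by (simp add: le_max_iff_disj)
  qed
  also have "\<dots> \<le> rho x y + rho y z" by (simp add: rho_def)
  finally show "rho x z \<le> rho x y + rho y z" .
qed

lemma mtopology_rho: "rho.mtopology = euclidean"
proof (rule topology_eq[THEN iffD2], intro allI iffI)
  fix U :: "bseq set"
  assume "openin rho.mtopology U"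
  then have U: "\<exists>r>0. rho.mball x r \<subseteq> U" if "x \<in> U" for x
    using that by (auto simp: rho.openin_mtopology)
  have "\<exists>T. open T \<and> x \<in> T \<and> T \<subseteq> U" if x: "x \<in> U" for x
  proof -
    obtain r where r: "r > 0" "rho.mball x r \<subseteq> U" using U[OF x] by auto
    obtain k where k: "(1/2::real) ^ k < r" using real_arch_pow_inv[OF r(1), of "1/2"] by auto
    define T where "T = Pi\<^sub>E UNIV (\<lambda>i. if i \<le> k then {x i} else UNIV)"
    have "open T" unfolding T_def
    proof (rule open_PiE)
      show "finite {i. (if i \<le> k then {x i} else UNIV) \<noteq> UNIV}"
        by (rule finite_subset[of _ "{..k}"]) auto
    qed (simp add: Topological_Spaces.open_discrete)
    moreover have "x \<in> T" by (auto simp: T_def)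
    moreover have "T \<subseteq> U"
    proof
      fix y assume "y \<in> T"
      then have "x i = y i" if "i \<le> k" for i
        using that PiE_mem[of y UNIV "\<lambda>i. if i \<le> k then {x i} else UNIV" i] by (simp add: T_def)
      then have "rho x y < (1/2) ^ k" by (simp add: rho_less_iff)
      then have "rho x y < r" using k by (rule less_trans)
      then show "y \<in> U" using r(2) by (auto simp: rho.in_mball)
    qed
    ultimately show ?thesis by blast
  qed
  then show "openin euclidean U" unfolding open_openin[symmetric] using open_subopen[of U] by simp
next
  fix U :: "bseq set"
  assume "openin euclidean U"
  then have oU: "openin (product_topology (\<lambda>i. euclidean) UNIV) U"
    by (simp add: euclidean_product_topology)
  have "\<exists>r>0. rho.mball x r \<subseteq> U" if x: "x \<in> U" for x
  proof -
    obtain W where W: "finite {i \<in> UNIV. W i \<noteq> topspace (euclidean :: bool topology)}"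
        "x \<in> Pi\<^sub>E UNIV W" "Pi\<^sub>E UNIV W \<subseteq> U"
      using product_topology_open_contains_basis[OF oU x] by auto
    obtain k where k: "\<forall>i\<in>{i. W i \<noteq> UNIV}. i \<le> k"
      using W(1) finite_nat_set_iff_bounded_le[of "{i. W i \<noteq> UNIV}"] by auto
    have "rho.mball x ((1/2) ^ k) \<subseteq> U"
    proof
      fix y assume "y \<in> rho.mball x ((1/2) ^ k)"
      then have eq: "\<forall>i\<le>k. x i = y i" by (simp add: rho.in_mball rho_less_iff)
      have "y i \<in> W i" for i
      proof (cases "W i = UNIV")
        case False
        then have "x i = y i" using k eq by auto
        then show ?thesis using W(2) using PiE_mem[of x UNIV W i] by simp
      qed simp
      then show "y \<in> U" using W(3) by (auto simp: PiE_UNIV_domain)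
    qed
    then show ?thesis by (intro exI[of _ "(1/2) ^ k"]) auto
  qed
  then show "openin rho.mtopology U" by (auto simp: rho.openin_mtopology)
qed

definition shift_space :: "bseq set \<Rightarrow> bool" where
  "shift_space X \<longleftrightarrow> X \<noteq> {} \<and> closed X \<and> shift ` X \<subseteq> X"

text \<open>A labeled graph is given by its set of edges (source, label, target).\<close>

definition presented_shift :: "('v \<times> bool \<times> 'v) set \<Rightarrow> bseq set" where
  "presented_shift E = {x. \<exists>p. \<forall>i. (p i, x i, p (Suc i)) \<in> E}"

definition words :: "bseq set \<Rightarrow> bool list set" where
  "words X = {w. \<exists>x\<in>X. \<exists>i. w = map x [i..<i + length w]}"

definition words_of_length :: "bseq set \<Rightarrow> nat \<Rightarrow> bool list set" where
  "words_of_length X n = {w \<in> words X. length w = n}"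

definition hereditary :: "bseq set \<Rightarrow> bool" where
  "hereditary X \<longleftrightarrow> (\<forall>x\<in>X. \<forall>y. (\<forall>i. y i \<le> x i) \<longrightarrow> y \<in> X)"

definition topologically_mixing :: "bseq set \<Rightarrow> bool" where
  "topologically_mixing X \<longleftrightarrow>
     (\<forall>u\<in>words X. \<forall>w\<in>words X. \<exists>N. \<forall>n\<ge>N. \<exists>v\<in>words_of_length X n. u @ v @ w \<in> words X)"

definition proximal :: "bseq set \<Rightarrow> bool" where
  "proximal X \<longleftrightarrow>
     (\<forall>x\<in>X. \<forall>y\<in>X. liminf (\<lambda>n. ereal (rho ((shift ^^ n) x) ((shift ^^ n) y))) = 0)"

definition topological_entropy :: "bseq set \<Rightarrow> real" where
  "topological_entropy X = lim (\<lambda>n. ln (real (card (words_of_length X n))) / real n)"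

definition partition_entropy :: "'a measure \<Rightarrow> 'a set set \<Rightarrow> real" where
  "partition_entropy M P = - (\<Sum>A\<in>P. measure M A * ln (measure M A))"

text \<open>The join of the preimages of \<open>P\<close> under the first \<open>n\<close> iterates of \<open>T\<close>. It may contain
  the empty set, which contributes 0 to the entropy because \<^prop>\<open>ln (0::real) = 0\<close>.\<close>

definition iterated_join :: "'a measure \<Rightarrow> ('a \<Rightarrow> 'a) \<Rightarrow> 'a set set \<Rightarrow> nat \<Rightarrow> 'a set set" where
  "iterated_join M T P n = {space M \<inter> (\<Inter>i<n. (T ^^ i) -` a i) | a. \<forall>i<n. a i \<in> P}"

definition entropy_wrt :: "'a measure \<Rightarrow> ('a \<Rightarrow> 'a) \<Rightarrow> 'a set set \<Rightarrow> real" where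
  "entropy_wrt M T P = lim (\<lambda>n. partition_entropy M (iterated_join M T P n) / real n)"

definition ks_entropy :: "'a measure \<Rightarrow> ('a \<Rightarrow> 'a) \<Rightarrow> ereal" where
  "ks_entropy M T =
     (SUP P\<in>{P. finite P \<and> P \<subseteq> sets M \<and> partition_on (space M) P}. ereal (entropy_wrt M T P))"

definition borel_probs :: "bseq set \<Rightarrow> bseq measure set" where
  "borel_probs X = {\<mu>. prob_space \<mu> \<and> sets \<mu> = sets (restrict_space borel X)}"

definition invariant_measures :: "bseq set \<Rightarrow> bseq measure set" where
  "invariant_measures X = {\<mu> \<in> borel_probs X. shift \<in> measurable \<mu> \<mu> \<and> distr \<mu> \<mu> shift = \<mu>}"

definition ergodic_measures :: "bseq set \<Rightarrow> bseq measure set" where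
  "ergodic_measures X = {\<mu> \<in> invariant_measures X.
     \<forall>A\<in>sets \<mu>. shift -` A \<inter> space \<mu> = A \<longrightarrow> measure \<mu> A = 0 \<or> measure \<mu> A = 1}"

text \<open>The coarsest topology on \<^term>\<open>borel_probs X\<close> for which integration of each continuous
  real function on \<open>X\<close> is continuous.\<close>

definition weak_star :: "bseq set \<Rightarrow> bseq measure topology" where
  "weak_star X = topology_generated_by
     {{\<mu> \<in> borel_probs X. (\<integral>x. f x \<partial>\<mu>) \<in> V} | (f :: bseq \<Rightarrow> real) V. continuous_on X f \<and> open V}"

definition entropy_dense :: "bseq set \<Rightarrow> bool" where
  "entropy_dense X \<longleftrightarrow>
     (\<forall>\<mu>\<in>invariant_measures X. \<forall>U.
        openin (subtopology (weak_star X) (invariant_measures X)) U \<and> \<mu> \<in> U \<longrightarrow>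
        (\<forall>\<epsilon>>0. \<exists>\<nu>\<in>U \<inter> ergodic_measures X. \<bar>ks_entropy \<nu> shift - ks_entropy \<mu> shift\<bar> < ereal \<epsilon>))"

text \<open>The vertex \<open>v\<^sub>k\<close> is the number \<open>k < 10 ^ n\<close>.\<close>

definition G :: "nat \<Rightarrow> (nat \<times> bool \<times> nat) set" where
  "G n =
     {(k, False, (k + 1) mod 10 ^ n) | k. k < 10 ^ n} \<union>
     {(k, True, (k + 1) mod 10 ^ n) | k. 1 \<le> k \<and> k \<le> 10 ^ n - 2 ^ n} \<union>
     {(10 ^ n - 2 ^ n, False, (10 ^ n - 2 ^ n + 2) mod 10 ^ n)}"

definition Zn :: "nat \<Rightarrow> bseq set" where
  "Zn n = presented_shift (G n)"

definition Z :: "bseq set" where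
  "Z = (\<Inter>n\<in>{1..}. Zn n)"

end

theory Submission
  imports Defs
begin

text \<open>
  For \<open>n \<ge> 1\<close> a point belongs to \<^term>\<open>Zn n\<close> iff it can be cut into pieces of length \<open>10 ^ n\<close> or \<open>10 ^ n - 1\<close> (the
  first piece may be incomplete), each of which ends with \<open>2 ^ n\<close> zeros, the \<^emph>\<open>gap\<close> of level \<open>n\<close>. Nothing
  else is asked of it, so all conditions have the form ``here are zeros''. This gives heredity at once. It
  gives proximality because a gap of level \<open>m\<close> is longer than a whole piece of level \<open>n\<close> plus a gap
  of level \<open>n\<close> as soon as \<open>m\<close> is large compared with \<open>n\<close>: a high gap of one point contains a low
  gap of the other. The entropy is positive because the fraction of positions that lie in a gap of some
  level can be kept down to \<open>(1/5) + (1/5)^2 + \<dots> = 1/4\<close>, and the other positions are free.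

  Two facts allow points to be put together. At a low level a run of \<open>10 ^ (2 * n)\<close> zeros suffices to
  get from any vertex to any other in the prescribed time, by taking the shortcut the right number of
  times (\<open>zero_path\<close>, \<open>Zn_glue\<close>). At a high level one may simply overwrite with zeros whatever is found
  in the gaps, and this hardly changes the point, because the gaps are rare (\<open>prob_masked_le\<close>). Mixing is
  the simplest application, with ``rare'' replaced by ``avoidable'' (\<open>Zn_if_small_support\<close>).

  For entropy density let \<open>\<mu>\<close> be an invariant measure. Take independent blocks of length \<open>l\<close>, each
  distributed like the first \<open>l\<close> coordinates of a \<open>\<mu>\<close>-random point, separate them by zeros so that
  the blocks start at the multiples of \<open>10 ^ K\<close>, and look at this sequence from a random position; then
  overwrite with zeros the gaps of all levels \<open>m \<ge> k\<close>, where the gaps of level \<open>m\<close> recur with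
  period \<open>10 ^ m\<close>. If at least \<open>10 ^ (2 * k)\<close> zeros separate the blocks, the result lies in \<open>Z\<close>:
  levels below \<open>k\<close> are served by the zeros between the blocks, the others by the masks. The positions
  modulo all powers of 10 are the states of the decimal odometer, so that the law \<open>\<nu>\<close> of the
  result is a factor of a skew product over the odometer in which one block is used up every \<open>10 ^ K\<close>
  steps. This system is ergodic: over \<open>10 ^ m\<close> consecutive steps the phase of level \<open>m\<close> takes each
  value once, while the blocks seen at distant times are independent (\<open>step_ergodic\<close>).

  If \<open>k\<close> is large and \<open>10 ^ K\<close> is much larger than \<open>10 ^ (2 * k)\<close>, then a window of fixed length
  of a \<open>\<nu>\<close>-random point usually lies inside a block and away from the masks, so \<open>\<nu>\<close> is weak* close
  to \<open>\<mu>\<close> (\<open>cylinder_probability_close\<close>, \<open>weak_star_neighbourhood\<close>). The entropy of \<open>\<nu>\<close> is at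
  least that of the independent blocks per unit of time, up to \<open>ln 2\<close> times the density of the masks
  (\<open>h_nu_ge\<close>). Conversely it is at most \<open>H / n\<close>, where \<open>H\<close> is the Shannon entropy of its words of length
  \<open>n\<close>, for every fixed \<open>n\<close>; this is close to the same quantity for \<open>\<mu>\<close>, which for large \<open>n\<close> is close
  to \<open>h(\<mu>)\<close>. The use of words to compute entropies rests on the generator theorem \<open>ks_entropy_eq\<close>.
\<close>

section \<open>Paths, gaps and gluing in the sofic shifts\<close>

text \<open>The vertices that no edge with label 1 leaves. The argument need not be reduced, so that the
  predicate can be applied to the sum of a starting vertex and a time.\<close>

definition gap :: "nat \<Rightarrow> nat \<Rightarrow> bool" where
  "gap n v \<longleftrightarrow> v mod 10 ^ n = 0 \<or> v mod 10 ^ n > 10 ^ n - 2 ^ n"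

lemma two_power_le_ten_power: "(2::nat) ^ n \<le> 10 ^ n"
  by (rule power_mono) auto

lemma G_vertices: "(u, b, v) \<in> G n \<Longrightarrow> u < 10 ^ n \<and> v < 10 ^ n"
  by (auto simp: G_def intro: le_less_trans[OF _ diff_less])

lemma G_lower: "(u, b, v) \<in> G n \<Longrightarrow> b' \<le> b \<Longrightarrow> (u, b', v) \<in> G n"
proof -
  have "k \<le> 10 ^ n - 2 ^ n \<Longrightarrow> k < 10 ^ n" for k :: nat
    by (rule le_less_trans[OF _ diff_less]) auto
  then show "(u, b, v) \<in> G n \<Longrightarrow> b' \<le> b \<Longrightarrow> (u, b', v) \<in> G n"
    by (cases b; cases b') (auto simp: G_def)
qed

lemma G_True_not_gap: "(u, True, v) \<in> G n \<Longrightarrow> \<not> gap n u"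
proof -
  have "k \<le> 10 ^ n - 2 ^ n \<Longrightarrow> k < 10 ^ n" for k :: nat
    by (rule le_less_trans[OF _ diff_less]) auto
  then show "(u, True, v) \<in> G n \<Longrightarrow> \<not> gap n u"
    by (auto simp: G_def gap_def)
qed

lemma G_step:
  "(u, b, v) \<in> G n \<Longrightarrow> u \<noteq> 10 ^ n - 2 ^ n \<Longrightarrow> v = (u + 1) mod 10 ^ n"
  by (auto simp: G_def)

lemma G_step_or_shortcut:
  "(u, b, v) \<in> G n \<Longrightarrow> v = (u + 1) mod 10 ^ n \<or>
     u = 10 ^ n - 2 ^ n \<and> \<not> b \<and> v = (u + 2) mod 10 ^ n"
  by (auto simp: G_def)

lemma shift_iterate: "(shift ^^ n) x = (\<lambda>i. x (n + i))"
  by (induction n arbitrary: x) (auto simp: shift_def fun_eq_iff)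

lemma ZnI: "(\<And>i. (p i, x i, p (Suc i)) \<in> G n) \<Longrightarrow> x \<in> Zn n"
  by (auto simp: Zn_def presented_shift_def)

lemma Zn_shift: "x \<in> Zn n \<Longrightarrow> (\<lambda>i. x (t + i)) \<in> Zn n"
proof -
  assume "x \<in> Zn n"
  then obtain p where "\<forall>i. (p i, x i, p (Suc i)) \<in> G n"
    by (auto simp: Zn_def presented_shift_def)
  then have "\<forall>i. (p (t + i), x (t + i), p (t + Suc i)) \<in> G n" by simp
  then show ?thesis
    unfolding Zn_def presented_shift_def mem_Collect_eq by (intro exI[of _ "\<lambda>i. p (t + i)"])
qed

lemma Zn_lower: "x \<in> Zn n \<Longrightarrow> (\<And>i. y i \<Longrightarrow> x i) \<Longrightarrow> y \<in> Zn n"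
proof -
  assume "x \<in> Zn n" and yx: "\<And>i. y i \<Longrightarrow> x i"
  then obtain p where p: "\<And>i. (p i, x i, p (Suc i)) \<in> G n"
    by (auto simp: Zn_def presented_shift_def)
  have "(p i, y i, p (Suc i)) \<in> G n" for i
  proof (rule G_lower[OF p[of i]])
    show "y i \<le> x i" using yx[of i] by (rule le_boolI)
  qed
  then show ?thesis by (rule ZnI)
qed

text \<open>The path that starts at \<open>t\<close> and never takes the shortcut.\<close>

lemma in_ZnI:
  assumes "\<And>i. x i \<Longrightarrow> \<not> gap n (t + i)"
  shows "x \<in> Zn n"
proof -
  have "((t + i) mod 10 ^ n, x i, (t + Suc i) mod 10 ^ n) \<in> G n" for i
  proof (cases "x i")
    case True
    then have "1 \<le> (t + i) mod 10 ^ n" "(t + i) mod 10 ^ n \<le> 10 ^ n - 2 ^ n"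
      using assms[of i] by (auto simp: gap_def Suc_le_eq)
    then show ?thesis using True by (auto simp: G_def mod_Suc_eq)
  next
    case False
    then show ?thesis by (auto simp: G_def mod_Suc_eq)
  qed
  then show ?thesis
    unfolding Zn_def presented_shift_def mem_Collect_eq
    by (intro exI[of _ "\<lambda>i. (t + i) mod 10 ^ n"]) auto
qed

lemma closed_if_closed_under_agreement:
  fixes X :: "bseq set"
  assumes "\<And>x. (\<And>N. \<exists>y\<in>X. \<forall>i<N. y i = x i) \<Longrightarrow> x \<in> X"
  shows "closed X"
proof -
  have "\<exists>T. open T \<and> x \<in> T \<and> T \<subseteq> - X" if "x \<notin> X" for x
  proof -
    have "\<not> (\<forall>N. \<exists>y\<in>X. \<forall>i<N. y i = x i)" 
    proof
      assume "\<forall>N. \<exists>y\<in>X. \<forall>i<N. y i = x i"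
      then have "x \<in> X" by (intro assms) simp
      with that show False by simp
    qed
    then obtain N where N: "\<forall>y\<in>X. \<exists>i<N. y i \<noteq> x i" by auto
    define T where "T = (\<Inter>i<N. (\<lambda>y::bseq. y i) -` {x i})"
    have "open ((\<lambda>y::bseq. y i) -` {x i})" for i
      by (intro open_vimage) (auto simp: Topological_Spaces.open_discrete)
    then have "open T" unfolding T_def by (intro open_INT) auto
    moreover have "x \<in> T" "T \<subseteq> - X" using N by (auto simp: T_def)
    ultimately show ?thesis by blast
  qed
  then have "open (- X)" by (subst open_subopen) auto
  then show ?thesis by (simp add: closed_def)
qed

text \<open>Koenig's lemma: a vertex is viable at time \<open>i\<close> if paths of every finite length spelling
  \<open>x i, x (i + 1), \<dots>\<close> start there. Since there are finitely many vertices, a viable one always has a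
  viable successor.\<close>

lemma Zn_closed_under_agreement:
  assumes "\<And>N. \<exists>y\<in>Zn n. \<forall>i<N. y i = x i"
  shows "x \<in> Zn n"
proof -
  define ok where "ok v i N \<longleftrightarrow> (\<exists>p. p i = v \<and> (\<forall>j. i \<le> j \<and> j < N \<longrightarrow> (p j, x j, p (Suc j)) \<in> G n))"
    for v i N
  define viable where "viable v i \<longleftrightarrow> v < 10 ^ n \<and> (\<forall>N. ok v i N)" for v i
  have mono: "ok v i N" if ok: "ok v i N'" and le: "N \<le> N'" for v i N N'
  proof -
    obtain p where "p i = v" "\<forall>j. i \<le> j \<and> j < N' \<longrightarrow> (p j, x j, p (Suc j)) \<in> G n"
      using ok by (auto simp: ok_def)
    then show ?thesis using le unfolding ok_def by (intro exI[of _ p]) auto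
  qed
  have pigeon: "\<exists>v<10 ^ n. Q v \<and> (\<forall>N. ok v i N)"
    if ex: "\<And>N. \<exists>v<10 ^ n. Q v \<and> ok v i N" for i Q
  proof (rule ccontr)
    assume "\<not> ?thesis"
    then have "\<forall>v\<in>{v. v < 10 ^ n \<and> Q v}. \<exists>N. \<not> ok v i N" by auto
    then obtain N where N: "\<forall>v\<in>{v. v < 10 ^ n \<and> Q v}. \<not> ok v i (N v)" by metis
    obtain v where v: "v < 10 ^ n" "Q v" "ok v i (Max (N ` {v. v < 10 ^ n \<and> Q v}))"
      using ex by blast
    have "ok v i (N v)" using v by (auto intro!: mono[OF v(3)] Max_ge)
    with N v show False by auto
  qed
  have "\<exists>v<10 ^ n. True \<and> ok v 0 N" for N
  proof -
    obtain y where y: "y \<in> Zn n" "\<forall>i<N. y i = x i" using assms by blast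
    then obtain p where p: "\<forall>i. (p i, y i, p (Suc i)) \<in> G n"
      by (auto simp: Zn_def presented_shift_def)
    have "(p j, x j, p (Suc j)) \<in> G n" if "j < N" for j
      using p[rule_format, of j] y(2)[rule_format, OF that] by simp
    then have "ok (p 0) 0 N" unfolding ok_def by (intro exI[of _ p]) auto
    then show ?thesis using p G_vertices by blast
  qed
  then have start: "\<exists>v. viable v 0" using pigeon[of "\<lambda>_. True" 0] by (auto simp: viable_def)
  have step: "\<exists>v'. viable v' (Suc i) \<and> (v, x i, v') \<in> G n" if "viable v i" for v i
  proof -
    have "\<exists>v'<10 ^ n. (v, x i, v') \<in> G n \<and> ok v' (Suc i) N" for N
    proof -
      have "ok v i (max N (Suc i))" using that by (auto simp: viable_def)
      then obtain p where p: "p i = v"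
        "\<forall>j. i \<le> j \<and> j < max N (Suc i) \<longrightarrow> (p j, x j, p (Suc j)) \<in> G n"
        by (auto simp: ok_def)
      then have e: "(v, x i, p (Suc i)) \<in> G n" by auto
      moreover have "ok (p (Suc i)) (Suc i) N" using p unfolding ok_def by auto
      ultimately show ?thesis using G_vertices[OF e] by blast
    qed
    then show ?thesis using pigeon[of "\<lambda>v'. (v, x i, v') \<in> G n" "Suc i"] by (auto simp: viable_def)
  qed
  have "\<exists>p. \<forall>i. viable (p i) i \<and> (p i, x i, p (Suc i)) \<in> G n"
    using dependent_nat_choice[of "\<lambda>i v. viable v i" "\<lambda>i v v'. (v, x i, v') \<in> G n"] start step
    by blast
  then show ?thesis by (auto simp: Zn_def presented_shift_def)
qed

lemma zero_in_Z: "(\<lambda>_. False) \<in> Z"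
  by (auto simp: Z_def intro: in_ZnI[where t = 0])

lemma shift_image_Z: "x \<in> Z \<Longrightarrow> shift x \<in> Z"
  using Zn_shift[of x _ 1] by (auto simp: Z_def shift_def)

lemma Z_shift: "x \<in> Z \<Longrightarrow> (\<lambda>i. x (t + i)) \<in> Z"
  using Zn_shift by (auto simp: Z_def)

lemma closed_Z: "closed Z"
proof (rule closed_if_closed_under_agreement)
  fix x assume *: "\<And>N. \<exists>y\<in>Z. \<forall>i<N. y i = x i"
  show "x \<in> Z" unfolding Z_def
  proof (intro INT_I Zn_closed_under_agreement)
    fix n N :: nat assume "n \<in> {1..}"
    then show "\<exists>y\<in>Zn n. \<forall>i<N. y i = x i" using *[of N] by (auto simp: Z_def)
  qed
qed

lemma shift_space_Z: "shift_space Z"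
  using zero_in_Z shift_image_Z closed_Z by (auto simp: shift_space_def)

lemma Z_lower: "x \<in> Z \<Longrightarrow> (\<And>i. y i \<Longrightarrow> x i) \<Longrightarrow> y \<in> Z"
  unfolding Z_def using Zn_lower by blast

lemma hereditary_Z: "hereditary Z"
  unfolding hereditary_def using Z_lower by (metis le_boolD)

lemma zero_walk: "e < 10 ^ n \<Longrightarrow> (e, (e + a) mod 10 ^ n) \<in> {(u, v). (u, False, v) \<in> G n} ^^ a"
proof (induction a)
  case (Suc a)
  then show ?case by (auto simp: G_def mod_Suc_eq intro!: relcompI)
qed auto

text \<open>The shortcut gains one step per use, so a path that takes it \<open>b\<close> times in \<open>a\<close> steps advances
  by \<open>a + b\<close>; each use costs at most one tour of the cycle. As \<open>b\<close> ranges over the residues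
  modulo \<open>10 ^ n\<close>, every target vertex is hit.\<close>

lemma zero_path_advance:
  assumes "e < 10 ^ n" "b * 10 ^ n \<le> a"
  shows "(e, (e + a + b) mod 10 ^ n) \<in> {(u, v). (u, False, v) \<in> G n} ^^ a"
  using assms
proof (induction b arbitrary: e a)
  case 0
  then show ?case using zero_walk[of e n a] by simp
next
  case (Suc b)
  let ?R = "{(u, v). (u, False, v) \<in> G n}"
  define L :: nat where "L = 10 ^ n"
  define c :: nat where "c = L - 2 ^ n"
  have c: "c < L" by (simp add: c_def L_def)
  define d where "d = (c + (L - e)) mod L"
  have d: "d < L" "(e + d) mod L = c"
  proof -
    show "d < L" using c by (simp add: d_def)
    have "(e + d) mod L = (c + L) mod L"
      using Suc.prems(1) by (simp add: d_def mod_add_right_eq L_def)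
    then show "(e + d) mod L = c" using c by simp
  qed
  have "(e, c) \<in> ?R ^^ d" using zero_walk[of e n d] d(2) Suc.prems(1) by (simp add: L_def)
  moreover have "(c, (c + 2) mod L) \<in> ?R" by (auto simp: G_def c_def L_def)
  ultimately have 1: "(e, (c + 2) mod L) \<in> ?R ^^ Suc d" by auto
  have le: "Suc d + b * L \<le> a" using d(1) Suc.prems(2) by (simp add: L_def)
  then have "((c + 2) mod L, ((c + 2) mod L + (a - Suc d) + b) mod L) \<in> ?R ^^ (a - Suc d)"
    unfolding L_def by (intro Suc.IH) (auto simp: L_def)
  moreover have "((c + 2) mod L + (a - Suc d) + b) mod L = (e + a + Suc b) mod L"
  proof -
    have "((c + 2) mod L + (a - Suc d) + b) mod L = ((e + d) mod L + (2 + (a - Suc d) + b)) mod L"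
      using d(2) by (simp add: mod_add_left_eq add.assoc)
    also have "\<dots> = (e + d + (2 + (a - Suc d) + b)) mod L" by (rule mod_add_left_eq)
    also have "e + d + (2 + (a - Suc d) + b) = e + a + Suc b" using le by simp
    finally show ?thesis .
  qed
  ultimately have "(e, (e + a + Suc b) mod L) \<in> ?R ^^ (Suc d + (a - Suc d))"
    using 1 unfolding relpow_add by (auto intro!: relcompI)
  then show ?case using le by (simp add: L_def)
qed

lemma zero_path:
  assumes "e < 10 ^ n" "s < 10 ^ n" "10 ^ (2 * n) \<le> a"
  obtains q where "q 0 = e" "q a = s" "\<forall>i<a. (q i, False, q (Suc i)) \<in> G n"
proof -
  define L :: nat where "L = 10 ^ n"
  define b where "b = (s + (L - (e + a) mod L)) mod L"
  have bL: "b < L" by (simp add: b_def L_def)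
  then have "b * L \<le> L * L" by (intro mult_right_mono) auto
  also have "\<dots> \<le> a" using assms(3) by (simp add: L_def mult_2 power_add)
  finally have "b * L \<le> a" .
  moreover have "(e + a + b) mod L = s"
  proof -
    have "(e + a + b) mod L = ((e + a) mod L + (s + (L - (e + a) mod L))) mod L"
      unfolding b_def by (metis mod_add_eq mod_mod_trivial)
    also have "(e + a) mod L < L" by (simp add: L_def)
    then have "(e + a) mod L + (s + (L - (e + a) mod L)) = s + L" by simp
    finally show ?thesis using assms(2) by (simp add: L_def)
  qed
  ultimately have "(e, s) \<in> {(u, v). (u, False, v) \<in> G n} ^^ a"
    using zero_path_advance[OF assms(1), of b a] by (simp add: L_def)
  then show ?thesis using that unfolding relpow_fun_conv by auto
qed

text \<open>Long runs of zeros synchronise the cycle: after a run of length at least \<open>10 ^ (2 * n)\<close> any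
  point of the shift can be entered at any place.\<close>

lemma Zn_glue:
  assumes x: "\<And>j. x j \<in> Zn n" and a: "10 ^ (2 * n) \<le> a" and B: "B = l + a"
  shows "(\<lambda>i. i mod B < l \<and> x (i div B) (i mod B)) \<in> Zn n"
proof -
  have "\<exists>p. \<forall>i. (p i, x j i, p (Suc i)) \<in> G n" for j
    using x[of j] by (auto simp: Zn_def presented_shift_def)
  then obtain p where p: "\<And>j i. (p j i, x j i, p j (Suc i)) \<in> G n" by metis
  then have pv: "p j i < 10 ^ n" for j i using G_vertices by blast
  have "\<exists>q. q 0 = p j l \<and> q a = p (Suc j) 0 \<and> (\<forall>i<a. (q i, False, q (Suc i)) \<in> G n)" for j
    using zero_path[OF pv pv a, of j l "Suc j" 0] by metis
  then obtain q where q: "\<And>j. q j 0 = p j l" "\<And>j. q j a = p (Suc j) 0"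
    "\<And>j i. i < a \<Longrightarrow> (q j i, False, q j (Suc i)) \<in> G n" by metis
  have a0: "a > 0" using a by (metis gr0I le_zero_eq power_eq_0_iff zero_neq_numeral)
  then have B0: "B > 0" using B by simp
  define P where "P i = (if i mod B < l then p (i div B) (i mod B) else q (i div B) (i mod B - l))" for i
  have "(P i, i mod B < l \<and> x (i div B) (i mod B), P (Suc i)) \<in> G n" for i
  proof (cases "Suc (i mod B) = B")
    case True
    then have s: "Suc i mod B = 0" "Suc i div B = Suc (i div B)"
      by (auto simp: mod_Suc div_Suc)
    then have "P (Suc i) = p (Suc (i div B)) 0" using q(1) by (auto simp: P_def)
    moreover have "\<not> i mod B < l" "i mod B - l < a" "Suc (i mod B - l) = a"
      using True B a0 by auto
    ultimately show ?thesis using q(2)[of "i div B"] q(3)[of "i mod B - l" "i div B"] by (simp add: P_def)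
  next
    case False
    then have s: "Suc i mod B = Suc (i mod B)" "Suc i div B = i div B"
      by (auto simp: mod_Suc div_Suc)
    have lt: "i mod B < B" using B0 by simp
    consider "Suc (i mod B) < l" | "Suc (i mod B) = l" | "i mod B \<ge> l" by linarith
    then show ?thesis
    proof cases
      case 1
      then show ?thesis using p s by (simp add: P_def)
    next
      case 2
      then have *: "Suc (i mod B) - l = 0" "i mod B < l" "\<not> Suc (i mod B) < l" by auto
      have "P (Suc i) = p (i div B) (Suc (i mod B))" using * 2 s q(1) by (simp add: P_def)
      then show ?thesis using p * by (simp add: P_def)
    next
      case 3
      then have "Suc (i mod B) - l = Suc (i mod B - l)" "i mod B - l < a" using lt B by auto
      then show ?thesis using 3 s q(3) by (simp add: P_def)
    qed
  qed
  then show ?thesis by (rule ZnI)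
qed

lemma bij_betw_add_mod:
  fixes L :: nat
  assumes "L > 0"
  shows "bij_betw (\<lambda>t. (t + i) mod L) {..<L} {..<L}"
proof (rule bij_betw_imageI)
  have "s = t" if "s < L" "t < L" "s \<le> t" "(t + i) mod L = (s + i) mod L" for s t
  proof -
    have "L dvd (t + i) - (s + i)" using that by (subst mod_eq_dvd_iff_nat[symmetric]) auto
    then have "t - s = 0" using that by (metis add_diff_cancel_right dvd_imp_le less_imp_diff_less not_gr_zero not_less)
    then show "s = t" using that by simp
  qed
  then show inj: "inj_on (\<lambda>t. (t + i) mod L) {..<L}"
    by (intro inj_onI) (metis lessThan_iff nat_le_linear)
  show "(\<lambda>t. (t + i) mod L) ` {..<L} = {..<L}"
    using inj assms by (intro endo_inj_surj) auto
qed

lemma card_gap: 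
  assumes "n \<ge> 1"
  shows "card {t. t < 10 ^ n \<and> gap n (t + i)} = 2 ^ n"
proof -
  let ?L = "10 ^ n :: nat"
  have pow: "2 ^ n \<le> ?L" "(2::nat) ^ n \<ge> 1" by (auto simp: two_power_le_ten_power)
  have "bij_betw (\<lambda>t. (t + i) mod ?L) {..<?L} {..<?L}" by (rule bij_betw_add_mod) simp
  then have "bij_betw (\<lambda>t. (t + i) mod ?L) {t \<in> {..<?L}. gap n ((t + i) mod ?L)} {t \<in> {..<?L}. gap n t}"
    by (rule bij_betw_Collect) auto
  then have "card {t. t < ?L \<and> gap n (t + i)} = card {t. t < ?L \<and> gap n t}"
    by (auto simp: gap_def dest: bij_betw_same_card)
  also have "{t. t < ?L \<and> gap n t} = insert 0 {?L - 2 ^ n<..<?L}"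
    by (auto simp: gap_def)
  also have "card \<dots> = 2 ^ n" using pow by (subst card_insert_disjoint) auto
  finally show ?thesis .
qed

text \<open>Each position of the support rules out \<open>2 ^ n\<close> of the \<open>10 ^ n\<close> starting
  vertices.\<close>

lemma Zn_if_small_support:
  assumes "n \<ge> 1" "finite F" "\<And>i. x i \<Longrightarrow> i \<in> F" "card F * 2 ^ n < 10 ^ n"
  shows "x \<in> Zn n"
proof -
  have "card (\<Union>i\<in>F. {t. t < 10 ^ n \<and> gap n (t + i)}) \<le> (\<Sum>i\<in>F. 2 ^ n)"
    using card_UN_le[OF assms(2), of "\<lambda>i. {t. t < 10 ^ n \<and> gap n (t + i)}"] card_gap[OF assms(1)] by simp
  also have "\<dots> < card {..<(10::nat) ^ n}" using assms(4) by simp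
  finally have "\<not> {..<10 ^ n} \<subseteq> (\<Union>i\<in>F. {t. t < 10 ^ n \<and> gap n (t + i)})"
    using card_mono[of "\<Union>i\<in>F. {t. t < 10 ^ n \<and> gap n (t + i)}" "{..<10 ^ n}"] assms(2) by fastforce
  then obtain t where "\<forall>i\<in>F. \<not> gap n (t + i)" by auto
  then show ?thesis using assms(3) by (intro in_ZnI[of x n t]) blast
qed

section \<open>Mixing and proximality\<close>

lemma words_iff_initial: "w \<in> words Z \<longleftrightarrow> (\<exists>x\<in>Z. w = map x [0..<length w])"
proof
  assume "w \<in> words Z"
  then obtain x i where x: "x \<in> Z" "w = map x [i..<i + length w]" by (auto simp: words_def)
  have "map x [i..<i + length w] = map (\<lambda>j. x (i + j)) [0..<length w]"
    by (intro nth_equalityI) auto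
  with x show "\<exists>x\<in>Z. w = map x [0..<length w]" using Z_shift[of x i] by metis
next
  assume "\<exists>x\<in>Z. w = map x [0..<length w]"
  then show "w \<in> words Z" unfolding words_def using add_0 by (metis (mono_tags, lifting) mem_Collect_eq)
qed

lemma topologically_mixing_Z: "topologically_mixing Z"
  unfolding topologically_mixing_def
proof (intro ballI)
  fix u w assume "u \<in> words Z" "w \<in> words Z"
  then obtain x y where x: "x \<in> Z" "u = map x [0..<length u]" and y: "y \<in> Z" "w = map y [0..<length w]"
    unfolding words_iff_initial by blast
  define l where "l = max (length u) (length w)"
  obtain k where k: "real (2 * l) < 5 ^ k" using real_arch_pow[of 5 "real (2 * l)"] by auto
  have k': "2 * l < 5 ^ m" if "k \<le> m" for m
  proof -
    have "2 * l < 5 ^ k" using k by (metis of_nat_less_iff of_nat_numeral of_nat_power)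
    also have "(5::nat) ^ k \<le> 5 ^ m" using that by (intro power_increasing) auto
    finally show ?thesis .
  qed
  show "\<exists>N. \<forall>n\<ge>N. \<exists>v\<in>words_of_length Z n. u @ v @ w \<in> words Z"
  proof (intro exI[of _ "l + 10 ^ (2 * k)"] allI impI)
    fix n assume n: "l + 10 ^ (2 * k) \<le> n"
    (* The words u and w become the initial parts of the windows [0, l) and [B, B + l); whatever the
       constructed point z shows between them, zeros or remainders of the windows, is taken for v. *)
    define a where "a = length u + n - l"
    define B where "B = l + a"
    have "(10::nat) ^ (2 * k) > 0" by simp
    with n have B: "B = length u + n" and B0: "B > 0" and a: "10 ^ (2 * k) \<le> a"
      unfolding B_def a_def by linarith+
    define X where "X j = (if j = 0 then x else if j = 1 then y else (\<lambda>_. False))" for j :: nat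
    have X: "X j \<in> Z" for j using x y zero_in_Z by (auto simp: X_def)
    define z where "z = (\<lambda>i. i mod B < l \<and> X (i div B) (i mod B))"
    have z: "z \<in> Z" unfolding Z_def
    proof
      fix m :: nat assume m: "m \<in> {1..}"
      show "z \<in> Zn m"
      proof (cases "m < k")
        case True
        then have "(10::nat) ^ (2 * m) \<le> 10 ^ (2 * k)" by (intro power_increasing) auto
        then have "10 ^ (2 * m) \<le> a" using a by (rule le_trans)
        then show ?thesis
          unfolding z_def using X m by (intro Zn_glue[OF _ _ B_def]) (auto simp: Z_def)
      next
        case False
        have "i \<in> {..<l} \<union> {B..<B + l}" if "z i" for i
        proof -
          have "i div B = 0 \<or> i div B = 1" "i mod B < l" using that by (auto simp: z_def X_def split: if_splits)
          then have "i = i mod B \<or> i = B + i mod B"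
            using div_mult_mod_eq[of i B] by (metis add_0 mult_0 mult_1)
          then show ?thesis using \<open>i mod B < l\<close> by auto
        qed
        moreover have "card ({..<l} \<union> {B..<B + l}) * 2 ^ m < 10 ^ m"
        proof -
          have "card ({..<l} \<union> {B..<B + l}) * 2 ^ m \<le> (2 * l) * 2 ^ m"
            using card_Un_le[of "{..<l}" "{B..<B + l}"] by (intro mult_right_mono) auto
          also have "\<dots> < 5 ^ m * 2 ^ m" using k'[of m] False by simp
          also have "\<dots> = (10::nat) ^ m" by (simp flip: power_mult_distrib)
          finally show ?thesis .
        qed
        ultimately show ?thesis using m by (intro Zn_if_small_support[of m "{..<l} \<union> {B..<B + l}"]) auto
      qed
    qed
    have lB: "l \<le> B" by (simp add: B_def)
    have zu: "z i = x i" if "i < length u" for i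
    proof -
      have "i < l" "i < B" using that B_def by (auto simp: l_def)
      then show ?thesis by (auto simp: z_def X_def)
    qed
    have zw: "z (B + i) = y i" if "i < length w" for i
    proof -
      have "i < l" "i < B" using that B_def by (auto simp: l_def)
      then show ?thesis using B0 by (auto simp: z_def X_def)
    qed
    define v where "v = map z [length u..<length u + n]"
    have lv: "length v = n" by (simp add: v_def)
    have "u @ v @ w = map z [0..<length (u @ v @ w)]"
    proof (rule nth_equalityI)
      fix i assume i: "i < length (u @ v @ w)"
      have ux: "u ! j = x j" if "j < length u" for j by (subst x(2)) (use that in simp)
      have wy: "w ! j = y j" if "j < length w" for j by (subst y(2)) (use that in simp)
      show "(u @ v @ w) ! i = map z [0..<length (u @ v @ w)] ! i"
        using i zu[of i] zw[of "i - B"] ux[of i] wy[of "i - B"] lv B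
        by (auto simp: nth_append v_def)
    qed simp
    then have "u @ v @ w \<in> words Z" using z words_iff_initial by blast
    moreover have "v \<in> words_of_length Z n"
      using z lv unfolding words_of_length_def words_def by (auto simp: v_def)
    ultimately show "\<exists>v\<in>words_of_length Z n. u @ v @ w \<in> words Z" by blast
  qed
qed

text \<open>Within one tour every path comes to the vertex with the shortcut, and whichever edge it takes
  there, it then has to cross the gap.\<close>

lemma Zn_gap_occurs:
  assumes x: "x \<in> Zn n" and n: "n \<ge> 1"
  obtains j where "N \<le> j" "j \<le> N + 10 ^ n" "\<And>t. 1 \<le> t \<Longrightarrow> t < 2 ^ n \<Longrightarrow> \<not> x (j + t)"
proof -
  obtain p where p: "\<And>i. (p i, x i, p (Suc i)) \<in> G n"
    using x by (auto simp: Zn_def presented_shift_def)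
  define L :: nat where "L = 10 ^ n"
  define c :: nat where "c = L - 2 ^ n"
  have pow: "2 ^ n \<le> L" "(2::nat) ^ n \<ge> 2"
    using n two_power_le_ten_power power_increasing[of 1 n "2::nat"] by (auto simp: L_def)
  have cL: "c < L" "c + 2 ^ n = L" using pow by (auto simp: c_def)
  have pL: "p i < L" for i using G_vertices[OF p] by (simp add: L_def)
  have stepL: "p i \<noteq> c \<Longrightarrow> p (Suc i) = (p i + 1) mod L" for i
    using G_step[OF p[of i]] by (simp add: L_def c_def)
  have up: "p (i + s) = p i + s" if "\<And>s'. s' < s \<Longrightarrow> p i + s' \<noteq> c" "p i + s < L" for i s
    using that
  proof (induction s)
    case (Suc s)
    then have "p (i + s) = p i + s" "p i + s \<noteq> c" by auto
    then show ?case using stepL[of "i + s"] Suc.prems by simp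
  qed simp
  have up_wrap: "p (i + s) = (p i + s) mod L" if "c < p i" "p i + s \<le> L" for i s
  proof (cases "p i + s < L")
    case True
    then show ?thesis using up[of s i] that by simp
  next
    case False
    then have eq: "p i + s = L" using that by simp
    with pL[of i] obtain s' where s': "s = Suc s'" by (cases s) auto
    then have "p (i + s') = p i + s'" using up[of s' i] that eq by simp
    then show ?thesis using stepL[of "i + s'"] s' eq that by simp
  qed
  have low: "\<exists>j. i \<le> j \<and> j \<le> i + c \<and> p j = c" if "p i \<le> c" for i
    using up[of "c - p i" i] that cL by (intro exI[of _ "i + (c - p i)"]) auto
  have "\<exists>j. N \<le> j \<and> j \<le> N + L \<and> p j = c"
  proof (cases "p N \<le> c")
    case True
    then show ?thesis using low[of N] cL by (meson le_trans add_left_mono less_imp_le)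
  next
    case False
    then have "p (N + (L - p N)) = 0" using up_wrap[of N "L - p N"] pL[of N] by simp
    then obtain j where "N + (L - p N) \<le> j" "j \<le> N + (L - p N) + c" "p j = c"
      using low[of "N + (L - p N)"] by auto
    then show ?thesis using False pL[of N] by (intro exI[of _ j]) auto
  qed
  then obtain j where j: "N \<le> j" "j \<le> N + L" "p j = c" by blast
  have "\<not> x (j + t)" if t: "1 \<le> t" "t < 2 ^ n" for t
  proof -
    have False if "c + t < L" "p (j + t) = (c + t) mod L" "x (j + t)"
      using G_True_not_gap[of "p (j + t)" "p (Suc (j + t))" n] p[of "j + t"] that t
      by (auto simp: gap_def L_def c_def)
    moreover have False if "c + t + 1 \<le> L" "p (j + t) = (c + t + 1) mod L" "x (j + t)"
    proof -
      have "gap n (p (j + t))" using that(1,2) t pL[of "j + t"]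
        by (cases "c + t + 1 = L") (auto simp: gap_def L_def c_def)
      then show False using G_True_not_gap[of "p (j + t)" "p (Suc (j + t))" n] p[of "j + t"] that by auto
    qed
    moreover have "p (j + t) = (c + t) mod L \<or> p (j + t) = (c + t + 1) mod L"
    proof -
      have *: "p (j + t) = (p (Suc j) + (t - 1)) mod L" if "c < p (Suc j)" "p (Suc j) + (t - 1) \<le> L"
        using up_wrap[OF that] t by simp
      have "p (Suc j) = (c + 1) mod L \<or> p (Suc j) = (c + 2) mod L"
        using G_step_or_shortcut[OF p[of j]] j(3) by (auto simp: L_def)
      moreover have ?thesis if "p (Suc j) = (c + 1) mod L"
      proof -
        have "p (Suc j) = c + 1" using that cL pow by simp
        then show ?thesis using * t cL by simp
      qed
      moreover have ?thesis if "p (Suc j) = (c + 2) mod L"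
      proof (cases "c + 2 = L")
        case True
        then have "t = 1" using t cL by simp
        then show ?thesis using that by simp
      next
        case False
        then have "p (Suc j) = c + 2" using that cL pow by simp
        then show ?thesis using * t cL by simp
      qed
      ultimately show ?thesis by blast
    qed
    ultimately show ?thesis using t cL by auto
  qed
  then show ?thesis using that j by (auto simp: L_def)
qed

text \<open>A gap of a sufficiently high level of one point is so long that it contains a whole gap of a
  given lower level of the other point.\<close>

lemma proximal_Z: "proximal Z"
  unfolding proximal_def
proof (intro ballI)
  fix x y assume x: "x \<in> Z" and y: "y \<in> Z"
  let ?d = "\<lambda>n. ereal (rho ((shift ^^ n) x) ((shift ^^ n) y))"
  have close: "\<exists>n\<ge>N. rho ((shift ^^ n) x) ((shift ^^ n) y) < (1/2) ^ k" for N k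
  proof -
    obtain n :: nat where n: "n \<ge> 1" "k + 1 < 2 ^ n"
      using less_exp[of "k + 2"] by (intro that[of "k + 2"]) (auto intro: less_trans[of _ "k + 2"])
    (* a gap of level m is longer than one tour at level n followed by a gap of level n *)
    obtain m :: nat where m: "m \<ge> 1" "1 + 10 ^ n + 2 ^ n \<le> (2::nat) ^ m"
      using less_exp[of "1 + 10 ^ n + 2 ^ n"] by (intro that[of "1 + 10 ^ n + 2 ^ n"]) auto
    have "y \<in> Zn m" "x \<in> Zn n" using x y n m by (auto simp: Z_def)
    obtain j where j: "N \<le> j" "\<And>t. 1 \<le> t \<Longrightarrow> t < 2 ^ m \<Longrightarrow> \<not> y (j + t)"
      using Zn_gap_occurs[OF \<open>y \<in> Zn m\<close> m(1), of N] by blast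
    obtain i where i: "j \<le> i" "i \<le> j + 10 ^ n" "\<And>t. 1 \<le> t \<Longrightarrow> t < 2 ^ n \<Longrightarrow> \<not> x (i + t)"
      using Zn_gap_occurs[OF \<open>x \<in> Zn n\<close> n(1), of j] by blast
    have "x (i + 1 + s) = y (i + 1 + s)" if "s \<le> k" for s
    proof -
      have "\<not> x (i + (1 + s))" using that n by (intro i(3)) auto
      moreover have "\<not> y (j + (i - j + 1 + s))" using that n m i(1,2) by (intro j(2)) auto
      ultimately show ?thesis using i(1) by (simp add: add.assoc)
    qed
    then show ?thesis using i(1) j(1)
      unfolding rho_less_iff shift_iterate by (intro exI[of _ "i + 1"]) auto
  qed
  have "\<not> 0 < liminf ?d"
  proof
    assume "0 < liminf ?d"
    then obtain c where c: "0 < c" "c < liminf ?d" using dense by blast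
    have "\<exists>r::real. 0 < r \<and> ereal r \<le> c"
      using c(1) by (cases c) (auto intro: exI[of _ 1])
    then obtain r where r: "0 < r" "ereal r \<le> c" by blast
    obtain N where N: "\<And>n. n \<ge> N \<Longrightarrow> c < ?d n"
      using less_LiminfD[OF c(2)] by (auto simp: eventually_sequentially)
    obtain k where k: "(1/2::real) ^ k < r" using real_arch_pow_inv[OF r(1), of "1/2"] by auto
    obtain n where n: "n \<ge> N" "rho ((shift ^^ n) x) ((shift ^^ n) y) < (1/2) ^ k" using close by blast
    from N[OF n(1)] r(2) have "ereal r < ?d n" by (rule le_less_trans[rotated])
    then show False using n(2) k by simp
  qed
  moreover have "0 \<le> liminf ?d"
    by (intro Liminf_bounded always_eventually allI) (simp add: rho_def)
  ultimately show "liminf ?d = 0" by simp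
qed

section \<open>The decimal odometer and random masks\<close>

abbreviation residue_space :: "(nat \<Rightarrow> nat) measure" where
  "residue_space \<equiv> PiM UNIV (\<lambda>_. count_space UNIV)"

abbreviation digits :: "(nat \<Rightarrow> nat) measure" where
  "digits \<equiv> PiM UNIV (\<lambda>_. measure_pmf (pmf_of_set {..<10}))"

text \<open>The residues modulo all powers of 10 of the 10-adic integer with the given digits. The digits are
  reduced so that the result is consistent for every argument.\<close>

definition residue :: "(nat \<Rightarrow> nat) \<Rightarrow> nat \<Rightarrow> nat" where
  "residue d m = (\<Sum>j<m. (d j mod 10) * 10 ^ j)"

text \<open>The Haar measure on the 10-adic integers, which are represented by their sequences of
  residues.\<close>

definition odometer :: "(nat \<Rightarrow> nat) measure" where
  "odometer = distr digits residue_space residue"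

lemma residue_less: "residue d m < 10 ^ m"
proof (induction m)
  case (Suc m)
  have "d m mod 10 * 10 ^ m \<le> 9 * 10 ^ m" by (intro mult_right_mono) (auto simp: less_Suc_eq_le[symmetric])
  moreover have "residue d (Suc m) = residue d m + d m mod 10 * 10 ^ m" by (simp add: residue_def)
  ultimately show ?case using Suc unfolding power_Suc by linarith
qed (simp add: residue_def)

lemma residue_consistent: "i \<le> m \<Longrightarrow> residue d m mod 10 ^ i = residue d i"
proof (induction m)
  case (Suc m)
  show ?case
  proof (cases "i = Suc m")
    case False
    then have "i \<le> m" using Suc.prems by simp
    then have "(10::nat) ^ i dvd d m mod 10 * 10 ^ m" by (simp add: le_imp_power_dvd)
    then have "residue d (Suc m) mod 10 ^ i = residue d m mod 10 ^ i"
      by (auto simp: residue_def elim!: dvdE)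
    then show ?thesis using Suc.IH \<open>i \<le> m\<close> by simp
  next
    case True
    then show ?thesis by (simp only: mod_less[OF residue_less])
  qed
qed (simp add: residue_def)

lemma residue_eq_iff:
  assumes "t < 10 ^ m"
  shows "residue d m = t \<longleftrightarrow> (\<forall>j<m. d j mod 10 = t div 10 ^ j mod 10)"
  using assms
proof (induction m arbitrary: t)
  case 0
  then show ?case by (simp add: residue_def)
next
  case (Suc m)
  have t: "t div 10 ^ m < 10" using Suc.prems by (simp add: less_mult_imp_div_less)
  have digit: "t mod 10 ^ m div 10 ^ j mod 10 = t div 10 ^ j mod 10" if j: "j < m" for j
  proof -
    obtain i where i: "m = j + Suc i" using less_imp_Suc_add[OF j] by auto
    have "t mod 10 ^ m div 10 ^ j = t div 10 ^ j mod 10 ^ Suc i"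
      unfolding i power_add mod_mult2_eq by simp
    also have "\<dots> mod 10 = t div 10 ^ j mod 10" by (rule mod_mod_cancel) simp
    finally show ?thesis .
  qed
  have "residue d (Suc m) = t \<longleftrightarrow> residue d m = t mod 10 ^ m \<and> d m mod 10 = t div 10 ^ m"
  proof
    assume *: "residue d (Suc m) = t"
    then have "t = residue d m + d m mod 10 * 10 ^ m" by (simp add: residue_def)
    then show "residue d m = t mod 10 ^ m \<and> d m mod 10 = t div 10 ^ m"
      using residue_less[of d m] by simp
  next
    assume "residue d m = t mod 10 ^ m \<and> d m mod 10 = t div 10 ^ m"
    then have "residue d (Suc m) = t mod 10 ^ m + t div 10 ^ m * 10 ^ m" by (simp add: residue_def)
    then show "residue d (Suc m) = t" by (simp only: mod_div_mult_eq)
  qed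
  also have "residue d m = t mod 10 ^ m \<longleftrightarrow> (\<forall>j<m. d j mod 10 = t div 10 ^ j mod 10)"
    using Suc.IH[of "t mod 10 ^ m"] digit by simp
  finally show ?case using t by (auto simp: less_Suc_eq)
qed

lemma residue_level_sets [simp]: "{\<theta>. \<theta> m \<in> B} \<in> sets residue_space"
proof -
  have "(\<lambda>\<theta>. \<theta> m) -` B \<inter> space residue_space \<in> sets residue_space"
    by (rule measurable_sets[where A = "count_space UNIV"]) auto
  then show ?thesis by (simp add: space_PiM vimage_def)
qed

lemma residue_level_measurable: "(\<lambda>d. residue d m) \<in> measurable digits (count_space UNIV)"
proof (subst measurable_count_space_eq2_countable, intro conjI ballI, simp_all)
  fix t
  show "(\<lambda>d. residue d m) -` {t} \<inter> space digits \<in> sets digits"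
  proof (cases "t < 10 ^ m")
    case True
    have "(\<lambda>d. residue d m) -` {t} \<inter> space digits =
      {d \<in> space digits. \<forall>j<m. d j mod 10 = t div 10 ^ j mod 10}"
      using residue_eq_iff[OF True] by auto
    also have "\<dots> \<in> sets digits" by measurable
    finally show ?thesis .
  next
    case False
    then have "(\<lambda>d. residue d m) -` {t} \<inter> space digits = {}" using residue_less by auto
    then show ?thesis by (metis sets.empty_sets)
  qed
qed

lemma residue_measurable [measurable]: "residue \<in> measurable digits residue_space"
  by (rule measurable_PiM_single'[where f = "\<lambda>m d. residue d m"])
    (auto simp: residue_level_measurable)

lemma prob_space_odometer: "prob_space odometer"
  unfolding odometer_def
  by (intro prob_space.prob_space_distr prob_space_PiM prob_space_measure_pmf) simp

interpretation odometer: prob_space odometer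
  by (rule prob_space_odometer)

lemma sets_odometer [measurable_cong, simp]: "sets odometer = sets residue_space"
  by (simp add: odometer_def)

lemma space_odometer [simp]: "space odometer = UNIV"
  by (simp add: odometer_def space_PiM)

lemma prob_residue:
  assumes "t < 10 ^ m"
  shows "emeasure digits {d \<in> space digits. residue d m = t} = ennreal (1 / 10 ^ m)"
proof -
  interpret P: product_prob_space "\<lambda>_::nat. measure_pmf (pmf_of_set {..<10::nat})" UNIV
    by unfold_locales
  have digit: "emeasure (measure_pmf (pmf_of_set {..<10::nat})) {e. e mod 10 = c} = ennreal (1 / 10)" if "c < 10" for c
  proof -
    have "{..<10} \<inter> {e. e mod 10 = c} = {c}" using that by auto
    then show ?thesis by (subst emeasure_pmf_of_set) (auto simp: lessThan_empty_iff)
  qed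
  define X where "X j = {e::nat. e mod 10 = t div 10 ^ j mod 10}" for j
  have X: "emeasure (measure_pmf (pmf_of_set {..<10::nat})) (X j) = ennreal (1 / 10)" for j
    unfolding X_def by (rule digit) simp
  have "{d \<in> space digits. residue d m = t} = {d \<in> space digits. \<forall>j\<in>{..<m}. d j \<in> X j}"
    using residue_eq_iff[OF assms] by (auto simp: X_def)
  then have "emeasure digits {d \<in> space digits. residue d m = t}
      = (\<Prod>j<m. emeasure (measure_pmf (pmf_of_set {..<10::nat})) (X j))"
    using P.emeasure_PiM_Collect[of "{..<m}" X] by simp
  then show ?thesis
    by (simp only: X prod_constant card_lessThan) (simp add: ennreal_power power_divide)
qed

text \<open>The residue modulo \<open>10 ^ m\<close> is determined by \<open>m\<close> independent uniform
  digits.\<close>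

lemma odometer_uniform:
  "distr odometer (count_space UNIV) (\<lambda>\<theta>. \<theta> m) = measure_pmf (pmf_of_set {..<10 ^ m})"
proof (rule measure_eqI_countable_AE[where \<Omega> = "{..<10 ^ m}"])
  have eq: "distr odometer (count_space UNIV) (\<lambda>\<theta>. \<theta> m) = distr digits (count_space UNIV) (\<lambda>d. residue d m)"
    unfolding odometer_def by (subst distr_distr) (auto simp: comp_def)
  show "AE x in distr odometer (count_space UNIV) (\<lambda>\<theta>. \<theta> m). x \<in> {..<10 ^ m}"
    unfolding eq by (subst AE_distr_iff) (auto simp: residue_level_measurable residue_less)
  show "AE x in measure_pmf (pmf_of_set {..<10 ^ m}). x \<in> {..<10 ^ m :: nat}"
    by (auto simp: AE_measure_pmf_iff lessThan_empty_iff)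
  fix t :: nat assume t: "t \<in> {..<10 ^ m}"
  have "emeasure (distr odometer (count_space UNIV) (\<lambda>\<theta>. \<theta> m)) {t} = emeasure digits ((\<lambda>d. residue d m) -` {t} \<inter> space digits)"
    unfolding eq by (rule emeasure_distr) (auto simp: residue_level_measurable)
  also have "(\<lambda>d. residue d m) -` {t} \<inter> space digits = {d \<in> space digits. residue d m = t}" by auto
  also have "emeasure digits \<dots> = ennreal (1 / 10 ^ m)" using prob_residue t by simp
  also have "\<dots> = emeasure (measure_pmf (pmf_of_set {..<10 ^ m})) {t}"
    using t by (simp add: emeasure_pmf_single pmf_of_set lessThan_empty_iff)
  finally show "emeasure (distr odometer (count_space UNIV) (\<lambda>\<theta>. \<theta> m)) {t} =
      emeasure (measure_pmf (pmf_of_set {..<10 ^ m})) {t}" .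
qed auto

lemma odometer_level_emeasure:
  "emeasure odometer {\<theta>. \<theta> m \<in> B} = emeasure (measure_pmf (pmf_of_set {..<10 ^ m})) B"
  unfolding odometer_uniform[symmetric]
  by (subst emeasure_distr) (auto intro!: arg_cong[where f = "emeasure odometer"])

lemma odometer_level_prob:
  "measure odometer {\<theta>. \<theta> m \<in> B} = card ({..<10 ^ m} \<inter> B) / 10 ^ m"
  using odometer_level_emeasure[of m B]
  by (simp add: measure_def[of odometer] measure_pmf_of_set lessThan_empty_iff
      flip: measure_def[of "measure_pmf (pmf_of_set {..<10 ^ m})"])

lemma odometer_consistent: "AE \<theta> in odometer. \<forall>m i. i \<le> m \<longrightarrow> \<theta> i = \<theta> m mod 10 ^ i"
  unfolding odometer_def
  by (subst AE_distr_iff) (auto simp: residue_consistent)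

definition odometer_succ :: "(nat \<Rightarrow> nat) \<Rightarrow> nat \<Rightarrow> nat" where
  "odometer_succ \<theta> m = (\<theta> m + 1) mod 10 ^ m"

lemma odometer_succ_measurable [measurable]: "odometer_succ \<in> measurable residue_space residue_space"
  unfolding odometer_succ_def[abs_def]
  by (rule measurable_PiM_single'[where f = "\<lambda>m \<theta>. (\<theta> m + 1) mod 10 ^ m"]) auto

lemma map_pmf_of_set_succ: 
  "map_pmf (\<lambda>t. (t + 1) mod 10 ^ m) (pmf_of_set {..<10 ^ m :: nat}) = pmf_of_set {..<10 ^ m}"
proof -
  let ?f = "\<lambda>t::nat. (t + 1) mod 10 ^ m"
  have "bij_betw ?f {..<10 ^ m} {..<10 ^ m}" by (rule bij_betw_add_mod) simp
  then have "inj_on ?f {..<10 ^ m}" "?f ` {..<10 ^ m} = {..<10 ^ m}"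
    by (auto simp: bij_betw_def)
  then show ?thesis by (subst map_pmf_of_set_inj) (auto simp: lessThan_empty_iff)
qed

text \<open>By consistency, an event about finitely many residues is almost surely an event about the residue of
  the highest level involved, and addition of 1 permutes the residues of that level.\<close>

lemma odometer_invariant: "distr odometer residue_space odometer_succ = odometer"
proof (rule measure_eqI_PiM_infinite[where M = "\<lambda>_. count_space UNIV" and I = UNIV])
  show "finite_measure (distr odometer residue_space odometer_succ)"
    by (intro prob_space.finite_measure prob_space.prob_space_distr prob_space_odometer) simp
  fix A :: "nat \<Rightarrow> nat set" and J :: "nat set"
  assume J: "finite J"
  define E where "E = prod_emb UNIV (\<lambda>_. count_space UNIV) J (Pi\<^sub>E J A)"
  have E: "E = {\<theta>. \<forall>i\<in>J. \<theta> i \<in> A i}" by (auto simp: E_def prod_emb_def space_PiM PiE_iff)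
  have [measurable]: "E \<in> sets residue_space" unfolding E_def using J by (intro sets_PiM_I) auto
  define M where "M = Max (insert 0 J)"
  have M: "i \<le> M" if "i \<in> J" for i using J that by (auto simp: M_def)
  define B where "B = {t. \<forall>i\<in>J. t mod 10 ^ i \<in> A i}"
  have "emeasure odometer E = emeasure odometer {\<theta>. \<theta> M \<in> B}"
  proof (rule emeasure_eq_AE)
    show "AE \<theta> in odometer. (\<theta> \<in> E) = (\<theta> \<in> {\<theta>. \<theta> M \<in> B})"
      using odometer_consistent
    proof eventually_elim
      case (elim \<theta>)
      then have "\<theta> i = \<theta> M mod 10 ^ i" if "i \<in> J" for i using M[OF that] by blast
      then show ?case by (auto simp: E B_def)
    qed
  qed (auto simp: pred_def[symmetric])
  also have "\<dots> = emeasure (measure_pmf (pmf_of_set {..<10 ^ M})) B" by (rule odometer_level_emeasure)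
  also have "\<dots> = emeasure (measure_pmf (pmf_of_set {..<10 ^ M})) {t. (t + 1) mod 10 ^ M \<in> B}"
    by (subst map_pmf_of_set_succ[symmetric]) (simp add: vimage_def)
  also have "\<dots> = emeasure odometer {\<theta>. \<theta> M \<in> {t. (t + 1) mod 10 ^ M \<in> B}}"
    by (rule odometer_level_emeasure[symmetric])
  also have "\<dots> = emeasure odometer (odometer_succ -` E \<inter> space odometer)"
  proof (rule emeasure_eq_AE)
    show "AE \<theta> in odometer. (\<theta> \<in> {\<theta>. \<theta> M \<in> {t. (t + 1) mod 10 ^ M \<in> B}}) = (\<theta> \<in> odometer_succ -` E \<inter> space odometer)"
      using odometer_consistent
    proof eventually_elim
      case (elim \<theta>)
      have "(\<theta> M + 1) mod 10 ^ M mod 10 ^ i = (\<theta> i + 1) mod 10 ^ i" if "i \<in> J" for i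
      proof -
        have "(\<theta> M + 1) mod 10 ^ M mod 10 ^ i = (\<theta> M + 1) mod 10 ^ i"
          using M[OF that] by (intro mod_mod_cancel le_imp_power_dvd)
        also have "\<dots> = (\<theta> M mod 10 ^ i + 1) mod 10 ^ i" by (simp only: mod_add_left_eq)
        finally show ?thesis using elim M[OF that] by metis
      qed
      then show ?case by (auto simp: E B_def odometer_succ_def)
    qed
  next
    show "{\<theta>. \<theta> M \<in> {t. (t + 1) mod 10 ^ M \<in> B}} \<in> sets odometer"
      unfolding sets_odometer by (rule residue_level_sets)
    show "odometer_succ -` E \<inter> space odometer \<in> sets odometer" by measurable
  qed
  also have "\<dots> = emeasure (distr odometer residue_space odometer_succ) E"
    by (rule emeasure_distr[symmetric]) auto
  finally show "emeasure (distr odometer residue_space odometer_succ) E = emeasure odometer E" by simp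
qed auto

text \<open>A sequence of residues fixes the position of the gaps of all levels at once; masked are the
  positions that lie in a gap of level \<open>k\<close> or higher.\<close>

definition masked :: "nat \<Rightarrow> (nat \<Rightarrow> nat) \<Rightarrow> nat \<Rightarrow> bool" where
  "masked k \<theta> i \<longleftrightarrow> (\<exists>m\<ge>k. gap m (\<theta> m + i))"

lemma masked_measurable [measurable]: "Measurable.pred residue_space (\<lambda>\<theta>. masked k \<theta> i)"
proof -
  have [measurable]: "Measurable.pred residue_space (\<lambda>\<theta>. gap m (\<theta> m + i))" for m
    by (rule measurable_compose[of "\<lambda>\<theta>. \<theta> m" _ "count_space UNIV"]) auto
  show ?thesis unfolding masked_def by measurable
qed

text \<open>The gap of level \<open>m\<close> occupies the fraction \<open>(1/5) ^ m\<close> of the cycle, and these fractions are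
  summable.\<close>

lemma prob_masked_le:
  assumes "k \<ge> 1"
  shows "measure odometer {\<theta>. masked k \<theta> i} \<le> (1/5) ^ k * (5/4)"
proof -
  have p: "measure odometer {\<theta>. gap m (\<theta> m + i)} = (1/5) ^ m" if "m \<ge> 1" for m
  proof -
    have "measure odometer {\<theta>. \<theta> m \<in> {t. gap m (t + i)}} = card ({..<10 ^ m} \<inter> {t. gap m (t + i)}) / 10 ^ m"
      by (rule odometer_level_prob)
    also have "{..<10 ^ m} \<inter> {t. gap m (t + i)} = {t. t < 10 ^ m \<and> gap m (t + i)}" by auto
    also have "card \<dots> = 2 ^ m" by (rule card_gap[OF that])
    also have "real (2 ^ m) / 10 ^ m = (2 / 10) ^ m" by (simp only: power_divide of_nat_power of_nat_numeral)
    finally show ?thesis by simp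
  qed
  have gap_sets: "{\<theta>. gap m (\<theta> m + i)} \<in> sets residue_space" for m
    using residue_level_sets[of m "{t. gap m (t + i)}"] by simp
  have p': "measure odometer {\<theta>. gap (k + j) (\<theta> (k + j) + i)} = (1/5) ^ k * (1/5) ^ j" for j
    using p[of "k + j"] assms by (simp add: power_add)
  have s: "(\<lambda>j. (1/5) ^ k * (1/5::real) ^ j) sums ((1/5) ^ k * (5/4))"
    using sums_mult[OF geometric_sums[of "1/5::real"], of "(1/5) ^ k"] by simp
  have "{\<theta>. masked k \<theta> i} = (\<Union>j. {\<theta>. gap (k + j) (\<theta> (k + j) + i)})"
    unfolding masked_def using le_iff_add by auto
  also have "measure odometer \<dots> \<le> (\<Sum>j. measure odometer {\<theta>. gap (k + j) (\<theta> (k + j) + i)})"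
    using s by (intro odometer.finite_measure_subadditive_countably) (auto simp: p' sums_iff gap_sets)
  also have "\<dots> = (1/5) ^ k * (5/4)" using s by (simp add: p' sums_iff)
  finally show ?thesis .
qed

section \<open>Topological entropy\<close>

text \<open>Fekete's lemma.\<close>

lemma subadditive_limit:
  fixes a :: "nat \<Rightarrow> real"
  assumes sub: "\<And>m n. a (m + n) \<le> a m + a n" and nonneg: "\<And>n. 0 \<le> a n"
  obtains L where "(\<lambda>n. a n / real n) \<longlonglongrightarrow> L" "\<And>n. n \<ge> 1 \<Longrightarrow> L \<le> a n / real n"
proof -
  define S where "S = (\<lambda>n. a n / real n) ` {1..}"
  define L where "L = Inf S"
  have bdd: "bdd_below S" using nonneg by (intro bdd_belowI[of _ 0]) (auto simp: S_def)
  have L: "L \<le> a n / real n" if "n \<ge> 1" for n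
    unfolding L_def using bdd that by (intro cInf_lower) (auto simp: S_def)
  have mult: "a (q * m + r) \<le> real q * a m + a r" for q m r
  proof (induction q)
    case (Suc q)
    have "a (Suc q * m + r) \<le> a m + a (q * m + r)" using sub[of m "q * m + r"] by (simp add: add.assoc)
    with Suc show ?case by (simp add: algebra_simps)
  qed simp
  have "(\<lambda>n. a n / real n) \<longlonglongrightarrow> L"
  proof (rule LIMSEQ_I)
    fix e :: real assume e: "e > 0"
    have "Inf S < L + e / 2" using e by (simp add: L_def)
    then obtain m where m: "m \<ge> 1" "a m / real m < L + e / 2"
      using cInf_lessD[of S "L + e / 2"] by (auto simp: S_def)
    define C where "C = Max (a ` {..<m})"
    obtain N where N: "real N > 2 * C / e" using reals_Archimedean2 by blast
    show "\<exists>no. \<forall>n\<ge>no. norm (a n / real n - L) < e"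
    proof (intro exI[of _ "Suc N"] allI impI)
      fix n assume n: "Suc N \<le> n"
      then have n0: "real n > 0" by simp
      have "2 * C / e < real n" using N n by linarith
      then have Cn: "C / real n < e / 2" using e n0 by (simp add: field_simps)
      have "a n \<le> real (n div m) * a m + a (n mod m)" using mult[of "n div m" m "n mod m"] by simp
      also have "a (n mod m) \<le> C" unfolding C_def using m by (intro Max_ge) auto
      also have "real (n div m) * a m \<le> real n / real m * a m"
        using nonneg by (intro mult_right_mono) (auto simp: of_nat_div_le_of_nat)
      finally have "a n / real n \<le> (real n / real m * a m + C) / real n"
        using n0 by (simp add: divide_right_mono)
      also have "\<dots> = a m / real m + C / real n" using n0 by (simp add: field_simps)
      finally have "a n / real n < L + e" using m(2) Cn by linarith
      moreover have "L \<le> a n / real n" using L[of n] n by simp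
      ultimately show "norm (a n / real n - L) < e" by simp
    qed
  qed
  then show ?thesis using that L by blast
qed

lemma finite_words_of_length: "finite (words_of_length X n)"
  by (rule finite_subset[OF _ finite_lists_length_eq[of "UNIV :: bool set" n]]) (auto simp: words_of_length_def)

lemma words_of_length_Z: "words_of_length Z n = (\<lambda>x. map x [0..<n]) ` Z"
  unfolding words_of_length_def words_iff_initial
  by auto

lemma card_words_subadditive:
  "card (words_of_length Z (m + n)) \<le> card (words_of_length Z m) * card (words_of_length Z n)"
proof -
  have "(\<lambda>w. (take m w, drop m w)) ` words_of_length Z (m + n) \<subseteq> words_of_length Z m \<times> words_of_length Z n"
  proof
    fix p assume "p \<in> (\<lambda>w. (take m w, drop m w)) ` words_of_length Z (m + n)"
    then obtain x where x: "x \<in> Z" "p = (take m (map x [0..<m + n]), drop m (map x [0..<m + n]))"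
      unfolding words_of_length_Z by auto
    have "take m (map x [0..<m + n]) = map x [0..<m]" by (simp add: take_map)
    moreover have "drop m (map x [0..<m + n]) = map (\<lambda>i. x (m + i)) [0..<n]"
      by (intro nth_equalityI) auto
    ultimately show "p \<in> words_of_length Z m \<times> words_of_length Z n"
      using x Z_shift[OF x(1), of m] unfolding words_of_length_Z by auto
  qed
  moreover have "inj_on (\<lambda>w. (take m w, drop m w)) (words_of_length Z (m + n))"
    by (rule inj_onI) (metis append_take_drop_id prod.inject)
  ultimately have "card (words_of_length Z (m + n)) \<le> card (words_of_length Z m \<times> words_of_length Z n)"
    by (intro card_inj_on_le) (auto intro: finite_words_of_length)
  then show ?thesis by (simp add: card_cartesian_product)
qed

lemma unmasked_in_Z:
  assumes "\<And>i. x i \<Longrightarrow> \<not> masked 1 \<theta> i"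
  shows "x \<in> Z"
  unfolding Z_def using assms by (auto simp: masked_def intro!: in_ZnI[where t = "\<theta> _"])

text \<open>On average at most a quarter of the positions are masked, and by heredity the remaining ones can
  be filled independently.\<close>

lemma many_words: "2 ^ (n div 2) \<le> card (words_of_length Z n)"
proof (cases "n = 0")
  case True
  then have "words_of_length Z n = {[]}" using zero_in_Z by (auto simp: words_of_length_Z)
  then show ?thesis using True by simp
next
  case False
  define U where "U \<theta> = {i. i < n \<and> \<not> masked 1 \<theta> i}" for \<theta>
  have "\<exists>\<theta>. n div 2 \<le> card (U \<theta>)"
  proof (rule ccontr)
    assume "\<not> ?thesis"
    then have less: "card (U \<theta>) \<le> n div 2" for \<theta> by (meson nat_le_linear)
    define f where "f \<theta> = (\<Sum>i<n. indicator {\<theta>. \<not> masked 1 \<theta> i} \<theta> :: real)" for \<theta>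
    have f: "f \<theta> = card (U \<theta>)" for \<theta>
    proof -
      have "f \<theta> = (\<Sum>i<n. indicator (U \<theta>) i)"
        unfolding f_def by (rule sum.cong) (auto simp: U_def indicator_def)
      also have "\<dots> = card ({..<n} \<inter> U \<theta>)" by (simp add: indicator_def Int_def)
      also have "{..<n} \<inter> U \<theta> = U \<theta>" by (auto simp: U_def)
      finally show ?thesis .
    qed
    have unmasked_sets [measurable]: "{\<theta>. \<not> masked 1 \<theta> i} \<in> sets odometer" for i
    proof -
      have "Measurable.pred residue_space (\<lambda>\<theta>. \<not> masked 1 \<theta> i)" by measurable
      then show ?thesis by (simp add: pred_def space_PiM)
    qed
    have "real n * (3/4) \<le> (\<Sum>i<n. measure odometer {\<theta>. \<not> masked 1 \<theta> i})"
    proof -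
      have "3/4 \<le> measure odometer {\<theta>. \<not> masked 1 \<theta> i}" for i
      proof -
        have "{\<theta>. \<not> masked 1 \<theta> i} = space odometer - {\<theta>. masked 1 \<theta> i}" by auto
        moreover have "{\<theta>. masked 1 \<theta> i} \<in> sets odometer"
          using masked_measurable[of 1 i] by (simp add: pred_def space_PiM)
        ultimately have "measure odometer {\<theta>. \<not> masked 1 \<theta> i} = 1 - measure odometer {\<theta>. masked 1 \<theta> i}"
          using odometer.prob_compl[of "{\<theta>. masked 1 \<theta> i}"] by simp
        then show ?thesis using prob_masked_le[of 1 i] by simp
      qed
      then show ?thesis using sum_mono[of "{..<n}" "\<lambda>_. 3/4::real" "\<lambda>i. measure odometer {\<theta>. \<not> masked 1 \<theta> i}"] by simp
    qed
    also have "\<dots> = (\<integral>\<theta>. f \<theta> \<partial>odometer)"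
      unfolding f_def
      by (subst Bochner_Integration.integral_sum)
        (auto intro!: integrable_real_indicator unmasked_sets simp: less_top[symmetric] simp del: One_nat_def sets_odometer)
    also have "\<dots> \<le> real (n div 2)"
    proof (rule odometer.integral_le_const)
      show "integrable odometer f" unfolding f_def
        by (intro Bochner_Integration.integrable_sum integrable_real_indicator unmasked_sets)
          (simp add: less_top[symmetric])
      show "AE \<theta> in odometer. f \<theta> \<le> real (n div 2)" using less by (auto simp: f)
    qed
    also have "\<dots> \<le> real n / 2" by linarith
    finally show False using False by simp
  qed
  then obtain \<theta> where \<theta>: "n div 2 \<le> card (U \<theta>)" by blast
  have inj: "inj_on (\<lambda>S. map (\<lambda>i. i \<in> S) [0..<n]) (Pow (U \<theta>))"
    by (rule inj_onI) (auto simp: U_def)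
  have "(\<lambda>S. map (\<lambda>i. i \<in> S) [0..<n]) ` Pow (U \<theta>) \<subseteq> words_of_length Z n"
    unfolding words_of_length_Z by (auto simp: U_def intro!: imageI unmasked_in_Z[where \<theta> = \<theta>])
  then have "card (Pow (U \<theta>)) \<le> card (words_of_length Z n)"
    using inj finite_words_of_length by (intro card_inj_on_le) auto
  moreover have "card (Pow (U \<theta>)) = 2 ^ card (U \<theta>)" by (rule card_Pow) (auto simp: U_def)
  moreover have "(2::nat) ^ (n div 2) \<le> 2 ^ card (U \<theta>)" using \<theta> by (intro power_increasing) auto
  ultimately show ?thesis by linarith
qed

lemma topological_entropy_Z_pos: "topological_entropy Z > 0"
proof -
  define a where "a n = ln (real (card (words_of_length Z n)))" for n
  have pos: "card (words_of_length Z n) \<ge> 1" for n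
    using many_words[of n] by (meson le_trans one_le_power one_le_numeral)
  have "a (m + n) \<le> a m + a n" for m n
  proof -
    have "real (card (words_of_length Z (m + n))) \<le> real (card (words_of_length Z m)) * real (card (words_of_length Z n))"
      using card_words_subadditive[of m n] by (metis of_nat_le_iff of_nat_mult)
    then have "a (m + n) \<le> ln (real (card (words_of_length Z m)) * real (card (words_of_length Z n)))"
      unfolding a_def using pos[of "m + n"] by (intro ln_mono) auto
    also have "\<dots> = a m + a n"
      unfolding a_def using pos[of m] pos[of n] by (intro ln_mult_pos) auto
    finally show ?thesis .
  qed
  moreover have "0 \<le> a n" for n using pos[of n] by (simp add: a_def)
  ultimately obtain L where L: "(\<lambda>n. a n / real n) \<longlonglongrightarrow> L"
    by (rule subadditive_limit)
  have "ln 2 / 4 \<le> a n / real n" if "n \<ge> 2" for n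
  proof -
    have "real (n div 2) * ln 2 = ln (2 ^ (n div 2))" by (simp add: ln_realpow)
    also have "\<dots> \<le> a n" unfolding a_def
      using many_words[of n] by (intro ln_mono) (auto simp flip: of_nat_le_iff)
    finally have "real (n div 2) * ln 2 \<le> a n" .
    moreover have "real n / 4 \<le> real (n div 2)" using that by linarith
    ultimately have "real n / 4 * ln 2 \<le> a n"
      by (meson ln_ge_zero mult_right_mono one_le_numeral order_trans)
    then show ?thesis using that by (simp add: field_simps)
  qed
  then have "ln 2 / 4 \<le> L" using L by (intro tendsto_lowerbound[OF L]) (auto simp: eventually_sequentially)
  moreover have "topological_entropy Z = L"
    using L unfolding topological_entropy_def a_def by (rule limI)
  moreover have "ln (2::real) > 0" by simp
  ultimately show ?thesis by linarith
qed

section \<open>Entropy of finite-valued random variables\<close>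

definition eta :: "real \<Rightarrow> real" where
  "eta p = - (p * ln p)"

text \<open>Only values that are attained contribute; this makes the entropy independent of the type of
  values.\<close>

definition shannon :: "'a measure \<Rightarrow> ('a \<Rightarrow> 'b) \<Rightarrow> real" where
  "shannon M X = (\<Sum>x\<in>X ` space M. eta (measure M (X -` {x} \<inter> space M)))"

lemma eta_0 [simp]: "eta 0 = 0" and eta_1 [simp]: "eta 1 = 0"
  by (auto simp: eta_def)

lemma eta_nonneg: "0 \<le> p \<Longrightarrow> p \<le> 1 \<Longrightarrow> 0 \<le> eta p"
  by (cases "p = 0") (auto simp: eta_def mult_nonneg_nonpos)

lemma eta_le_sqrt:
  assumes "0 \<le> p"
  shows "eta p \<le> 2 * sqrt p"
proof (cases "p = 0")
  case False
  define s where "s = sqrt p"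
  have s: "s > 0" "p = s * s" using False assms by (auto simp: s_def)
  have "ln (1 / s) \<le> 1 / s - 1" using s by (intro ln_le_minus_one) auto
  then have "- ln s \<le> 1 / s" using s by (simp add: ln_div)
  then have "2 * (s * s) * (- ln s) \<le> 2 * (s * s) * (1 / s)" using s by (intro mult_left_mono) auto
  moreover have "eta p = 2 * (s * s) * (- ln s)" using s by (simp add: eta_def ln_mult)
  ultimately show ?thesis using s by (simp add: s_def[symmetric])
qed simp

lemma continuous_on_eta: "continuous_on {0..1} eta"
proof (rule continuous_on_eq_continuous_within[THEN iffD2], intro ballI)
  fix p :: real assume p: "p \<in> {0..1}"
  show "continuous (at p within {0..1}) eta"
  proof (cases "p = 0")
    case False
    then have "isCont eta p" using p unfolding eta_def[abs_def] by (intro continuous_intros) auto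
    then show ?thesis by (rule continuous_at_imp_continuous_within)
  next
    case True
    have "(eta \<longlongrightarrow> 0) (at 0 within {0..1})"
    proof (rule tendsto_sandwich[where f = "\<lambda>_. 0" and h = "\<lambda>p. 2 * sqrt p"])
      have "((\<lambda>p. 2 * sqrt p) \<longlongrightarrow> 2 * sqrt 0) (at (0::real) within {0..1})"
        by (intro tendsto_intros)
      then show "((\<lambda>p. 2 * sqrt p) \<longlongrightarrow> 0) (at (0::real) within {0..1})" by simp
    qed (auto simp: eventually_at_filter eta_nonneg eta_le_sqrt)
    then show ?thesis using True by (simp add: continuous_within)
  qed
qed

lemma measure_fibre_eq:
  "measure M (X -` {x} \<inter> space M) = measure M {\<omega> \<in> space M. X \<omega> = x}"
  by (rule arg_cong[where f = "measure M"]) auto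

context prob_space
begin

lemma shannon_superset:
  assumes "finite S" "X ` space M \<subseteq> S"
  shows "shannon M X = (\<Sum>x\<in>S. eta (prob (X -` {x} \<inter> space M)))"
  unfolding shannon_def using assms
proof (intro sum.mono_neutral_left ballI)
  fix x assume "x \<in> S - X ` space M"
  then have "X -` {x} \<inter> space M = {}" by auto
  then show "eta (prob (X -` {x} \<inter> space M)) = 0" by simp
qed auto

lemma shannon_cong: "(\<And>\<omega>. \<omega> \<in> space M \<Longrightarrow> X \<omega> = Y \<omega>) \<Longrightarrow> shannon M X = shannon M Y"
  unfolding shannon_def by (intro sum.cong arg_cong[where f = "\<lambda>A. eta (prob A)"]) auto

lemma shannon_eq_entropy:
  assumes "simple_function M X"
  shows "shannon M X = entropy (exp 1) (count_space (X ` space M)) X"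
proof -
  interpret information_space M "exp 1" by unfold_locales simp
  have "simple_distributed M X (\<lambda>x. prob (X -` {x} \<inter> space M))"
    using assms by (rule simple_distributedI) (auto simp: measure_nonneg)
  from entropy_simple_distributed[OF this] show ?thesis
    by (simp add: shannon_def eta_def sum_negf log_ln[symmetric])
qed

lemma shannon_nonneg: "0 \<le> shannon M X"
  unfolding shannon_def by (intro sum_nonneg eta_nonneg) auto

lemma simple_functionI_determined:
  assumes Y: "simple_function M Y"
    and det: "\<And>\<omega> \<omega>'. \<omega> \<in> space M \<Longrightarrow> \<omega>' \<in> space M \<Longrightarrow> Y \<omega> = Y \<omega>' \<Longrightarrow> X \<omega> = X \<omega>'"
  shows "\<exists>f. (\<forall>\<omega>\<in>space M. X \<omega> = f (Y \<omega>)) \<and> simple_function M X"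
proof -
  define f where "f y = X (SOME \<omega>. \<omega> \<in> space M \<and> Y \<omega> = y)" for y
  have f: "X \<omega> = f (Y \<omega>)" if "\<omega> \<in> space M" for \<omega>
  proof -
    have "(SOME \<omega>'. \<omega>' \<in> space M \<and> Y \<omega>' = Y \<omega>) \<in> space M \<and> Y (SOME \<omega>'. \<omega>' \<in> space M \<and> Y \<omega>' = Y \<omega>) = Y \<omega>"
      by (rule someI[of _ \<omega>]) (use that in auto)
    then show ?thesis unfolding f_def using det[OF that] by metis
  qed
  moreover have "simple_function M X"
    using simple_function_compose[OF Y, of f] simple_function_cong[of M X "f \<circ> Y"] f by auto
  ultimately show ?thesis by blast
qed

lemma shannon_mono:
  assumes Y: "simple_function M Y"
    and det: "\<And>\<omega> \<omega>'. \<omega> \<in> space M \<Longrightarrow> \<omega>' \<in> space M \<Longrightarrow> Y \<omega> = Y \<omega>' \<Longrightarrow> X \<omega> = X \<omega>'"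
  shows "shannon M X \<le> shannon M Y"
proof -
  interpret information_space M "exp 1" by unfold_locales simp
  have "\<exists>f. (\<forall>\<omega>\<in>space M. X \<omega> = f (Y \<omega>)) \<and> simple_function M X"
    by (rule simple_functionI_determined[OF Y]) (rule det)
  then obtain f where f: "\<And>\<omega>. \<omega> \<in> space M \<Longrightarrow> X \<omega> = f (Y \<omega>)" by blast
  have fY: "simple_function M (f \<circ> Y)" using Y by (rule simple_function_compose)
  have "shannon M X = shannon M (f \<circ> Y)" using f by (intro shannon_cong) auto
  also have "\<dots> \<le> shannon M Y"
    unfolding shannon_eq_entropy[OF fY] shannon_eq_entropy[OF Y] using Y by (rule entropy_data_processing)
  finally show ?thesis .
qed

lemma shannon_eqI:
  assumes "simple_function M X" "simple_function M Y"
    and "\<And>\<omega> \<omega>'. \<omega> \<in> space M \<Longrightarrow> \<omega>' \<in> space M \<Longrightarrow> Y \<omega> = Y \<omega>' \<longleftrightarrow> X \<omega> = X \<omega>'"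
  shows "shannon M X = shannon M Y"
  using assms by (intro antisym shannon_mono) auto

lemma sum_over_fibres:
  fixes g :: "'b \<Rightarrow> real"
  assumes X: "simple_function M X"
  shows "(\<Sum>x\<in>X ` space M. prob (X -` {x} \<inter> space M) * g x) = (\<integral>\<omega>. g (X \<omega>) \<partial>M)"
proof -
  have [simp]: "finite (X ` space M)" "\<And>x. X -` {x} \<inter> space M \<in> events"
    using X by (auto simp: simple_functionD)
  have "(\<integral>\<omega>. g (X \<omega>) \<partial>M) = (\<integral>\<omega>. (\<Sum>x\<in>X ` space M. g x * indicator (X -` {x} \<inter> space M) \<omega>) \<partial>M)"
  proof (rule Bochner_Integration.integral_cong)
    fix \<omega> assume \<omega>: "\<omega> \<in> space M"
    have "(\<Sum>x\<in>X ` space M. g x * indicator (X -` {x} \<inter> space M) \<omega>) = (\<Sum>x\<in>X ` space M. if x = X \<omega> then g x else 0)"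
      using \<omega> by (intro sum.cong) (auto simp: indicator_def)
    also have "\<dots> = g (X \<omega>)" using \<omega> by (subst sum.delta) auto
    finally show "g (X \<omega>) = (\<Sum>x\<in>X ` space M. g x * indicator (X -` {x} \<inter> space M) \<omega>)" by simp
  qed simp
  also have "\<dots> = (\<Sum>x\<in>X ` space M. g x * prob (X -` {x} \<inter> space M))"
    by (subst Bochner_Integration.integral_sum)
      (auto intro!: integrable_real_mult_indicator integrable_mult_right integrable_real_indicator simp: less_top[symmetric])
  finally show ?thesis by (simp add: mult.commute)
qed

text \<open>Marginalisation; both sides are the integral of \<open>g (f (W \<omega>))\<close>.\<close>

lemma sum_over_coarser_fibres:
  fixes g :: "'c \<Rightarrow> real"
  assumes W: "simple_function M W"
  shows "(\<Sum>w\<in>W ` space M. prob (W -` {w} \<inter> space M) * g (f w)) =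
    (\<Sum>v\<in>(\<lambda>\<omega>. f (W \<omega>)) ` space M. prob ((\<lambda>\<omega>. f (W \<omega>)) -` {v} \<inter> space M) * g v)"
proof -
  have "simple_function M (\<lambda>\<omega>. f (W \<omega>))" using simple_function_compose[OF W, of f] by (simp add: comp_def)
  from sum_over_fibres[OF this, of g] show ?thesis
    using sum_over_fibres[OF W, of "\<lambda>w. g (f w)"] by simp
qed

text \<open>Strong subadditivity, that is, the conditional mutual information of \<open>X\<close> and
  \<open>Y\<close> given \<open>V\<close> is nonnegative.\<close>

lemma shannon_submodular:
  assumes X: "simple_function M X" and Y: "simple_function M Y" and V: "simple_function M V"
  shows "shannon M (\<lambda>\<omega>. (X \<omega>, Y \<omega>, V \<omega>)) + shannon M V
    \<le> shannon M (\<lambda>\<omega>. (X \<omega>, V \<omega>)) + shannon M (\<lambda>\<omega>. (Y \<omega>, V \<omega>))"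
proof -
  interpret information_space M "exp 1" by unfold_locales simp
  let ?W = "\<lambda>\<omega>. (X \<omega>, Y \<omega>, V \<omega>)"
  have YZ: "simple_function M (\<lambda>\<omega>. (Y \<omega>, V \<omega>))" and XZ: "simple_function M (\<lambda>\<omega>. (X \<omega>, V \<omega>))"
    using X Y V by (auto intro: simple_function_Pair)
  have W: "simple_function M ?W" using X YZ by (rule simple_function_Pair)
  define p where "p w = prob (?W -` {w} \<inter> space M)" for w
  define pz where "pz z = prob (V -` {z} \<inter> space M)" for z
  define pxz where "pxz w = prob ((\<lambda>\<omega>. (X \<omega>, V \<omega>)) -` {w} \<inter> space M)" for w
  define pyz where "pyz w = prob ((\<lambda>\<omega>. (Y \<omega>, V \<omega>)) -` {w} \<inter> space M)" for w
  have ev: "V -` {z} \<inter> space M \<in> events" "(\<lambda>\<omega>. (X \<omega>, V \<omega>)) -` {xz} \<inter> space M \<in> events"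
    "(\<lambda>\<omega>. (Y \<omega>, V \<omega>)) -` {yz} \<inter> space M \<in> events" for z xz yz
    using simple_functionD(2)[OF V] simple_functionD(2)[OF XZ] simple_functionD(2)[OF YZ] by auto
  have le: "p (x, y, z) \<le> pz z" "p (x, y, z) \<le> pxz (x, z)" "p (x, y, z) \<le> pyz (y, z)" for x y z
    unfolding p_def pz_def pxz_def pyz_def by (auto intro!: finite_measure_mono ev)
  have p0: "0 \<le> p w" for w by (simp add: p_def)
  have "simple_distributed M V pz" "simple_distributed M (\<lambda>\<omega>. (Y \<omega>, V \<omega>)) pyz"
    "simple_distributed M (\<lambda>\<omega>. (X \<omega>, V \<omega>)) pxz" "simple_distributed M ?W p"
    using simple_distributedI[OF V _ refl] simple_distributedI[OF YZ _ refl]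
      simple_distributedI[OF XZ _ refl] simple_distributedI[OF W _ refl]
    unfolding p_def pz_def pxz_def pyz_def by auto
  from conditional_mutual_information_nonneg[OF X Y V, unfolded conditional_mutual_information_eq[OF this]]
  have "0 \<le> (\<Sum>(x, y, z)\<in>?W ` space M. p (x, y, z) * log (exp 1) (p (x, y, z) / (pxz (x, z) * (pyz (y, z) / pz z))))" .
  also have "\<dots> = (\<Sum>w\<in>?W ` space M. p w * (ln (p w) + ln (pz (snd (snd w))) - ln (pxz (fst w, snd (snd w))) - ln (pyz (snd w))))"
  proof (intro sum.cong refl, clarify)
    fix \<omega> assume "\<omega> \<in> space M"
    let ?x = "X \<omega>" and ?y = "Y \<omega>" and ?z = "V \<omega>"
    have "p (?x, ?y, ?z) = 0 \<or> p (?x, ?y, ?z) > 0" using p0[of "(?x, ?y, ?z)"] by linarith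
    then show "p (?x, ?y, ?z) * log (exp 1) (p (?x, ?y, ?z) / (pxz (?x, ?z) * (pyz (?y, ?z) / pz ?z))) =
      p (?x, ?y, ?z) * (ln (p (?x, ?y, ?z)) + ln (pz (snd (snd (?x, ?y, ?z)))) - ln (pxz (fst (?x, ?y, ?z), snd (snd (?x, ?y, ?z)))) - ln (pyz (snd (?x, ?y, ?z))))"
    proof
      assume pos: "p (?x, ?y, ?z) > 0"
      then have "pz ?z > 0" "pxz (?x, ?z) > 0" "pyz (?y, ?z) > 0"
        using le[of ?x ?y ?z] by linarith+
      then show ?thesis using pos by (simp add: log_ln[symmetric] ln_div ln_mult)
    qed simp
  qed
  also have "\<dots> = (\<Sum>w\<in>?W ` space M. p w * ln (p w)) + (\<Sum>w\<in>?W ` space M. p w * ln (pz (snd (snd w))))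
     - (\<Sum>w\<in>?W ` space M. p w * ln (pxz (fst w, snd (snd w)))) - (\<Sum>w\<in>?W ` space M. p w * ln (pyz (snd w)))"
    by (simp add: sum.distrib sum_subtractf algebra_simps)
  also have "(\<Sum>w\<in>?W ` space M. p w * ln (p w)) = - shannon M ?W"
    by (simp add: shannon_def eta_def p_def sum_negf)
  also have "(\<Sum>w\<in>?W ` space M. p w * ln (pz (snd (snd w)))) = - shannon M V"
    unfolding p_def using sum_over_coarser_fibres[OF W, of "\<lambda>z. ln (pz z)" "\<lambda>w. snd (snd w)"]
    by (simp add: shannon_def eta_def pz_def sum_negf)
  also have "(\<Sum>w\<in>?W ` space M. p w * ln (pxz (fst w, snd (snd w)))) = - shannon M (\<lambda>\<omega>. (X \<omega>, V \<omega>))"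
    unfolding p_def using sum_over_coarser_fibres[OF W, of "\<lambda>z. ln (pxz z)" "\<lambda>w. (fst w, snd (snd w))"]
    by (simp add: shannon_def eta_def pxz_def sum_negf)
  also have "(\<Sum>w\<in>?W ` space M. p w * ln (pyz (snd w))) = - shannon M (\<lambda>\<omega>. (Y \<omega>, V \<omega>))"
    unfolding p_def using sum_over_coarser_fibres[OF W, of "\<lambda>z. ln (pyz z)" "\<lambda>w. snd w"]
    by (simp add: shannon_def eta_def pyz_def sum_negf)
  finally show ?thesis by simp
qed

lemma shannon_const: "shannon M (\<lambda>_. c) = 0"
proof -
  have "(\<lambda>_. c) ` space M = {c}" using not_empty by auto
  then show ?thesis by (simp add: shannon_def prob_space)
qed

lemma shannon_subadditive:
  assumes X: "simple_function M X" and Y: "simple_function M Y"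
  shows "shannon M (\<lambda>\<omega>. (X \<omega>, Y \<omega>)) \<le> shannon M X + shannon M Y"
proof -
  have c: "simple_function M (\<lambda>_. ())" by (rule simple_function_const)
  note p = simple_function_Pair
  have "shannon M (\<lambda>\<omega>. (X \<omega>, Y \<omega>, ())) = shannon M (\<lambda>\<omega>. (X \<omega>, Y \<omega>))"
    by (intro shannon_eqI p X Y c) auto
  moreover have "shannon M (\<lambda>\<omega>. (X \<omega>, ())) = shannon M X"
    by (intro shannon_eqI p X Y c) auto
  moreover have "shannon M (\<lambda>\<omega>. (Y \<omega>, ())) = shannon M Y"
    by (intro shannon_eqI p X Y c) auto
  ultimately show ?thesis using shannon_submodular[OF X Y c] by (simp add: shannon_const)
qed

lemma shannon_indep:
  assumes X: "simple_function M X" and Y: "simple_function M Y"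
    and indep: "\<And>x y. prob {\<omega> \<in> space M. X \<omega> = x \<and> Y \<omega> = y} = prob {\<omega> \<in> space M. X \<omega> = x} * prob {\<omega> \<in> space M. Y \<omega> = y}"
  shows "shannon M (\<lambda>\<omega>. (X \<omega>, Y \<omega>)) = shannon M X + shannon M Y"
proof -
  have fin: "finite (X ` space M)" "finite (Y ` space M)" using X Y by (auto simp: simple_functionD)
  define px where "px x = prob {\<omega> \<in> space M. X \<omega> = x}" for x
  define py where "py y = prob {\<omega> \<in> space M. Y \<omega> = y}" for y
  have total: "(\<Sum>x\<in>X ` space M. px x) = 1" "(\<Sum>y\<in>Y ` space M. py y) = 1"
    using sum_over_fibres[OF X, of "\<lambda>_. 1"] sum_over_fibres[OF Y, of "\<lambda>_. 1"]
    by (auto simp: px_def py_def measure_fibre_eq prob_space)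
  have "shannon M (\<lambda>\<omega>. (X \<omega>, Y \<omega>)) = (\<Sum>(x, y)\<in>X ` space M \<times> Y ` space M. eta (px x * py y))"
    using fin by (subst shannon_superset[of "X ` space M \<times> Y ` space M"])
      (auto simp: measure_fibre_eq px_def py_def indep intro!: sum.cong)
  also have "\<dots> = (\<Sum>x\<in>X ` space M. \<Sum>y\<in>Y ` space M. eta (px x * py y))"
    by (simp add: sum.cartesian_product)
  also have "\<dots> = (\<Sum>x\<in>X ` space M. \<Sum>y\<in>Y ` space M. eta (px x) * py y + px x * eta (py y))"
  proof (intro sum.cong refl)
    fix x y
    have "px x \<ge> 0" "py y \<ge> 0" by (auto simp: px_def py_def)
    then show "eta (px x * py y) = eta (px x) * py y + px x * eta (py y)"
      by (cases "px x = 0"; cases "py y = 0") (auto simp: eta_def ln_mult algebra_simps)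
  qed
  also have "\<dots> = (\<Sum>x\<in>X ` space M. eta (px x)) * (\<Sum>y\<in>Y ` space M. py y) + (\<Sum>x\<in>X ` space M. px x) * (\<Sum>y\<in>Y ` space M. eta (py y))"
    by (simp add: sum.distrib sum_product)
  finally show ?thesis unfolding total by (simp add: shannon_def px_def py_def measure_fibre_eq)
qed

lemma simple_function_map_list:
  assumes "\<And>i. i < n \<Longrightarrow> simple_function M (X i)"
  shows "simple_function M (\<lambda>\<omega>. map (\<lambda>i. X i \<omega>) [0..<n])"
  using assms
proof (induction n)
  case (Suc n)
  have "simple_function M (\<lambda>\<omega>. map (\<lambda>i. X i \<omega>) [0..<n] @ [X n \<omega>])"
    using Suc by (intro simple_function_compose2[where h = "\<lambda>l x. l @ [x]"]) auto
  then show ?case by simp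
qed simp

text \<open>Chain rule with coarser conditioning: conditioning on less information \<open>W i\<close> than is available
  only increases the conditional entropies.\<close>

lemma shannon_list_given_le:
  assumes X: "\<And>i. i < n \<Longrightarrow> simple_function M (X i)" and V: "simple_function M V"
    and det: "\<And>i \<omega> \<omega>'. i < n \<Longrightarrow> \<omega> \<in> space M \<Longrightarrow> \<omega>' \<in> space M \<Longrightarrow> V \<omega> = V \<omega>' \<Longrightarrow> W i \<omega> = W i \<omega>'"
  shows "shannon M (\<lambda>\<omega>. (map (\<lambda>i. X i \<omega>) [0..<n], V \<omega>))
    \<le> shannon M V + (\<Sum>i<n. shannon M (\<lambda>\<omega>. (X i \<omega>, W i \<omega>)) - shannon M (W i))"
  using X det
proof (induction n)
  case 0
  have "shannon M (\<lambda>\<omega>. (map (\<lambda>i. X i \<omega>) [0..<0], V \<omega>)) \<le> shannon M V"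
    by (rule shannon_mono[OF V]) auto
  then show ?case by simp
next
  case (Suc n)
  let ?L = "\<lambda>\<omega>. map (\<lambda>i. X i \<omega>) [0..<n]"
  have L: "simple_function M ?L" using Suc.prems by (intro simple_function_map_list) auto
  have Xn: "simple_function M (X n)" using Suc.prems by auto
  have LZ: "simple_function M (\<lambda>\<omega>. (?L \<omega>, V \<omega>))" using L V by (rule simple_function_Pair)
  have "\<exists>f. (\<forall>\<omega>\<in>space M. W n \<omega> = f (V \<omega>)) \<and> simple_function M (W n)"
    by (rule simple_functionI_determined[OF V]) (rule Suc.prems(2), simp)
  then have Wn: "simple_function M (W n)" by blast
  have "shannon M (\<lambda>\<omega>. (map (\<lambda>i. X i \<omega>) [0..<Suc n], V \<omega>)) \<le> shannon M (\<lambda>\<omega>. (X n \<omega>, (?L \<omega>, V \<omega>), W n \<omega>))"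
    by (rule shannon_mono[OF simple_function_Pair[OF Xn simple_function_Pair[OF LZ Wn]]]) auto
  also have "\<dots> \<le> shannon M (\<lambda>\<omega>. (X n \<omega>, W n \<omega>)) + shannon M (\<lambda>\<omega>. ((?L \<omega>, V \<omega>), W n \<omega>)) - shannon M (W n)"
    using shannon_submodular[OF Xn LZ Wn] by simp
  also have "shannon M (\<lambda>\<omega>. ((?L \<omega>, V \<omega>), W n \<omega>)) \<le> shannon M (\<lambda>\<omega>. (?L \<omega>, V \<omega>))"
  proof (rule shannon_mono[OF LZ])
    fix \<omega> \<omega>' assume "\<omega> \<in> space M" "\<omega>' \<in> space M" "(?L \<omega>, V \<omega>) = (?L \<omega>', V \<omega>')"
    then show "((?L \<omega>, V \<omega>), W n \<omega>) = ((?L \<omega>', V \<omega>'), W n \<omega>')"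
      using Suc.prems(2)[of n \<omega> \<omega>'] by auto
  qed
  also have "\<dots> \<le> shannon M V + (\<Sum>i<n. shannon M (\<lambda>\<omega>. (X i \<omega>, W i \<omega>)) - shannon M (W i))"
  proof (rule Suc.IH)
    show "simple_function M (X i)" if "i < n" for i using Suc.prems(1) that by simp
    show "W i \<omega> = W i \<omega>'" if "i < n" "\<omega> \<in> space M" "\<omega>' \<in> space M" "V \<omega> = V \<omega>'" for i \<omega> \<omega>'
      using Suc.prems(2)[of i \<omega> \<omega>'] that by simp
  qed
  finally show ?case by simp
qed

lemma shannon_event:
  assumes "A \<in> events"
  shows "shannon M (\<lambda>\<omega>. \<omega> \<in> A) = eta (prob A) + eta (1 - prob A)"
proof -
  have "(\<lambda>\<omega>. \<omega> \<in> A) -` {True} \<inter> space M = A" "(\<lambda>\<omega>. \<omega> \<in> A) -` {False} \<inter> space M = space M - A"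
    using sets.sets_into_space[OF assms] by auto
  then show ?thesis using assms by (subst shannon_superset[of UNIV]) (auto simp: UNIV_bool prob_compl)
qed

lemma simple_function_event: "A \<in> events \<Longrightarrow> simple_function M (\<lambda>\<omega>. \<omega> \<in> A)"
  unfolding simple_function_def
proof (intro conjI ballI)
  assume A: "A \<in> events"
  fix b assume "b \<in> (\<lambda>\<omega>. \<omega> \<in> A) ` space M"
  show "(\<lambda>\<omega>. \<omega> \<in> A) -` {b} \<inter> space M \<in> events"
  proof (cases b)
    case True
    have "(\<lambda>\<omega>. \<omega> \<in> A) -` {True} \<inter> space M = A" using sets.sets_into_space[OF A] by auto
    then show ?thesis using True A by simp
  next
    case False
    have "(\<lambda>\<omega>. \<omega> \<in> A) -` {False} \<inter> space M = space M - A" by auto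
    then show ?thesis using False A by simp
  qed
qed (auto intro: finite_subset[OF _ finite[of "UNIV :: bool set"]])

text \<open>Given \<open>B\<close>, the event \<open>A\<close> is determined by the symmetric difference.\<close>

lemma shannon_event_given_le:
  assumes A: "A \<in> events" and B: "B \<in> events"
  shows "shannon M (\<lambda>\<omega>. (\<omega> \<in> A, \<omega> \<in> B)) - shannon M (\<lambda>\<omega>. \<omega> \<in> B)
    \<le> eta (prob (sym_diff A B)) + eta (1 - prob (sym_diff A B))"
proof -
  have D: "sym_diff A B \<in> events" using A B by auto
  note s = simple_function_event[OF B] simple_function_event[OF D]
  have "shannon M (\<lambda>\<omega>. (\<omega> \<in> A, \<omega> \<in> B)) \<le> shannon M (\<lambda>\<omega>. (\<omega> \<in> B, \<omega> \<in> sym_diff A B))"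
    by (rule shannon_mono[OF simple_function_Pair[OF s]]) auto
  also have "\<dots> \<le> shannon M (\<lambda>\<omega>. \<omega> \<in> B) + shannon M (\<lambda>\<omega>. \<omega> \<in> sym_diff A B)"
    by (rule shannon_subadditive[OF s])
  finally show ?thesis by (simp only: shannon_event[OF D])
qed

text \<open>The entropy of the symmetric difference tends to 0 with its probability.\<close>

lemma small_event_given:
  assumes "e > 0"
  shows "\<exists>d>0. \<forall>A\<in>events. \<forall>B\<in>events. prob (sym_diff A B) < d \<longrightarrow>
    shannon M (\<lambda>\<omega>. (\<omega> \<in> A, \<omega> \<in> B)) - shannon M (\<lambda>\<omega>. \<omega> \<in> B) < e"
proof -
  have "continuous_on {0..1::real} (\<lambda>p. eta p + eta (1 - p))"
    by (intro continuous_intros continuous_on_eta continuous_on_compose2[OF continuous_on_eta]) auto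
  then have "\<exists>d>0. \<forall>p\<in>{0..1::real}. dist p 0 < d \<longrightarrow> dist (eta p + eta (1 - p)) (eta 0 + eta (1 - 0)) < e"
    unfolding continuous_on_iff by (elim ballE[of _ _ 0]) (use assms in auto)
  then obtain d where d: "d > 0" "\<And>p. p \<in> {0..1::real} \<Longrightarrow> dist p 0 < d \<Longrightarrow> dist (eta p + eta (1 - p)) 0 < e"
    by auto
  show ?thesis
  proof (intro exI[of _ d] conjI ballI impI d(1))
    fix A B assume AB: "A \<in> events" "B \<in> events" "prob (sym_diff A B) < d"
    then have "dist (eta (prob (sym_diff A B)) + eta (1 - prob (sym_diff A B))) 0 < e"
      by (intro d(2)) (auto simp: dist_real_def)
    then show "shannon M (\<lambda>\<omega>. (\<omega> \<in> A, \<omega> \<in> B)) - shannon M (\<lambda>\<omega>. \<omega> \<in> B) < e"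
      using shannon_event_given_le[OF AB(1,2)] by (simp add: dist_real_def)
  qed
qed

end

lemma shannon_distr:
  assumes [measurable]: "T \<in> measurable M N" and "simple_function N X"
    and M: "prob_space M"
  shows "shannon (distr M N T) X = shannon M (\<lambda>\<omega>. X (T \<omega>))"
proof -
  interpret prob_space M by fact
  have X: "\<And>x. X -` {x} \<inter> space N \<in> sets N" "finite (X ` space N)"
    using assms(2) by (auto simp: simple_functionD)
  have T: "T \<omega> \<in> space N" if "\<omega> \<in> space M" for \<omega> using that assms(1) by (rule measurable_space[rotated])
  have eq: "measure (distr M N T) (X -` {x} \<inter> space N) = prob ((\<lambda>\<omega>. X (T \<omega>)) -` {x} \<inter> space M)" for x
    using X by (subst measure_distr) (auto intro!: arg_cong[where f = prob] simp: T)
  have "shannon M (\<lambda>\<omega>. X (T \<omega>)) = (\<Sum>x\<in>X ` space N. eta (prob ((\<lambda>\<omega>. X (T \<omega>)) -` {x} \<inter> space M)))"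
    using X by (intro shannon_superset) (auto simp: T)
  then show ?thesis by (simp add: shannon_def eq)
qed

section \<open>Approximation by an algebra and ergodicity\<close>

lemma (in finite_measure) measure_diff_le_sym_diff:
  assumes "A \<in> sets M" "B \<in> sets M"
  shows "\<bar>measure M A - measure M B\<bar> \<le> measure M (sym_diff A B)"
proof -
  have "measure M A \<le> measure M (B \<union> sym_diff A B)" "measure M B \<le> measure M (A \<union> sym_diff A B)"
    using assms by (auto intro!: finite_measure_mono)
  moreover have "measure M (B \<union> sym_diff A B) \<le> measure M B + measure M (sym_diff A B)"
    "measure M (A \<union> sym_diff A B) \<le> measure M A + measure M (sym_diff A B)"
    using assms by (auto intro!: measure_Un_le)
  ultimately show ?thesis by linarith
qed

text \<open>The measurable sets in which membership is unaffected by passing to an \<open>R n\<close>-related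
  point, for some \<open>n\<close>. Here \<open>R n x y\<close> should mean that \<open>x\<close> and
  \<open>y\<close> agree up to stage \<open>n\<close>.\<close>

definition determined_sets :: "'a measure \<Rightarrow> (nat \<Rightarrow> 'a \<Rightarrow> 'a \<Rightarrow> bool) \<Rightarrow> 'a set set" where
  "determined_sets M R = {C \<in> sets M. \<exists>n. \<forall>x\<in>space M. \<forall>y\<in>space M. R n x y \<longrightarrow> x \<in> C \<longrightarrow> y \<in> C}"

lemma determined_setsI:
  assumes "C \<in> sets M" "\<And>x y. x \<in> space M \<Longrightarrow> y \<in> space M \<Longrightarrow> R n x y \<Longrightarrow> x \<in> C \<Longrightarrow> y \<in> C"
  shows "C \<in> determined_sets M R"
  unfolding determined_sets_def mem_Collect_eq 
  by (intro conjI exI[of _ n] ballI impI assms(1)) (erule (3) assms(2))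

lemma determined_sets_subset: "determined_sets M R \<subseteq> sets M"
  unfolding determined_sets_def by (intro subsetI) (simp only: mem_Collect_eq)

lemma determined_setsD:
  "C \<in> determined_sets M R \<Longrightarrow> \<exists>n. \<forall>x\<in>space M. \<forall>y\<in>space M. R n x y \<longrightarrow> x \<in> C \<longrightarrow> y \<in> C"
  unfolding determined_sets_def mem_Collect_eq by (rule conjunct2)

lemma algebra_determined_sets:
  assumes sym: "\<And>n x y. R n x y \<Longrightarrow> R n y x" and antimono: "\<And>m n x y. m \<le> n \<Longrightarrow> R n x y \<Longrightarrow> R m x y"
  shows "algebra (space M) (determined_sets M R)"
proof (rule algebra_iff_Un[THEN iffD2], intro conjI ballI)
  show "determined_sets M R \<subseteq> Pow (space M)" using determined_sets_subset sets.space_closed by blast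
  show "{} \<in> determined_sets M R" by (rule determined_setsI) auto
  fix A B assume A: "A \<in> determined_sets M R" and B: "B \<in> determined_sets M R"
  then have AB: "A \<in> sets M" "B \<in> sets M" using determined_sets_subset by blast+
  obtain m where m: "\<forall>x\<in>space M. \<forall>y\<in>space M. R m x y \<longrightarrow> x \<in> A \<longrightarrow> y \<in> A" using determined_setsD[OF A] ..
  obtain n where n: "\<forall>x\<in>space M. \<forall>y\<in>space M. R n x y \<longrightarrow> x \<in> B \<longrightarrow> y \<in> B" using determined_setsD[OF B] ..
  show "space M - A \<in> determined_sets M R"
    by (rule determined_setsI[where n = m]) (use AB m sym in blast)+
  show "A \<union> B \<in> determined_sets M R"
    by (rule determined_setsI[where n = "max m n"]) (use AB m n antimono[OF max.cobounded1] antimono[OF max.cobounded2] in blast)+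
qed

text \<open>The sets that can be approximated by members of an algebra form a \<open>\<sigma>\<close>-algebra.\<close>

lemma (in prob_space) approx_by_algebra:
  assumes alg: "algebra (space M) \<A>" and sub: "\<A> \<subseteq> events" and gen: "events \<subseteq> sigma_sets (space M) \<A>"
    and A: "A \<in> events" and e: "e > 0"
  shows "\<exists>C\<in>\<A>. prob (sym_diff A C) < e"
proof -
  interpret algebra "space M" \<A> by (rule alg)
  have ev: "sigma_sets (space M) \<A> \<subseteq> events" using sub by (rule sets.sigma_sets_subset)
  have "A \<in> sigma_sets (space M) \<A>" using A gen by auto
  then show ?thesis using e
  proof (induction arbitrary: e rule: sigma_sets.induct)
    case (Basic a)
    then show ?case by (intro bexI[of _ a]) auto
  next
    case Empty
    then show ?case by (intro bexI[of _ "{}"]) auto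
  next
    case (Compl a)
    then obtain C where C: "C \<in> \<A>" "prob (sym_diff a C) < e" by blast
    have "sym_diff (space M - a) (space M - C) = sym_diff a C"
      using C(1) sub Compl.hyps sets.sets_into_space ev by blast
    then show ?case using C by (intro bexI[of _ "space M - C"]) auto
  next
    case (Union a)
    have a: "a i \<in> events" for i using Union.hyps ev by blast
    have "(\<lambda>n. prob (\<Union>i<n. a i)) \<longlonglongrightarrow> prob (\<Union>n. \<Union>i<n. a i)"
      by (rule finite_Lim_measure_incseq) (use a in \<open>auto simp: incseq_def dest: less_le_trans\<close>)
    also have "(\<Union>n. \<Union>i<n. a i) = (\<Union>i. a i)" by auto
    finally obtain n where n: "\<bar>prob (\<Union>i<n. a i) - prob (\<Union>i. a i)\<bar> < e / 2"
      using LIMSEQ_D[of _ _ "e / 2"] Union.prems by fastforce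
    (* n sets with errors e / (2 * (n + 1)) each leave room for the tail of the union; n may be 0 *)
    have "\<exists>C\<in>\<A>. prob (sym_diff (a i) C) < e / (2 * real (Suc n))" for i
      using Union.IH Union.prems by simp
    then obtain C where C: "\<And>i. C i \<in> \<A>" "\<And>i. prob (sym_diff (a i) (C i)) < e / (2 * real (Suc n))"
      by metis
    have Cev: "C i \<in> events" for i using C(1) sub by blast
    define D where "D = (\<Union>i<n. C i)"
    have D: "D \<in> \<A>" unfolding D_def using C(1) by (intro finite_UN) auto
    have "sym_diff (\<Union>i. a i) D \<subseteq> ((\<Union>i. a i) - (\<Union>i<n. a i)) \<union> (\<Union>i<n. sym_diff (a i) (C i))"
      by (auto simp: D_def)
    then have "prob (sym_diff (\<Union>i. a i) D) \<le> prob (((\<Union>i. a i) - (\<Union>i<n. a i)) \<union> (\<Union>i<n. sym_diff (a i) (C i)))"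
      using a Cev by (intro finite_measure_mono) auto
    also have "\<dots> \<le> prob ((\<Union>i. a i) - (\<Union>i<n. a i)) + prob (\<Union>i<n. sym_diff (a i) (C i))"
      using a Cev by (intro measure_Un_le) auto
    also have "prob ((\<Union>i. a i) - (\<Union>i<n. a i)) = prob (\<Union>i. a i) - prob (\<Union>i<n. a i)"
      using a by (intro finite_measure_Diff) auto
    also have "prob (\<Union>i<n. sym_diff (a i) (C i)) \<le> (\<Sum>i<n. prob (sym_diff (a i) (C i)))"
      using a Cev by (intro finite_measure_subadditive_finite) auto
    also have "\<dots> \<le> (\<Sum>i<n. e / (2 * real (Suc n)))" using C(2) by (intro sum_mono less_imp_le)
    also have "\<dots> \<le> e / 2" using Union.prems by (simp add: field_simps)
    finally have "prob (sym_diff (\<Union>i. a i) D) < e" using n by linarith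
    then show ?case using D by blast
  qed
qed

text \<open>If the correlations of every set of a generating algebra with its own translates average to the
  square of its measure, then an invariant set \<open>A\<close>, being close to a set of the algebra, satisfies
  \<open>prob A = (prob A)\<^sup>2\<close>.\<close>

lemma (in prob_space) ergodic_if_correlations_average:
  assumes alg: "algebra (space M) \<A>" and sub: "\<A> \<subseteq> events" and gen: "events \<subseteq> sigma_sets (space M) \<A>"
    and T [measurable]: "T \<in> measurable M M" and inv: "distr M M T = M"
    and corr: "\<And>C. C \<in> \<A> \<Longrightarrow> \<exists>F. finite F \<and> F \<noteq> {} \<and>
      (\<Sum>n\<in>F. prob (C \<inter> ((T ^^ n) -` C \<inter> space M))) = real (card F) * (prob C)\<^sup>2"
    and A: "A \<in> events" and TA: "T -` A \<inter> space M = A"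
  shows "prob A = 0 \<or> prob A = 1"
proof -
  have Tn [measurable]: "T ^^ n \<in> measurable M M" for n
    by (induction n) (auto intro: measurable_comp[OF _ T])
  have inv_n: "prob ((T ^^ n) -` B \<inter> space M) = prob B" if [measurable]: "B \<in> events" for B n
  proof (induction n)
    case 0
    then show ?case using sets.sets_into_space[OF that] by (simp add: Int_absorb2)
  next
    case (Suc n)
    have "(T ^^ Suc n) -` B \<inter> space M = T -` ((T ^^ n) -` B \<inter> space M) \<inter> space M"
      using measurable_space[OF T] by (auto simp: funpow_swap1)
    also have "prob \<dots> = measure (distr M M T) ((T ^^ n) -` B \<inter> space M)"
      by (rule measure_distr[symmetric]) auto
    finally show ?case using Suc by (simp only: inv)
  qed
  have TnA: "(T ^^ n) -` A \<inter> space M = A" for n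
  proof (induction n)
    case 0
    then show ?case using sets.sets_into_space[OF A] by auto
  next
    case (Suc n)
    have "(T ^^ Suc n) -` A \<inter> space M = T -` ((T ^^ n) -` A \<inter> space M) \<inter> space M"
      using measurable_space[OF T] by (auto simp: funpow_swap1)
    then show ?case by (simp only: Suc TA)
  qed
  have "\<bar>prob A - (prob A)\<^sup>2\<bar> \<le> 4 * e" if e: "e > 0" for e
  proof -
    obtain C where C: "C \<in> \<A>" "prob (sym_diff A C) < e"
      using approx_by_algebra[OF alg sub gen A e] by blast
    have Cev [measurable]: "C \<in> events" using C(1) sub by blast
    have *: "\<bar>prob A - prob (C \<inter> ((T ^^ n) -` C \<inter> space M))\<bar> \<le> 2 * e" for n
    proof -
      have [measurable]: "sym_diff A C \<in> events" using A by auto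
      have "sym_diff A (C \<inter> ((T ^^ n) -` C \<inter> space M)) \<subseteq> sym_diff A C \<union> ((T ^^ n) -` (sym_diff A C) \<inter> space M)"
        using TnA[of n] sets.sets_into_space[OF A] by blast
      then have "prob (sym_diff A (C \<inter> ((T ^^ n) -` C \<inter> space M))) \<le> prob (sym_diff A C \<union> ((T ^^ n) -` (sym_diff A C) \<inter> space M))"
        using A by (intro finite_measure_mono) measurable
      also have "\<dots> \<le> prob (sym_diff A C) + prob ((T ^^ n) -` (sym_diff A C) \<inter> space M)"
        using A by (intro measure_Un_le) measurable
      also have "\<dots> \<le> 2 * e" using C(2) inv_n[of "sym_diff A C" n] A by simp
      finally show ?thesis using measure_diff_le_sym_diff[of A "C \<inter> ((T ^^ n) -` C \<inter> space M)"] A by simp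
    qed
    obtain F where F: "finite F" "F \<noteq> {}"
      "(\<Sum>n\<in>F. prob (C \<inter> ((T ^^ n) -` C \<inter> space M))) = real (card F) * (prob C)\<^sup>2"
      using corr[OF C(1)] by blast
    have "\<bar>real (card F) * (prob A - (prob C)\<^sup>2)\<bar> = \<bar>\<Sum>n\<in>F. prob A - prob (C \<inter> ((T ^^ n) -` C \<inter> space M))\<bar>"
      using F(3) by (simp add: sum_subtractf right_diff_distrib)
    also have "\<dots> \<le> (\<Sum>n\<in>F. 2 * e)" using * by (intro order.trans[OF sum_abs] sum_mono)
    finally have "real (card F) * \<bar>prob A - (prob C)\<^sup>2\<bar> \<le> real (card F) * (2 * e)" by (simp add: abs_mult)
    then have 1: "\<bar>prob A - (prob C)\<^sup>2\<bar> \<le> 2 * e" using F by (simp add: card_gt_0_iff)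
    have "(prob C)\<^sup>2 - (prob A)\<^sup>2 = (prob C - prob A) * (prob C + prob A)"
      by (simp add: power2_eq_square algebra_simps)
    then have "\<bar>(prob C)\<^sup>2 - (prob A)\<^sup>2\<bar> = \<bar>prob C - prob A\<bar> * \<bar>prob C + prob A\<bar>"
      by (simp add: abs_mult)
    also have "\<dots> \<le> e * 2"
    proof (rule mult_mono)
      show "\<bar>prob C - prob A\<bar> \<le> e" using measure_diff_le_sym_diff[OF A Cev] C(2) by linarith
      have "0 \<le> prob C" "prob C \<le> 1" "0 \<le> prob A" "prob A \<le> 1" by auto
      then show "\<bar>prob C + prob A\<bar> \<le> 2" by linarith
    qed (use e in auto)
    finally show ?thesis using 1 by linarith
  qed
  then have "\<bar>prob A - (prob A)\<^sup>2\<bar> \<le> 0 + e" if "e > 0" for e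
    using that by (metis add_0 mult.commute nonzero_eq_divide_eq zero_less_divide_iff zero_less_numeral zero_neq_numeral)
  then have "\<bar>prob A - (prob A)\<^sup>2\<bar> \<le> 0" by (rule field_le_epsilon)
  then have "prob A * (1 - prob A) = 0" by (simp add: power2_eq_square algebra_simps)
  then show ?thesis by auto
qed

section \<open>Entropy of a measure-preserving map\<close>

locale measure_preserving_map = prob_space +
  fixes T :: "'a \<Rightarrow> 'a"
  assumes measurable_map [measurable]: "T \<in> measurable M M"
    and distr_map: "distr M M T = M"
begin

lemma measurable_iterate [measurable]: "T ^^ n \<in> measurable M M"
  by (induction n) (auto intro: measurable_comp[OF _ measurable_map])

lemma iterate_in_space: "\<omega> \<in> space M \<Longrightarrow> (T ^^ n) \<omega> \<in> space M"
  using measurable_space[OF measurable_iterate] .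

lemma distr_iterate: "distr M M (T ^^ n) = M"
proof (induction n)
  case 0
  show ?case by (simp add: id_def distr_id)
next
  case (Suc n)
  have "distr M M (T ^^ Suc n) = distr (distr M M (T ^^ n)) M T"
    by (subst distr_distr) auto
  then show ?case by (simp only: Suc distr_map)
qed

lemma simple_function_iterate:
  assumes "simple_function M c"
  shows "simple_function M (\<lambda>\<omega>. c ((T ^^ n) \<omega>))"
  using measurable_iterate assms by (rule simple_function_comp)

lemma shannon_iterate:
  assumes "simple_function M c"
  shows "shannon M (\<lambda>\<omega>. c ((T ^^ n) \<omega>)) = shannon M c"
  using shannon_distr[OF measurable_iterate assms prob_space_axioms, of n] by (simp add: distr_iterate)

definition orbit_word :: "('a \<Rightarrow> 'b) \<Rightarrow> nat \<Rightarrow> 'a \<Rightarrow> 'b list" where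
  "orbit_word c n \<omega> = map (\<lambda>i. c ((T ^^ i) \<omega>)) [0..<n]"

lemma simple_function_orbit_word: "simple_function M c \<Longrightarrow> simple_function M (orbit_word c n)"
  unfolding orbit_word_def[abs_def] by (intro simple_function_map_list simple_function_iterate)

lemma orbit_word_add: "orbit_word c (m + n) \<omega> = orbit_word c m \<omega> @ orbit_word c n ((T ^^ m) \<omega>)"
  by (intro nth_equalityI) (auto simp: orbit_word_def nth_append funpow_add[symmetric] funpow_add[THEN fun_cong, symmetric, unfolded comp_def])

lemma shannon_orbit_word_add:
  assumes c: "simple_function M c"
  shows "shannon M (orbit_word c (m + n)) \<le> shannon M (orbit_word c m) + shannon M (orbit_word c n)"
proof -
  note s = simple_function_orbit_word[OF c]
  have s': "simple_function M (\<lambda>\<omega>. orbit_word c n ((T ^^ m) \<omega>))" by (rule simple_function_iterate[OF s])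
  have "shannon M (orbit_word c (m + n)) \<le> shannon M (\<lambda>\<omega>. (orbit_word c m \<omega>, orbit_word c n ((T ^^ m) \<omega>)))"
    by (rule shannon_mono[OF simple_function_Pair[OF s s']]) (simp add: orbit_word_add)
  also have "\<dots> \<le> shannon M (orbit_word c m) + shannon M (\<lambda>\<omega>. orbit_word c n ((T ^^ m) \<omega>))"
    by (rule shannon_subadditive[OF s s'])
  also have "shannon M (\<lambda>\<omega>. orbit_word c n ((T ^^ m) \<omega>)) = shannon M (orbit_word c n)"
    by (rule shannon_iterate[OF s])
  finally show ?thesis .
qed

lemma entropy_rate:
  assumes c: "simple_function M c"
  obtains h where "(\<lambda>n. shannon M (orbit_word c n) / real n) \<longlonglongrightarrow> h"
    "\<And>n. n \<ge> 1 \<Longrightarrow> h \<le> shannon M (orbit_word c n) / real n"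
  using subadditive_limit[of "\<lambda>n. shannon M (orbit_word c n)"] shannon_orbit_word_add[OF c] shannon_nonneg
  by metis

definition atom :: "'a set set \<Rightarrow> 'a \<Rightarrow> 'a set" where
  "atom P \<omega> = (THE A. A \<in> P \<and> \<omega> \<in> A)"

lemma atom_eqI:
  assumes "partition_on (space M) P" "A \<in> P" "\<omega> \<in> A"
  shows "atom P \<omega> = A"
  unfolding atom_def using assms
  by (intro the_equality) (auto simp: partition_on_def disjoint_def)

lemma atom_in:
  assumes "partition_on (space M) P" "\<omega> \<in> space M"
  shows "atom P \<omega> \<in> P" "\<omega> \<in> atom P \<omega>"
proof -
  obtain A where "A \<in> P" "\<omega> \<in> A" using assms by (auto simp: partition_on_def)
  then show "atom P \<omega> \<in> P" "\<omega> \<in> atom P \<omega>" using atom_eqI[OF assms(1)] by auto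
qed

lemma simple_function_atom:
  assumes "finite P" "P \<subseteq> events" "partition_on (space M) P"
  shows "simple_function M (atom P)"
  unfolding simple_function_def
proof (intro conjI ballI)
  show "finite (atom P ` space M)"
    by (rule finite_subset[OF _ assms(1)]) (auto intro: atom_in[OF assms(3)])
  fix A assume "A \<in> atom P ` space M"
  then have "A \<in> P" using atom_in[OF assms(3)] by auto
  then have "atom P -` {A} \<inter> space M = A"
    using atom_in[OF assms(3)] atom_eqI[OF assms(3)] assms(2) sets.sets_into_space by blast
  then show "atom P -` {A} \<inter> space M \<in> events" using \<open>A \<in> P\<close> assms(2) by auto
qed

text \<open>The nonempty members of the join are the sets on which the \<open>P\<close>-name of length
  \<open>n\<close> is constant, and the empty set contributes nothing.\<close>

lemma partition_entropy_join:
  assumes P: "finite P" "P \<subseteq> events" "partition_on (space M) P"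
  shows "partition_entropy M (iterated_join M T P n) = shannon M (orbit_word (atom P) n)"
proof -
  let ?W = "orbit_word (atom P) n"
  let ?fib = "\<lambda>w. ?W -` {w} \<inter> space M"
  let ?J = "iterated_join M T P n"
  have fin: "finite (?W ` space M)"
    by (rule simple_functionD(1)[OF simple_function_orbit_word[OF simple_function_atom[OF P]]])
  have fib: "space M \<inter> (\<Inter>i<n. (T ^^ i) -` a i) = ?fib (?W \<omega>)"
    if a: "\<And>i. i < n \<Longrightarrow> a i \<in> P" and \<omega>: "\<omega> \<in> space M" "\<And>i. i < n \<Longrightarrow> (T ^^ i) \<omega> \<in> a i" for a \<omega>
  proof -
    have w: "?W \<omega> = map a [0..<n]"
      unfolding orbit_word_def using atom_eqI[OF P(3)] a \<omega>(2) by (intro map_cong) auto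
    have "(T ^^ i) x \<in> a i \<longleftrightarrow> atom P ((T ^^ i) x) = a i" if "x \<in> space M" "i < n" for x i
      using atom_eqI[OF P(3) a[OF that(2)]] atom_in(2)[OF P(3) iterate_in_space[OF that(1)]] by auto
    then show ?thesis unfolding w by (auto simp: orbit_word_def)
  qed
  have sub: "?J \<subseteq> insert {} (?fib ` (?W ` space M))"
  proof
    fix S assume "S \<in> ?J"
    then obtain a where a: "\<forall>i<n. a i \<in> P" "S = space M \<inter> (\<Inter>i<n. (T ^^ i) -` a i)"
      by (auto simp: iterated_join_def)
    show "S \<in> insert {} (?fib ` (?W ` space M))"
    proof (cases "S = {}")
      case False
      then obtain \<omega> where \<omega>: "\<omega> \<in> S" by auto
      then have "S = ?fib (?W \<omega>)" unfolding a(2) using a(1) by (intro fib) auto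
      then show ?thesis using \<omega> a(2) by blast
    qed simp
  qed
  have sup: "?fib ` (?W ` space M) \<subseteq> ?J"
  proof clarify
    fix \<omega> assume \<omega>: "\<omega> \<in> space M"
    have "?fib (?W \<omega>) = space M \<inter> (\<Inter>i<n. (T ^^ i) -` atom P ((T ^^ i) \<omega>))"
      using \<omega> atom_in[OF P(3) iterate_in_space[OF \<omega>]] by (intro fib[symmetric]) auto
    moreover have "\<forall>i<n. atom P ((T ^^ i) \<omega>) \<in> P" using atom_in[OF P(3) iterate_in_space[OF \<omega>]] by auto
    ultimately show "?fib (?W \<omega>) \<in> ?J" unfolding iterated_join_def
      by (intro CollectI exI[of _ "\<lambda>i. atom P ((T ^^ i) \<omega>)"] conjI)
  qed
  have "partition_entropy M ?J = (\<Sum>A\<in>?J. eta (prob A))"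
    by (simp add: partition_entropy_def eta_def sum_negf)
  also have "\<dots> = (\<Sum>A\<in>?fib ` (?W ` space M). eta (prob A))"
    by (intro sum.mono_neutral_right finite_subset[OF sub] sup) (use fin sub in auto)
  also have "\<dots> = (\<Sum>w\<in>?W ` space M. eta (prob (?fib w)))"
  proof (rule sum.reindex_cong[OF _ refl refl])
    show "inj_on ?fib (?W ` space M)"
    proof (rule inj_onI)
      fix v w assume "v \<in> ?W ` space M" "w \<in> ?W ` space M" "?fib v = ?fib w"
      then obtain \<omega> where "\<omega> \<in> ?fib v" "\<omega> \<in> ?fib w" by blast
      then show "v = w" by simp
    qed
  qed
  finally show ?thesis by (simp add: shannon_def)
qed

lemma entropy_wrt_limit:
  assumes P: "finite P" "P \<subseteq> events" "partition_on (space M) P"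
  shows "(\<lambda>n. shannon M (orbit_word (atom P) n) / real n) \<longlonglongrightarrow> entropy_wrt M T P"
proof -
  obtain h where h: "(\<lambda>n. shannon M (orbit_word (atom P) n) / real n) \<longlonglongrightarrow> h"
    by (rule entropy_rate[OF simple_function_atom[OF P]])
  then have "entropy_wrt M T P = h"
    unfolding entropy_wrt_def partition_entropy_join[OF P] by (rule limI)
  then show ?thesis using h by simp
qed

text \<open>If the atoms of \<open>P\<close> are almost determined by \<open>m\<close> symbols of the \<open>c\<close>-orbit, then the \<open>P\<close>-names
  of length \<open>n\<close> are almost determined by the \<open>c\<close>-orbit of length \<open>n + m\<close>, with an error of at
  most \<open>e\<close> per symbol.\<close>

lemma entropy_wrt_le:
  assumes P: "finite P" "P \<subseteq> events" "partition_on (space M) P"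
    and c: "simple_function M c" and h: "(\<lambda>n. shannon M (orbit_word c n) / real n) \<longlonglongrightarrow> h"
    and e: "shannon M (\<lambda>\<omega>. (atom P \<omega>, orbit_word c m \<omega>)) - shannon M (orbit_word c m) \<le> e"
  shows "entropy_wrt M T P \<le> h + e"
proof -
  let ?W = "orbit_word c" and ?N = "orbit_word (atom P)"
  note sW = simple_function_orbit_word[OF c]
  note sP = simple_function_atom[OF P]
  have "shannon M (?N n) / real n \<le> (shannon M (?W n) / real n + shannon M (?W m) / real n) + e" if n: "n \<ge> 1" for n
  proof -
    have det: "orbit_word c m ((T ^^ i) \<omega>) = orbit_word c m ((T ^^ i) \<omega>')"
      if "i < n" "?W (n + m) \<omega> = ?W (n + m) \<omega>'" for i \<omega> \<omega>'
    proof -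
      have "?W (i + (m + (n - i))) \<omega> = ?W (i + (m + (n - i))) \<omega>'" using that by (simp add: add.commute)
      then show ?thesis unfolding orbit_word_add by (auto simp: orbit_word_def)
    qed
    have "shannon M (?N n) \<le> shannon M (\<lambda>\<omega>. (map (\<lambda>i. atom P ((T ^^ i) \<omega>)) [0..<n], ?W (n + m) \<omega>))"
      by (rule shannon_mono[OF simple_function_Pair[OF simple_function_map_list[OF simple_function_iterate[OF sP]] sW]])
        (simp add: orbit_word_def)
    also have "\<dots> \<le> shannon M (?W (n + m)) + (\<Sum>i<n. shannon M (\<lambda>\<omega>. (atom P ((T ^^ i) \<omega>), ?W m ((T ^^ i) \<omega>)))
       - shannon M (\<lambda>\<omega>. ?W m ((T ^^ i) \<omega>)))"
    proof (rule shannon_list_given_le[OF simple_function_iterate[OF sP] sW])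
      fix i \<omega> \<omega>' assume "i < n" "?W (n + m) \<omega> = ?W (n + m) \<omega>'"
      then show "?W m ((T ^^ i) \<omega>) = ?W m ((T ^^ i) \<omega>')" by (rule det)
    qed
    also have "(\<Sum>i<n. shannon M (\<lambda>\<omega>. (atom P ((T ^^ i) \<omega>), ?W m ((T ^^ i) \<omega>))) - shannon M (\<lambda>\<omega>. ?W m ((T ^^ i) \<omega>)))
      = (\<Sum>i<n. shannon M (\<lambda>\<omega>. (atom P \<omega>, ?W m \<omega>)) - shannon M (?W m))"
      using shannon_iterate[OF simple_function_Pair[OF sP sW]] shannon_iterate[OF sW] by simp
    also have "\<dots> \<le> (\<Sum>i<n. e)" using e by (intro sum_mono)
    also have "shannon M (?W (n + m)) \<le> shannon M (?W n) + shannon M (?W m)"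
      by (rule shannon_orbit_word_add[OF c])
    finally have "shannon M (?N n) \<le> shannon M (?W n) + shannon M (?W m) + real n * e" by simp
    then have "shannon M (?N n) / real n \<le> (shannon M (?W n) + shannon M (?W m) + real n * e) / real n"
      by (rule divide_right_mono) simp
    then show ?thesis using n by (simp add: add_divide_distrib)
  qed
  moreover have "(\<lambda>n. (shannon M (?W n) / real n + shannon M (?W m) / real n) + e) \<longlonglongrightarrow> (h + 0) + e"
    by (intro tendsto_add h tendsto_const lim_const_over_n)
  ultimately have "entropy_wrt M T P \<le> (h + 0) + e"
    by (intro LIMSEQ_le[OF entropy_wrt_limit[OF P]]) auto
  then show ?thesis by simp
qed

end

section \<open>The Borel structure and the generator theorem\<close>

definition cylinder :: "bool list \<Rightarrow> bseq set" where
  "cylinder w = {x. map x [0..<length w] = w}"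

lemma cylinder_eq: "cylinder w = {x. \<forall>i<length w. x i = w ! i}"
  unfolding cylinder_def by (subst list_eq_iff_nth_eq) simp

lemma open_cylinder: "open (cylinder w)"
proof -
  have "cylinder w = (\<Inter>i<length w. (\<lambda>y::bseq. y i) -` {w ! i})" by (auto simp: cylinder_eq)
  moreover have "open ((\<lambda>y::bseq. y i) -` {w ! i})" for i
    by (intro open_vimage) (auto simp: Topological_Spaces.open_discrete)
  ultimately show ?thesis by (auto intro!: open_INT)
qed

lemma open_contains_cylinder:
  assumes "open U" "x \<in> U"
  obtains n where "cylinder (map x [0..<n]) \<subseteq> U"
proof -
  have "openin rho.mtopology U" using assms(1) by (simp add: mtopology_rho)
  then obtain r where r: "r > 0" "rho.mball x r \<subseteq> U" using assms(2) by (auto simp: rho.openin_mtopology)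
  obtain k where k: "(1/2::real) ^ k < r" using real_arch_pow_inv[OF r(1), of "1/2"] by auto
  have "cylinder (map x [0..<Suc k]) \<subseteq> U"
  proof
    fix y assume "y \<in> cylinder (map x [0..<Suc k])"
    then have "\<forall>i\<le>k. x i = y i" by (auto simp: cylinder_eq less_Suc_eq_le simp del: upt_Suc)
    then have "rho x y < (1/2) ^ k" by (simp add: rho_less_iff)
    then have "rho x y < r" using k by (rule less_trans)
    then show "y \<in> U" using r(2) by (auto simp: rho.in_mball)
  qed
  then show ?thesis by (rule that)
qed

lemma in_cylinder_initial: "x \<in> cylinder (map x [0..<n])"
  by (simp add: cylinder_def)

text \<open>Every open set is the union of the cylinders that it contains, and there are countably many
  cylinders.\<close>

lemma sets_borel_cylinders: "sets (borel :: bseq measure) = sigma_sets UNIV (range cylinder)"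
proof (rule antisym)
  have "U \<in> sigma_sets UNIV (range cylinder)" if U: "open U" for U
  proof -
    have "U = (\<Union>w\<in>{w. cylinder w \<subseteq> U}. cylinder w)"
    proof (intro set_eqI iffI)
      fix x assume "x \<in> U"
      then obtain n where "cylinder (map x [0..<n]) \<subseteq> U" using open_contains_cylinder[OF U] by metis
      then show "x \<in> (\<Union>w\<in>{w. cylinder w \<subseteq> U}. cylinder w)" using in_cylinder_initial[of x n] by blast
    qed auto
    also have "\<dots> \<in> sigma_sets UNIV (range cylinder)"
      by (rule sigma_sets_UNION) auto
    finally show ?thesis .
  qed
  then show "sets (borel :: bseq measure) \<subseteq> sigma_sets UNIV (range cylinder)"
    unfolding sets_borel by (intro sigma_sets_mono) auto
  show "sigma_sets UNIV (range cylinder) \<subseteq> sets (borel :: bseq measure)"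
  proof -
    have "range cylinder \<subseteq> sets (borel :: bseq measure)" using open_cylinder by auto
    from sets.sigma_sets_subset[OF this] show ?thesis by simp
  qed
qed

lemma cylinder_borel [measurable]: "cylinder w \<in> sets borel"
  using open_cylinder by simp

lemma measurable_bseqI:
  assumes [measurable]: "\<And>i. Measurable.pred M (\<lambda>\<omega>. f \<omega> i)"
  shows "f \<in> measurable M (borel :: bseq measure)"
proof (rule measurable_sigma_sets[OF sets_borel_cylinders])
  fix A :: "bseq set" assume "A \<in> range cylinder"
  then obtain w where A: "A = cylinder w" by auto
  have "f -` A \<inter> space M = {\<omega> \<in> space M. \<forall>i\<in>{..<length w}. f \<omega> i = w ! i}"
    by (auto simp: A cylinder_eq)
  also have "\<dots> \<in> sets M" by measurable
  finally show "f -` A \<inter> space M \<in> sets M" .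
qed auto

lemma Z_borel [measurable]: "Z \<in> sets borel"
  using closed_Z by simp

abbreviation borel_Z :: "bseq measure" where
  "borel_Z \<equiv> restrict_space borel Z"

lemma coordinate_borel: "{x :: bseq. x i} \<in> sets borel"
proof -
  have "open ((\<lambda>y::bseq. y i) -` {True})"
    by (intro open_vimage) (auto simp: Topological_Spaces.open_discrete)
  then have "open {x::bseq. x i}" by (simp add: vimage_def)
  then show ?thesis by simp
qed

lemma cylinder_Z_sets: "Z \<inter> cylinder w \<in> sets borel_Z"
  unfolding sets_restrict_space by (rule imageI[OF cylinder_borel])

definition finitely_determined :: "bseq set set" where
  "finitely_determined = determined_sets borel_Z (\<lambda>n x y. \<forall>i<n. x i = y i)"

lemma algebra_finitely_determined: "algebra Z finitely_determined"
proof -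
  have "algebra (space borel_Z) finitely_determined"
    unfolding finitely_determined_def by (rule algebra_determined_sets) auto
  then show ?thesis by (simp add: space_restrict_space)
qed

lemma finitely_determined_sets: "finitely_determined \<subseteq> sets borel_Z"
  unfolding finitely_determined_def by (rule determined_sets_subset)

lemma sets_borel_Z_le: "sets borel_Z \<subseteq> sigma_sets Z finitely_determined"
proof -
  have "Z \<in> sigma_sets UNIV (range cylinder)" using Z_borel by (simp only: sets_borel_cylinders)
  then have "sets borel_Z = sigma_sets Z ((\<inter>) Z ` range cylinder)"
    unfolding sets_restrict_space sets_borel_cylinders by (rule sigma_sets_Int) simp
  also have "\<dots> \<subseteq> sigma_sets Z finitely_determined"
  proof (rule sigma_sets_mono, clarify)
    fix w
    have "Z \<inter> cylinder w \<in> finitely_determined"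
      unfolding finitely_determined_def
      by (rule determined_setsI[where n = "length w", OF cylinder_Z_sets]) (auto simp: cylinder_eq space_restrict_space)
    then show "Z \<inter> cylinder w \<in> sigma_sets Z finitely_determined" by auto
  qed
  finally show ?thesis .
qed

definition word_entropy :: "bseq measure \<Rightarrow> nat \<Rightarrow> real" where
  "word_entropy \<mu> n = shannon \<mu> (\<lambda>x. map x [0..<n])"

locale invariant_measure =
  fixes \<mu> :: "bseq measure"
  assumes invariant: "\<mu> \<in> invariant_measures Z"
begin

lemma sets_mu [measurable_cong]: "sets \<mu> = sets borel_Z"
  using invariant by (auto simp: invariant_measures_def borel_probs_def)

lemma space_mu [simp]: "space \<mu> = Z"
  using sets_eq_imp_space_eq[OF sets_mu] by (simp add: space_restrict_space)

sublocale measure_preserving_map \<mu> shift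
proof -
  interpret prob_space \<mu> using invariant by (auto simp: invariant_measures_def borel_probs_def)
  show "measure_preserving_map \<mu> shift"
    by unfold_locales (use invariant in \<open>auto simp: invariant_measures_def\<close>)
qed

lemma simple_function_coordinate: "simple_function \<mu> (\<lambda>x. x i)"
proof -
  have "Z \<inter> {x. x i} \<in> events"
    unfolding sets_mu sets_restrict_space using coordinate_borel by blast
  then have "simple_function \<mu> (\<lambda>x. x \<in> Z \<inter> {x. x i})" by (rule simple_function_event)
  then show ?thesis by (subst simple_function_cong[of \<mu> _ "\<lambda>x. x \<in> Z \<inter> {x. x i}"]) auto
qed

lemma orbit_word_coordinate: "orbit_word (\<lambda>x. x 0) n x = map x [0..<n]"
  by (simp add: orbit_word_def shift_iterate)

lemma word_entropy_eq: "word_entropy \<mu> n = shannon \<mu> (orbit_word (\<lambda>x. x 0) n)"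
  by (simp add: word_entropy_def orbit_word_coordinate[abs_def])

definition h :: real where
  "h = lim (\<lambda>n. word_entropy \<mu> n / real n)"

lemma h_limit: "(\<lambda>n. word_entropy \<mu> n / real n) \<longlonglongrightarrow> h"
  and h_le: "n \<ge> 1 \<Longrightarrow> h \<le> word_entropy \<mu> n / real n"
proof -
  obtain l where l: "(\<lambda>n. word_entropy \<mu> n / real n) \<longlonglongrightarrow> l" "\<And>n. n \<ge> 1 \<Longrightarrow> l \<le> word_entropy \<mu> n / real n"
    using entropy_rate[OF simple_function_coordinate[of 0]] unfolding word_entropy_eq by blast
  then have "h = l" unfolding h_def by (intro limI)
  then show "(\<lambda>n. word_entropy \<mu> n / real n) \<longlonglongrightarrow> h" "n \<ge> 1 \<Longrightarrow> h \<le> word_entropy \<mu> n / real n"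
    using l by auto
qed

text \<open>A Borel set is nearly a finitely determined set, and so the atom of a finite partition in which a
  point lies is nearly a function of finitely many coordinates.\<close>

lemma atom_nearly_determined:
  assumes P: "finite P" "P \<subseteq> events" "partition_on (space \<mu>) P" and e: "e > 0"
  obtains m where "shannon \<mu> (\<lambda>x. (atom P x, orbit_word (\<lambda>x. x 0) m x)) - shannon \<mu> (orbit_word (\<lambda>x. x 0) m) \<le> e"
proof -
  obtain As where As: "set As = P" using finite_list[OF P(1)] by blast
  define p where "p = length As"
  have "e / real (Suc p) > 0" using e by simp
  from small_event_given[OF this] obtain d where d0: "d > 0"
    and d': "\<forall>A\<in>events. \<forall>B\<in>events. prob (sym_diff A B) < d \<longrightarrow>
      shannon \<mu> (\<lambda>\<omega>. (\<omega> \<in> A, \<omega> \<in> B)) - shannon \<mu> (\<lambda>\<omega>. \<omega> \<in> B) < e / real (Suc p)" by blast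
  note d = d0 d'[rule_format]
  have "\<exists>C\<in>finitely_determined. prob (sym_diff (As ! i) C) < d" if "i < p" for i
    using that As P(2) d(1)
    by (intro approx_by_algebra) (auto simp: algebra_finitely_determined p_def sets_mu
        intro: finitely_determined_sets[THEN subsetD] sets_borel_Z_le[THEN subsetD])
  then obtain C where C: "\<And>i. i < p \<Longrightarrow> C i \<in> finitely_determined" "\<And>i. i < p \<Longrightarrow> prob (sym_diff (As ! i) (C i)) < d"
    by metis
  have "\<exists>n. \<forall>x\<in>Z. \<forall>y\<in>Z. (\<forall>j<n. x j = y j) \<longrightarrow> x \<in> C i \<longrightarrow> y \<in> C i" if "i < p" for i
    using determined_setsD[OF C(1)[OF that, unfolded finitely_determined_def]] by (simp add: space_restrict_space)
  then obtain N where "\<forall>i. i < p \<longrightarrow> (\<forall>x\<in>Z. \<forall>y\<in>Z. (\<forall>j<N i. x j = y j) \<longrightarrow> x \<in> C i \<longrightarrow> y \<in> C i)"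
    by metis
  note N = this[rule_format (no_asm)]
  define m where "m = Max (insert 0 (N ` {..<p}))"
  have m: "N i \<le> m" if "i < p" for i using that by (auto simp: m_def)
  let ?W = "orbit_word (\<lambda>x. x 0) m"
  have W: "simple_function \<mu> ?W" by (rule simple_function_orbit_word[OF simple_function_coordinate])
  have As_ev: "As ! i \<in> events" if "i < p" for i using that As P(2) by (auto simp: p_def)
  have C_ev: "C i \<in> events" if "i < p" for i using C(1)[OF that] finitely_determined_sets unfolding sets_mu by blast
  have sX: "simple_function \<mu> (\<lambda>x. x \<in> As ! i)" if "i < p" for i using As_ev[OF that] by (rule simple_function_event)
  have "shannon \<mu> (\<lambda>x. (atom P x, ?W x)) \<le> shannon \<mu> (\<lambda>x. (map (\<lambda>i. x \<in> As ! i) [0..<p], ?W x))"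
  proof (rule shannon_mono[OF simple_function_Pair[OF simple_function_map_list[OF sX] W]])
    fix x y assume x: "x \<in> space \<mu>" and y: "y \<in> space \<mu>"
      and eq: "(map (\<lambda>i. x \<in> As ! i) [0..<p], ?W x) = (map (\<lambda>i. y \<in> As ! i) [0..<p], ?W y)"
    obtain i where i: "i < p" "As ! i = atom P x"
      using atom_in(1)[OF P(3) x] As by (metis in_set_conv_nth p_def)
    have "y \<in> atom P x" using eq i atom_in(2)[OF P(3) x] by auto
    then have "atom P y = atom P x" using atom_eqI[OF P(3)] atom_in(1)[OF P(3) x] by blast
    then show "(atom P x, ?W x) = (atom P y, ?W y)" using eq by simp
  qed
  also have "\<dots> \<le> shannon \<mu> ?W + (\<Sum>i<p. shannon \<mu> (\<lambda>x. (x \<in> As ! i, x \<in> C i)) - shannon \<mu> (\<lambda>x. x \<in> C i))"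
  proof (rule shannon_list_given_le[OF sX W])
    fix i x y assume i: "i < p" and "x \<in> space \<mu>" "y \<in> space \<mu>" "?W x = ?W y"
    then have "x \<in> Z" "y \<in> Z" "\<forall>j<m. x j = y j" by (auto simp: orbit_word_coordinate)
    moreover from this have "\<forall>j<N i. x j = y j" "\<forall>j<N i. y j = x j" using m[OF i] by auto
    ultimately show "(x \<in> C i) = (y \<in> C i)" using N[OF i, of x y] N[OF i, of y x] by blast
  qed
  also have "(\<Sum>i<p. shannon \<mu> (\<lambda>x. (x \<in> As ! i, x \<in> C i)) - shannon \<mu> (\<lambda>x. x \<in> C i)) \<le> (\<Sum>i<p. e / real (Suc p))"
    by (intro sum_mono less_imp_le d(2) As_ev C_ev C(2)) auto
  also have "\<dots> \<le> e" using e by (simp add: field_simps)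
  finally show ?thesis by (intro that[of m]) simp
qed

text \<open>The Kolmogorov--Sinai theorem for the partition according to the coordinate at time 0. Its
  \<open>n\<close>-th join is the partition into words of length \<open>n\<close>. A class of that partition may
  be empty and is then dropped, since the members of a partition are nonempty.\<close>

theorem ks_entropy_eq: "ks_entropy \<mu> shift = ereal h"
proof (rule antisym)
  show "ks_entropy \<mu> shift \<le> ereal h"
    unfolding ks_entropy_def
  proof (rule SUP_least, clarify)
    fix P assume P: "finite P" "P \<subseteq> events" "partition_on (space \<mu>) P"
    have "entropy_wrt \<mu> shift P \<le> h + e" if e: "e > 0" for e
    proof -
      obtain m where "shannon \<mu> (\<lambda>x. (atom P x, orbit_word (\<lambda>x. x 0) m x)) - shannon \<mu> (orbit_word (\<lambda>x. x 0) m) \<le> e"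
        by (rule atom_nearly_determined[OF P e])
      then show ?thesis
        by (rule entropy_wrt_le[OF P simple_function_coordinate[of 0] h_limit[unfolded word_entropy_eq]])
    qed
    then have "entropy_wrt \<mu> shift P \<le> h" by (rule field_le_epsilon)
    then show "ereal (entropy_wrt \<mu> shift P) \<le> ereal h" by simp
  qed
  define P where "P = range (\<lambda>b. {x \<in> Z. x 0 = b}) - {{}}"
  have P: "finite P" "P \<subseteq> events" "partition_on (space \<mu>) P"
  proof -
    show "finite P" by (simp add: P_def)
    show "P \<subseteq> events"
    proof
      fix A assume "A \<in> P"
      then obtain b where "A = (\<lambda>x. x 0) -` {b} \<inter> space \<mu>" by (auto simp: P_def)
      then show "A \<in> events" using simple_functionD(2)[OF simple_function_coordinate[of 0]] by simp
    qed
    show "partition_on (space \<mu>) P" by (auto simp: partition_on_def disjoint_def P_def)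
  qed
  have atom: "atom P x = {y \<in> Z. y 0 = x 0}" if "x \<in> Z" for x
    using that by (intro atom_eqI[OF P(3)]) (auto simp: P_def)
  have eq: "atom P x = atom P y \<longleftrightarrow> x 0 = y 0" if "x \<in> Z" "y \<in> Z" for x y
    using that by (auto simp: atom)
  have "shannon \<mu> (orbit_word (atom P) n) = word_entropy \<mu> n" for n
    unfolding word_entropy_eq
  proof (rule shannon_eqI[OF simple_function_orbit_word[OF simple_function_atom[OF P]]
        simple_function_orbit_word[OF simple_function_coordinate]])
    fix x y assume "x \<in> space \<mu>" "y \<in> space \<mu>"
    then show "orbit_word (\<lambda>x. x 0) n x = orbit_word (\<lambda>x. x 0) n y \<longleftrightarrow> orbit_word (atom P) n x = orbit_word (atom P) n y"
      using iterate_in_space[of x] iterate_in_space[of y] by (simp add: orbit_word_def eq)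
  qed
  then have "entropy_wrt \<mu> shift P = h"
    using entropy_wrt_limit[OF P] h_limit LIMSEQ_unique by auto
  moreover have "ereal (entropy_wrt \<mu> shift P) \<le> ks_entropy \<mu> shift"
    unfolding ks_entropy_def by (rule SUP_upper) (use P in simp)
  ultimately show "ereal h \<le> ks_entropy \<mu> shift" by simp
qed

end

section \<open>Independent sequences driven by the odometer\<close>

definition drop_seq :: "nat \<Rightarrow> (nat \<Rightarrow> 'a) \<Rightarrow> nat \<Rightarrow> 'a" where
  "drop_seq q \<omega> j = \<omega> (j + q)"

lemma drop_seq_add: "drop_seq p (drop_seq q \<omega>) = drop_seq (p + q) \<omega>"
  by (simp add: drop_seq_def fun_eq_iff add.assoc)

context prob_space
begin

abbreviation iid :: "(nat \<Rightarrow> 'a) measure" where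
  "iid \<equiv> PiM UNIV (\<lambda>_. M)"

lemma prob_space_iid: "prob_space iid"
  by (intro prob_space_PiM prob_space_axioms)

lemma space_iid: "space iid = {\<omega>. \<forall>j. \<omega> j \<in> space M}"
  by (auto simp: space_PiM PiE_iff)

lemma measurable_drop_seq [measurable]: "drop_seq q \<in> measurable iid iid"
  unfolding drop_seq_def[abs_def]
  by (rule measurable_PiM_single'[where f = "\<lambda>j \<omega>. \<omega> (j + q)"]) (auto simp: space_PiM PiE_iff)

lemma drop_seq_space: "\<omega> \<in> space iid \<Longrightarrow> drop_seq q \<omega> \<in> space iid"
  by (auto simp: space_iid drop_seq_def)

lemma comb_seq_space: "\<omega> \<in> space iid \<Longrightarrow> \<omega>' \<in> space iid \<Longrightarrow> comb_seq q \<omega> \<omega>' \<in> space iid"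
  by (auto simp: space_iid comb_seq_def)

text \<open>The sequence is distributed like its first \<open>q\<close> terms followed by an independent copy of
  the whole sequence.\<close>

lemma prob_before_and_after:
  assumes A [measurable]: "A \<in> sets iid" and B [measurable]: "B \<in> sets iid"
    and det: "\<And>\<omega> \<omega>'. \<omega> \<in> space iid \<Longrightarrow> \<omega>' \<in> space iid \<Longrightarrow> \<forall>j<q. \<omega> j = \<omega>' j \<Longrightarrow> \<omega> \<in> A \<Longrightarrow> \<omega>' \<in> A"
  shows "measure iid {\<omega> \<in> space iid. \<omega> \<in> A \<and> drop_seq q \<omega> \<in> B} = measure iid A * measure iid B"
proof -
  interpret seq: sequence_space M by unfold_locales
  let ?f = "\<lambda>(\<omega>, \<omega>'). comb_seq q \<omega> \<omega>'"
  let ?X = "{\<omega> \<in> space iid. \<omega> \<in> A \<and> drop_seq q \<omega> \<in> B}"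
  have X [measurable]: "?X \<in> sets iid" by measurable
  have drop: "drop_seq q (comb_seq q \<omega> \<omega>') = \<omega>'" for \<omega> \<omega>' :: "nat \<Rightarrow> 'a"
    by (auto simp: drop_seq_def comb_seq_def)
  have "comb_seq q \<omega> \<omega>' \<in> A \<longleftrightarrow> \<omega> \<in> A" if "\<omega> \<in> space iid" "\<omega>' \<in> space iid" for \<omega> \<omega>'
    using det[of "comb_seq q \<omega> \<omega>'" \<omega>] det[of \<omega> "comb_seq q \<omega> \<omega>'"] that comb_seq_space[OF that]
    by (auto simp: comb_seq_def)
  then have eq: "?f -` ?X \<inter> space (iid \<Otimes>\<^sub>M iid) = A \<times> B"
    using sets.sets_into_space[OF A] sets.sets_into_space[OF B]
    by (auto simp: space_pair_measure drop comb_seq_space)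
  have "measure iid ?X = measure (distr (iid \<Otimes>\<^sub>M iid) iid ?f) ?X"
    by (simp only: seq.PiM_comb_seq)
  also have "\<dots> = measure (iid \<Otimes>\<^sub>M iid) (A \<times> B)"
    by (subst measure_distr[OF measurable_comb_seq X]) (simp only: eq)
  also have "\<dots> = measure iid A * measure iid B"
    by (simp add: measure_def seq.P.emeasure_pair_measure_Times enn2real_mult)
  finally show ?thesis .
qed

lemma distr_drop_seq: "distr iid iid (drop_seq q) = iid"
proof (rule measure_eqI)
  interpret iid: prob_space iid by (rule prob_space_iid)
  fix B assume "B \<in> sets (distr iid iid (drop_seq q))"
  then have B [measurable]: "B \<in> sets iid" by simp
  have "measure iid {\<omega> \<in> space iid. \<omega> \<in> space iid \<and> drop_seq q \<omega> \<in> B} = measure iid (space iid) * measure iid B"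
    by (rule prob_before_and_after) auto
  moreover have "{\<omega> \<in> space iid. \<omega> \<in> space iid \<and> drop_seq q \<omega> \<in> B} = drop_seq q -` B \<inter> space iid" by auto
  ultimately have "measure iid (drop_seq q -` B \<inter> space iid) = measure iid B"
    by (simp add: iid.prob_space)
  then show "emeasure (distr iid iid (drop_seq q)) B = emeasure iid B"
    by (simp add: emeasure_distr iid.emeasure_eq_measure)
qed simp

lemma simple_function_seq:
  assumes "simple_function M f"
  shows "simple_function iid (\<lambda>\<omega>. f (\<omega> j))"
  by (rule simple_function_comp[OF measurable_component_singleton[of j UNIV "\<lambda>_. M"] assms]) simp

lemma shannon_iid:
  assumes f: "simple_function M f"
  shows "shannon iid (\<lambda>\<omega>. map (\<lambda>j. f (\<omega> j)) [0..<n]) = real n * shannon M f"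
proof (induction n)
  interpret iid: prob_space iid by (rule prob_space_iid)
  case 0
  then show ?case by (simp add: iid.shannon_const)
next
  interpret iid: prob_space iid by (rule prob_space_iid)
  interpret seq: sequence_space M by unfold_locales
  case (Suc n)
  let ?L = "\<lambda>\<omega>. map (\<lambda>j. f (\<omega> j)) [0..<n]"
  have L: "simple_function iid ?L" by (intro iid.simple_function_map_list simple_function_seq f)
  have f0: "simple_function iid (\<lambda>\<omega>. f (\<omega> 0))" by (rule simple_function_seq[OF f])
  have L': "simple_function iid (\<lambda>\<omega>. ?L (drop_seq 1 \<omega>))"
    unfolding drop_seq_def by (intro iid.simple_function_map_list simple_function_seq f)
  have fm: "simple_function iid (\<lambda>\<omega>. map (\<lambda>j. f (\<omega> j)) [0..<Suc n])"
    by (intro iid.simple_function_map_list simple_function_seq f)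
  have unroll: "map (\<lambda>j. f (\<omega> j)) [0..<Suc n] = f (\<omega> 0) # ?L (drop_seq 1 \<omega>)" for \<omega>
    by (subst upt_conv_Cons) (auto simp: drop_seq_def map_Suc_upt[symmetric] simp del: upt_Suc)
  have "shannon iid (\<lambda>\<omega>. map (\<lambda>j. f (\<omega> j)) [0..<Suc n]) = shannon iid (\<lambda>\<omega>. (f (\<omega> 0), ?L (drop_seq 1 \<omega>)))"
    by (rule iid.shannon_eqI[OF fm simple_function_Pair[OF f0 L']]) (simp add: unroll del: upt_Suc)
  also have "\<dots> = shannon iid (\<lambda>\<omega>. f (\<omega> 0)) + shannon iid (\<lambda>\<omega>. ?L (drop_seq 1 \<omega>))"
  proof (rule iid.shannon_indep[OF f0 L'])
    fix x y
    let ?A = "{\<omega> \<in> space iid. f (\<omega> 0) = x}" and ?B = "{\<omega> \<in> space iid. ?L \<omega> = y}"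
    have A: "?A \<in> sets iid" and B: "?B \<in> sets iid"
      using simple_functionD(2)[OF f0, of "{x}"] simple_functionD(2)[OF L, of "{y}"]
      by (simp_all add: vimage_def Int_def conj_commute)
    have "measure iid {\<omega> \<in> space iid. \<omega> \<in> ?A \<and> drop_seq 1 \<omega> \<in> ?B} = measure iid ?A * measure iid ?B"
      by (rule prob_before_and_after[OF A B]) auto
    moreover have "measure iid {\<omega> \<in> space iid. \<omega> \<in> space iid \<and> drop_seq 1 \<omega> \<in> ?B} = measure iid (space iid) * measure iid ?B"
      by (rule prob_before_and_after[OF _ B]) auto
    ultimately show "measure iid {\<omega> \<in> space iid. f (\<omega> 0) = x \<and> ?L (drop_seq 1 \<omega>) = y} =
        measure iid {\<omega> \<in> space iid. f (\<omega> 0) = x} * measure iid {\<omega> \<in> space iid. ?L (drop_seq 1 \<omega>) = y}"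
      using drop_seq_space[of _ 1] by (simp add: iid.prob_space cong: conj_cong)
  qed
  also have "shannon iid (\<lambda>\<omega>. ?L (drop_seq 1 \<omega>)) = shannon iid ?L"
    using shannon_distr[OF measurable_drop_seq L prob_space_iid, of 1] by (simp add: distr_drop_seq)
  also have "shannon iid (\<lambda>\<omega>. f (\<omega> 0)) = shannon M f"
    using shannon_distr[OF measurable_component_singleton[of "0::nat" UNIV "\<lambda>_. M"] f prob_space_iid]
      seq.PiM_component[of 0] by simp
  finally show ?case using Suc by (simp add: algebra_simps)
qed

end

lemma (in prob_space) distr_pair_snd:
  assumes "prob_space N"
  shows "distr (M \<Otimes>\<^sub>M N) N snd = N"
proof (rule measure_eqI)
  interpret N: prob_space N by fact
  fix B assume "B \<in> sets (distr (M \<Otimes>\<^sub>M N) N snd)"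
  then have B: "B \<in> sets N" by simp
  have "snd -` B \<inter> space (M \<Otimes>\<^sub>M N) = space M \<times> B"
    using sets.sets_into_space[OF B] by (auto simp: space_pair_measure)
  then show "emeasure (distr (M \<Otimes>\<^sub>M N) N snd) B = emeasure N B"
    using B by (simp add: emeasure_distr N.emeasure_pair_measure_Times emeasure_space_1)
qed simp

text \<open>A random position in an infinite row of independent blocks of length \<open>10 ^ K\<close>: the
  first component is the position modulo all powers of 10, the second lists the present block and all later
  ones. A step moves by one symbol, and it discards a block whenever it crosses a multiple of
  \<open>10 ^ K\<close>.\<close>

locale odometer_skew_product = prob_space +
  fixes K :: nat
begin

text \<open>Almost surely this is \<open>\<theta> K\<close>; the reduction makes it a position in the block for
  every \<open>\<theta>\<close>.\<close>

definition phase :: "(nat \<Rightarrow> nat) \<Rightarrow> nat" where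
  "phase \<theta> = \<theta> K mod 10 ^ K"

definition Omega :: "((nat \<Rightarrow> nat) \<times> (nat \<Rightarrow> 'a)) measure" where
  "Omega = odometer \<Otimes>\<^sub>M iid"

definition step :: "(nat \<Rightarrow> nat) \<times> (nat \<Rightarrow> 'a) \<Rightarrow> (nat \<Rightarrow> nat) \<times> (nat \<Rightarrow> 'a)" where
  "step x = (odometer_succ (fst x), drop_seq ((phase (fst x) + 1) div 10 ^ K) (snd x))"

sublocale iid: prob_space iid
  by (rule prob_space_iid)

sublocale pair: pair_prob_space odometer iid ..

lemma sets_Omega [measurable_cong]: "sets Omega = sets (odometer \<Otimes>\<^sub>M iid)"
  by (simp only: Omega_def)

lemma space_Omega: "space Omega = UNIV \<times> space iid"
  by (simp add: Omega_def space_pair_measure)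

lemma prob_space_Omega: "prob_space Omega"
  unfolding Omega_def by (rule pair.prob_space_axioms)

lemma phase_measurable [measurable]: "phase \<in> measurable odometer (count_space UNIV)"
proof -
  have "(\<lambda>\<theta>. \<theta> K mod 10 ^ K) \<in> measurable residue_space (count_space UNIV)" by measurable
  then show ?thesis by (simp add: phase_def[abs_def] cong: measurable_cong_sets)
qed

lemma phase_less: "phase \<theta> < 10 ^ K"
  by (simp add: phase_def)

lemma measurable_drop_by:
  assumes [measurable]: "f \<in> measurable N (count_space UNIV)" "g \<in> measurable N iid"
  shows "(\<lambda>x. drop_seq (f x) (g x)) \<in> measurable N iid"
  by (rule measurable_compose_countable[OF _ assms(1)]) measurable

lemma step_measurable [measurable]: "step \<in> measurable Omega Omega"
proof -
  have [measurable]: "odometer_succ \<in> measurable odometer odometer"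
    using odometer_succ_measurable by (simp cong: measurable_cong_sets)
  show ?thesis
    unfolding step_def[abs_def] Omega_def
    by (intro measurable_Pair measurable_drop_by) measurable
qed

lemma phase_succ: "phase (odometer_succ \<theta>) = (phase \<theta> + 1) mod 10 ^ K"
  by (simp add: phase_def odometer_succ_def mod_Suc_eq)

lemma step_iterate:
  "(step ^^ n) (\<theta>, \<omega>) = ((odometer_succ ^^ n) \<theta>, drop_seq ((phase \<theta> + n) div 10 ^ K) \<omega>)"
  "phase ((odometer_succ ^^ n) \<theta>) = (phase \<theta> + n) mod 10 ^ K"
proof (induction n)
  case 0
  case 1
  show ?case using phase_less[of \<theta>] by (simp add: drop_seq_def)
  case 2
  show ?case using phase_less[of \<theta>] by simp
next
  case (Suc n)
  have "phase \<theta> + Suc n = (phase \<theta> + n) mod 10 ^ K + 1 + (phase \<theta> + n) div 10 ^ K * 10 ^ K"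
    using mod_div_mult_eq[of "phase \<theta> + n" "10 ^ K"] by linarith
  then have "(phase \<theta> + Suc n) div 10 ^ K = ((phase \<theta> + n) mod 10 ^ K + 1 + (phase \<theta> + n) div 10 ^ K * 10 ^ K) div 10 ^ K"
    by (simp only:)
  also have "\<dots> = ((phase \<theta> + n) mod 10 ^ K + 1) div 10 ^ K + (phase \<theta> + n) div 10 ^ K"
    by (subst div_mult_self1) auto
  finally have *: "(phase \<theta> + Suc n) div 10 ^ K = ((phase \<theta> + n) mod 10 ^ K + 1) div 10 ^ K + (phase \<theta> + n) div 10 ^ K" .
  case 1
  have "(step ^^ Suc n) (\<theta>, \<omega>) = step ((odometer_succ ^^ n) \<theta>, drop_seq ((phase \<theta> + n) div 10 ^ K) \<omega>)"
    by (simp add: Suc(1))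
  also have "\<dots> = (odometer_succ ((odometer_succ ^^ n) \<theta>), drop_seq (((phase \<theta> + n) mod 10 ^ K + 1) div 10 ^ K)
      (drop_seq ((phase \<theta> + n) div 10 ^ K) \<omega>))"
    by (simp only: step_def fst_conv snd_conv Suc(2))
  also have "\<dots> = ((odometer_succ ^^ Suc n) \<theta>, drop_seq ((phase \<theta> + Suc n) div 10 ^ K) \<omega>)"
    by (simp only: drop_seq_add * funpow.simps comp_def)
  finally show ?case .
  case 2
  show ?case using Suc(2) by (simp add: phase_succ mod_Suc_eq)
qed

lemma emeasure_Omega:
  assumes "X \<in> sets Omega"
  shows "emeasure Omega X = (\<integral>\<^sup>+\<theta>. emeasure iid (Pair \<theta> -` X) \<partial>odometer)"
  using assms unfolding Omega_def by (rule iid.emeasure_pair_measure_alt)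

text \<open>For each \<open>\<theta>\<close> the map on the second component preserves the product measure, and the odometer
  preserves the first marginal.\<close>

lemma step_invariant: "distr Omega Omega step = Omega"
proof (rule measure_eqI)
  fix A assume "A \<in> sets (distr Omega Omega step)"
  then have A [measurable]: "A \<in> sets Omega" by simp
  then have A': "A \<in> sets (odometer \<Otimes>\<^sub>M iid)" by (simp only: Omega_def)
  have succ: "odometer_succ \<in> measurable odometer odometer"
    using odometer_succ_measurable by (simp cong: measurable_cong_sets)
  have "emeasure (distr Omega Omega step) A = emeasure Omega (step -` A \<inter> space Omega)"
    by (rule emeasure_distr) auto
  also have "\<dots> = (\<integral>\<^sup>+\<theta>. emeasure iid (Pair \<theta> -` (step -` A \<inter> space Omega)) \<partial>odometer)"
    by (rule emeasure_Omega) measurable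
  also have "\<dots> = (\<integral>\<^sup>+\<theta>. emeasure iid (Pair (odometer_succ \<theta>) -` A) \<partial>odometer)"
  proof (rule nn_integral_cong)
    fix \<theta>
    let ?q = "(phase \<theta> + 1) div 10 ^ K"
    have "Pair (odometer_succ \<theta>) -` A \<in> sets iid" using A' by (rule sets_Pair1)
    then have "emeasure (distr iid iid (drop_seq ?q)) (Pair (odometer_succ \<theta>) -` A)
      = emeasure iid (drop_seq ?q -` (Pair (odometer_succ \<theta>) -` A) \<inter> space iid)"
      by (rule emeasure_distr[OF measurable_drop_seq])
    also have "drop_seq ?q -` (Pair (odometer_succ \<theta>) -` A) \<inter> space iid = Pair \<theta> -` (step -` A \<inter> space Omega)"
      by (auto simp: step_def space_Omega)
    finally show "emeasure iid (Pair \<theta> -` (step -` A \<inter> space Omega)) = emeasure iid (Pair (odometer_succ \<theta>) -` A)"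
      by (simp add: distr_drop_seq)
  qed
  also have "\<dots> = (\<integral>\<^sup>+\<theta>. emeasure iid (Pair \<theta> -` A) \<partial>distr odometer odometer odometer_succ)"
    using iid.measurable_emeasure_Pair[OF A'] succ by (intro nn_integral_distr[symmetric]) auto
  also have "distr odometer odometer odometer_succ = odometer"
    using odometer_invariant distr_cong[of odometer odometer odometer residue_space odometer_succ odometer_succ] by simp
  also have "(\<integral>\<^sup>+\<theta>. emeasure iid (Pair \<theta> -` A) \<partial>odometer) = emeasure Omega A"
    by (rule emeasure_Omega[symmetric]) measurable
  finally show "emeasure (distr Omega Omega step) A = emeasure Omega A" .
qed simp

sublocale Om: measure_preserving_map Omega step
proof -
  interpret Om: prob_space Omega by (rule prob_space_Omega)
  show "measure_preserving_map Omega step"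
    by unfold_locales (auto simp: step_invariant)
qed

text \<open>Fubini, in the case where the inner probability depends on one residue only.\<close>

lemma prob_by_level:
  assumes X: "X \<in> sets Omega" and F: "\<And>t. 0 \<le> F t"
    and AE: "AE \<theta> in odometer. measure iid (Pair \<theta> -` X) = F (\<theta> m)"
  shows "Om.prob X = (\<Sum>t<10 ^ m. F t) / 10 ^ m"
proof -
  have "emeasure Omega X = (\<integral>\<^sup>+\<theta>. ennreal (F (\<theta> m)) \<partial>odometer)"
    unfolding emeasure_Omega[OF X]
    by (rule nn_integral_cong_AE) (use AE in \<open>auto simp: iid.emeasure_eq_measure\<close>)
  also have "\<dots> = (\<integral>\<^sup>+t. ennreal (F t) \<partial>distr odometer (count_space UNIV) (\<lambda>\<theta>. \<theta> m))"
    by (rule nn_integral_distr[symmetric]) auto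
  also have "\<dots> = ennreal ((\<Sum>t<10 ^ m. F t) / 10 ^ m)"
    unfolding odometer_uniform
    by (subst nn_integral_pmf_of_set) (auto simp: lessThan_empty_iff F sum_nonneg divide_ennreal ennreal_of_nat_eq_real_of_nat)
  finally show ?thesis
    by (simp add: measure_def F sum_nonneg)
qed

abbreviation finitary :: "((nat \<Rightarrow> nat) \<times> (nat \<Rightarrow> 'a)) set set" where
  "finitary \<equiv> determined_sets Omega (\<lambda>m x y. (\<forall>i\<le>m. fst x i = fst y i) \<and> (\<forall>j<m. snd x j = snd y j))"

lemma algebra_finitary: "algebra (space Omega) finitary"
  by (rule algebra_determined_sets) auto

lemma finitary_generates: "sets Omega \<subseteq> sigma_sets (space Omega) finitary"
proof
  define \<Sigma> where "\<Sigma> = sigma (space Omega) finitary"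
  have sub: "finitary \<subseteq> Pow (space Omega)" using determined_sets_subset sets.space_closed by blast
  have space: "space \<Sigma> = space Omega" and sets: "sets \<Sigma> = sigma_sets (space Omega) finitary"
    using sub by (auto simp: \<Sigma>_def sets_measure_of)
  have fin: "C \<in> sets \<Sigma>" if "C \<in> finitary" for C using that by (auto simp: sets)
  have 1: "(\<lambda>x. fst x) \<in> measurable \<Sigma> odometer"
  proof -
    have "(\<lambda>x i. fst x i) \<in> measurable \<Sigma> residue_space"
    proof (rule measurable_PiM_single'[where f = "\<lambda>i x. fst x i"])
      fix i
      show "(\<lambda>x. fst x i) \<in> measurable \<Sigma> (count_space UNIV)"
      proof (subst measurable_count_space_eq2_countable, intro conjI ballI, simp_all)
        fix t
        have "(\<lambda>x. fst x i) -` {t} \<inter> space Omega \<in> finitary"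
        proof (rule determined_setsI[where n = i])
          have "{\<theta>. \<theta> i \<in> {t}} \<times> space iid \<in> sets Omega"
            unfolding Omega_def by (intro pair_measureI) (simp_all only: sets_odometer residue_level_sets sets.top)
          also have "{\<theta>. \<theta> i \<in> {t}} \<times> space iid = (\<lambda>x. fst x i) -` {t} \<inter> space Omega"
            by (auto simp: space_Omega)
          finally show "(\<lambda>x. fst x i) -` {t} \<inter> space Omega \<in> sets Omega" .
        qed (auto simp: space_Omega)
        then show "(\<lambda>x. fst x i) -` {t} \<inter> space \<Sigma> \<in> sets \<Sigma>" unfolding space by (rule fin)
      qed
    qed (auto simp: space_PiM)
    then show ?thesis by (simp cong: measurable_cong_sets)
  qed
  have 2: "(\<lambda>x j. snd x j) \<in> measurable \<Sigma> iid"
  proof (rule measurable_PiM_single'[where f = "\<lambda>j x. snd x j"])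
    fix j :: nat
    show "(\<lambda>x. snd x j) \<in> measurable \<Sigma> M"
    proof (rule measurableI)
      fix x assume "x \<in> space \<Sigma>"
      then show "snd x j \<in> space M" by (auto simp: space space_Omega space_iid)
    next
      fix A assume A: "A \<in> events"
      have "(\<lambda>x. snd x j) -` A \<inter> space Omega \<in> finitary"
      proof (rule determined_setsI[where n = "Suc j"])
        have "space odometer \<times> ((\<lambda>\<omega>. \<omega> j) -` A \<inter> space iid) \<in> sets Omega"
          unfolding Omega_def
          by (intro pair_measureI sets.top measurable_sets[OF measurable_component_singleton[of j UNIV "\<lambda>_. M"] A]) simp
        also have "space odometer \<times> ((\<lambda>\<omega>. \<omega> j) -` A \<inter> space iid) = (\<lambda>x. snd x j) -` A \<inter> space Omega"
          by (auto simp: space_Omega)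
        finally show "(\<lambda>x. snd x j) -` A \<inter> space Omega \<in> sets Omega" .
      qed (auto simp: space_Omega)
      then show "(\<lambda>x. snd x j) -` A \<inter> space \<Sigma> \<in> sets \<Sigma>" unfolding space by (rule fin)
    qed
  qed (auto simp: space space_Omega space_PiM)
  have "(\<lambda>x. (fst x, snd x)) \<in> measurable \<Sigma> (odometer \<Otimes>\<^sub>M iid)"
    using 1 2 by (intro measurable_Pair) auto
  then have id: "(\<lambda>x. x) \<in> measurable \<Sigma> Omega" by (simp add: Omega_def)
  fix A assume A: "A \<in> sets Omega"
  have "(\<lambda>x. x) -` A \<inter> space \<Sigma> \<in> sets \<Sigma>" by (rule measurable_sets[OF id A])
  moreover have "(\<lambda>x. x) -` A \<inter> space \<Sigma> = A" using sets.sets_into_space[OF A] by (auto simp: space)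
  ultimately show "A \<in> sigma_sets (space Omega) finitary" by (simp add: sets)
qed

definition consistent :: "(nat \<Rightarrow> nat) \<Rightarrow> bool" where
  "consistent \<theta> \<longleftrightarrow> (\<forall>m i. i \<le> m \<longrightarrow> \<theta> i = \<theta> m mod 10 ^ i)"

lemma consistent_iterate:
  assumes "consistent \<theta>"
  shows "(odometer_succ ^^ n) \<theta> = (\<lambda>i. (\<theta> i + n) mod 10 ^ i)"
proof (induction n)
  case 0
  have "\<theta> i mod 10 ^ i = \<theta> i" for i using assms unfolding consistent_def by (metis order_refl)
  then show ?case by simp
next
  case (Suc n)
  then show ?case by (simp add: odometer_succ_def[abs_def] mod_Suc_eq)
qed

text \<open>A set that depends on the residues up to level \<open>m\<close> and on the first \<open>m\<close> terms of the sequence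
  is conditionally independent of its translates by \<open>n \<ge> m * 10 ^ K\<close> steps given the residue of level \<open>m\<close>,
  because by then the first \<open>m\<close> terms have been discarded; and during \<open>10 ^ m\<close> consecutive steps that residue runs through all values exactly once.\<close>

lemma finitary_correlations:
  assumes C: "C \<in> finitary"
  shows "\<exists>F. finite F \<and> F \<noteq> {} \<and>
    (\<Sum>n\<in>F. Om.prob (C \<inter> ((step ^^ n) -` C \<inter> space Omega))) = real (card F) * (Om.prob C)\<^sup>2"
proof -
  have Cs [measurable]: "C \<in> sets Omega" using C determined_sets_subset by blast
  then have Cs': "C \<in> sets (odometer \<Otimes>\<^sub>M iid)" by (simp only: Omega_def)
  obtain m where det: "\<forall>x\<in>space Omega. \<forall>y\<in>space Omega. (\<forall>i\<le>m. fst x i = fst y i) \<and> (\<forall>j<m. snd x j = snd y j) \<longrightarrow>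
      x \<in> C \<longrightarrow> y \<in> C"
    using determined_setsD[OF C] ..
  have m: "(\<theta>', \<omega>') \<in> C" if "\<omega> \<in> space iid" "\<omega>' \<in> space iid" "\<forall>i\<le>m. \<theta> i = \<theta>' i" "\<forall>j<m. \<omega> j = \<omega>' j" "(\<theta>, \<omega>) \<in> C"
    for \<theta> \<theta>' \<omega> \<omega>'
    by (rule det[rule_format (no_asm), of "(\<theta>, \<omega>)" "(\<theta>', \<omega>')"]) (use that in \<open>auto simp: space_Omega\<close>)
  define L :: nat where "L = 10 ^ m"
  (* after n0 steps at least m blocks have been discarded *)
  define n0 where "n0 = m * 10 ^ K"
  define fib where "fib \<theta> = Pair \<theta> -` C" for \<theta>
  have fib_sets: "fib \<theta> \<in> sets iid" for \<theta> unfolding fib_def using Cs' by (rule sets_Pair1)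
  have fib_space: "\<omega> \<in> space iid" if "\<omega> \<in> fib \<theta>" for \<theta> \<omega>
    using sets.sets_into_space[OF fib_sets] that by blast
  (* the conditional probability of C given that the residue of level m is t *)
  define g where "g t = measure iid (fib (\<lambda>i. t mod 10 ^ i))" for t
  have g: "measure iid (fib \<theta>) = g (\<theta> m)" if "consistent \<theta>" for \<theta>
  proof -
    let ?\<theta> = "\<lambda>i. \<theta> m mod 10 ^ i"
    have e: "\<forall>i\<le>m. \<theta> i = ?\<theta> i" using that unfolding consistent_def by blast
    have e': "\<forall>i\<le>m. ?\<theta> i = \<theta> i" by (intro allI impI e[rule_format, symmetric])
    have "fib \<theta> = fib ?\<theta>"
    proof (intro set_eqI iffI)
      fix \<omega> assume "\<omega> \<in> fib \<theta>"
      then show "\<omega> \<in> fib ?\<theta>"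
        using m[OF fib_space fib_space e, of \<omega> \<theta> \<omega> \<theta>] by (simp add: fib_def)
    next
      fix \<omega> assume "\<omega> \<in> fib ?\<theta>"
      then show "\<omega> \<in> fib \<theta>"
        using m[OF fib_space fib_space e', of \<omega> ?\<theta> \<omega> ?\<theta>] by (simp add: fib_def)
    qed
    then show ?thesis by (simp add: g_def)
  qed
  have AE_cons: "AE \<theta> in odometer. consistent \<theta>"
    unfolding consistent_def by (rule odometer_consistent)
  have probC: "Om.prob C = (\<Sum>t<L. g t) / L"
    unfolding L_def of_nat_power of_nat_numeral
    by (rule prob_by_level) (use AE_cons g in \<open>auto simp: g_def[of "_ :: nat"] fib_def[symmetric]\<close>)
  have corr: "Om.prob (C \<inter> ((step ^^ n) -` C \<inter> space Omega)) = (\<Sum>t<L. g t * g ((t + n) mod L)) / L"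
    if n: "n0 \<le> n" for n
    unfolding L_def of_nat_power of_nat_numeral
  proof (rule prob_by_level)
    show "C \<inter> ((step ^^ n) -` C \<inter> space Omega) \<in> sets Omega" by measurable
    show "0 \<le> g t * g ((t + n) mod 10 ^ m)" for t by (simp add: g_def)
    show "AE \<theta> in odometer. measure iid (Pair \<theta> -` (C \<inter> ((step ^^ n) -` C \<inter> space Omega))) = g (\<theta> m) * g ((\<theta> m + n) mod 10 ^ m)"
      using AE_cons
    proof eventually_elim
      case (elim \<theta>)
      define q where "q = (phase \<theta> + n) div 10 ^ K"
      define \<theta>' where "\<theta>' = (odometer_succ ^^ n) \<theta>"
      have \<theta>': "\<theta>' i = (\<theta> i + n) mod 10 ^ i" for i
        unfolding \<theta>'_def consistent_iterate[OF elim] ..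
      have "m \<le> n div 10 ^ K" using div_le_mono[OF n, of "10 ^ K"] by (simp add: n0_def)
      also have "\<dots> \<le> q" unfolding q_def by (rule div_le_mono) simp
      finally have q: "m \<le> q" .
      have cons': "consistent \<theta>'"
        unfolding consistent_def
      proof (intro allI impI)
        fix k i :: nat assume "i \<le> k"
        then have "\<theta> i = \<theta> k mod 10 ^ i" using elim unfolding consistent_def by blast
        then have "(\<theta> i + n) mod 10 ^ i = (\<theta> k + n) mod 10 ^ i" by (simp add: mod_add_left_eq)
        also have "\<dots> = (\<theta> k + n) mod 10 ^ k mod 10 ^ i"
          using \<open>i \<le> k\<close> by (intro mod_mod_cancel[symmetric] le_imp_power_dvd)
        finally show "\<theta>' i = \<theta>' k mod 10 ^ i" by (simp add: \<theta>')
      qed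
      have "Pair \<theta> -` (C \<inter> ((step ^^ n) -` C \<inter> space Omega)) = {\<omega> \<in> space iid. \<omega> \<in> fib \<theta> \<and> drop_seq q \<omega> \<in> fib \<theta>'}"
        by (auto simp: step_iterate(1) fib_def q_def \<theta>'_def space_Omega)
      moreover have "measure iid {\<omega> \<in> space iid. \<omega> \<in> fib \<theta> \<and> drop_seq q \<omega> \<in> fib \<theta>'} = measure iid (fib \<theta>) * measure iid (fib \<theta>')"
      proof (rule prob_before_and_after[OF fib_sets fib_sets])
        fix \<omega> \<omega>' assume *: "\<omega> \<in> space iid" "\<omega>' \<in> space iid" "\<forall>j<q. \<omega> j = \<omega>' j" "\<omega> \<in> fib \<theta>"
        have "\<forall>j<m. \<omega> j = \<omega>' j" using *(3) q by auto
        then show "\<omega>' \<in> fib \<theta>"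
          using m[OF *(1,2), of \<theta> \<theta>] *(4) by (simp add: fib_def)
      qed
      ultimately show ?case using g[OF elim] g[OF cons'] by (simp add: \<theta>')
    qed
  qed
  have L0: "L > 0" by (simp add: L_def)
  have tour: "(\<Sum>n\<in>{n0..<n0 + L}. g ((t + n) mod L)) = (\<Sum>s<L. g s)" for t
  proof -
    have "(\<Sum>n\<in>{n0..<n0 + L}. g ((t + n) mod L)) = (\<Sum>s<L. g ((s + (t + n0)) mod L))"
      by (rule sum.reindex_bij_witness[of _ "\<lambda>s. s + n0" "\<lambda>n. n - n0"]) (auto simp: algebra_simps)
    also have "\<dots> = (\<Sum>s<L. g s)"
      by (rule sum.reindex_bij_betw[OF bij_betw_add_mod[OF L0]])
    finally show ?thesis .
  qed
  let ?F = "{n0..<n0 + L}"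
  have "(\<Sum>n\<in>?F. Om.prob (C \<inter> ((step ^^ n) -` C \<inter> space Omega))) = (\<Sum>n\<in>?F. (\<Sum>t<L. g t * g ((t + n) mod L)) / L)"
    by (intro sum.cong corr) auto
  also have "\<dots> = (\<Sum>n\<in>?F. \<Sum>t<L. g t * g ((t + n) mod L)) / L" by (rule sum_divide_distrib[symmetric])
  also have "(\<Sum>n\<in>?F. \<Sum>t<L. g t * g ((t + n) mod L)) = (\<Sum>t<L. g t * (\<Sum>n\<in>?F. g ((t + n) mod L)))"
    by (subst sum.swap) (simp add: sum_distrib_left)
  also have "\<dots> = (\<Sum>t<L. g t) * (\<Sum>t<L. g t)" by (simp only: tour sum_distrib_right)
  also have "\<dots> / L = real (card ?F) * (Om.prob C)\<^sup>2"
    using L0 by (simp add: probC power2_eq_square)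
  finally show ?thesis using L0 by (intro exI[of _ ?F]) auto
qed

theorem step_ergodic:
  assumes "A \<in> sets Omega" "step -` A \<inter> space Omega = A"
  shows "Om.prob A = 0 \<or> Om.prob A = 1"
  by (rule Om.ergodic_if_correlations_average[OF algebra_finitary determined_sets_subset finitary_generates
        step_measurable step_invariant finitary_correlations assms])

end

section \<open>Masked concatenations of independent blocks\<close>

lemma gap_mod: "gap m (a mod 10 ^ m + i) \<longleftrightarrow> gap m (a + i)"
  by (simp add: gap_def mod_add_left_eq)

text \<open>A part of mass \<open>s\<close> that is split in two gains the entropy of a binary choice at
  most.\<close>

lemma eta_split_le:
  assumes "0 \<le> p" "p \<le> s"
  shows "eta p + eta (s - p) - eta s \<le> s * ln 2"
proof (cases "s = 0")
  case False
  have "eta q + q * ln s \<le> s / 2 - q + q * ln 2" if q: "0 \<le> q" "q \<le> s" for q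
  proof (cases "q = 0")
    case False
    then have "q > 0" "s > 0" using q by auto
    then have "ln (s / (2 * q)) \<le> s / (2 * q) - 1" by (intro ln_le_minus_one) auto
    then have "q * ln (s / (2 * q)) \<le> q * (s / (2 * q) - 1)" using q by (intro mult_left_mono)
    also have "\<dots> = s / 2 - q" using \<open>q > 0\<close> by (simp add: field_simps)
    finally show ?thesis using \<open>q > 0\<close> \<open>s > 0\<close> by (simp add: eta_def ln_div ln_mult algebra_simps)
  qed (use q in simp)
  from this[of p] this[of "s - p"] assms show ?thesis
    by (simp add: eta_def algebra_simps)
qed (use assms in simp)

text \<open>Outside \<open>D\<close> nothing remains to be learnt about \<open>A\<close>, inside
  \<open>D\<close> at most one bit.\<close>

lemma (in prob_space) shannon_subevent_given_le:
  assumes A: "A \<in> events" and D: "D \<in> events" and sub: "A \<subseteq> D"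
  shows "shannon M (\<lambda>\<omega>. (\<omega> \<in> A, \<omega> \<in> D)) - shannon M (\<lambda>\<omega>. \<omega> \<in> D) \<le> prob D * ln 2"
proof -
  let ?f = "\<lambda>\<omega>. (\<omega> \<in> A, \<omega> \<in> D)"
  have fib: "?f -` {(True, True)} \<inter> space M = A" "?f -` {(True, False)} \<inter> space M = {}"
    "?f -` {(False, True)} \<inter> space M = D - A" "?f -` {(False, False)} \<inter> space M = space M - D"
    using sub sets.sets_into_space[OF A] sets.sets_into_space[OF D] by auto
  have "shannon M ?f = (\<Sum>x\<in>{(True, True), (True, False), (False, True), (False, False)}. eta (prob (?f -` {x} \<inter> space M)))"
    by (rule shannon_superset) auto
  also have "\<dots> = eta (prob A) + eta (prob (D - A)) + eta (prob (space M - D))"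
    by (simp add: fib)
  also have "\<dots> = eta (prob A) + eta (prob D - prob A) + eta (1 - prob D)"
    using A D sub by (simp add: finite_measure_Diff prob_compl)
  finally have "shannon M ?f = eta (prob A) + eta (prob D - prob A) + eta (1 - prob D)" .
  moreover have "eta (prob A) + eta (prob D - prob A) - eta (prob D) \<le> prob D * ln 2"
    using A D sub by (intro eta_split_le finite_measure_mono) auto
  ultimately show ?thesis by (simp add: shannon_event[OF D])
qed

lemma (in prob_space) simple_function_pred:
  assumes [measurable]: "Measurable.pred M P"
  shows "simple_function M P"
proof -
  have "simple_function M (\<lambda>\<omega>. \<omega> \<in> {\<omega> \<in> space M. P \<omega>})"
    by (rule simple_function_event) measurable
  then show ?thesis by (subst simple_function_cong[of M P "\<lambda>\<omega>. \<omega> \<in> {\<omega> \<in> space M. P \<omega>}"]) auto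
qed

lemma shift_measurable_borel_Z: "shift \<in> measurable borel_Z borel_Z"
proof (rule measurable_restrict_space2)
  show "shift \<in> space borel_Z \<rightarrow> Z" using shift_image_Z by (auto simp: space_restrict_space)
  have "shift \<in> measurable borel borel"
  proof (rule measurable_bseqI)
    fix i show "Measurable.pred borel (\<lambda>x. shift x i)"
      using coordinate_borel[of "Suc i"] by (simp add: pred_def shift_def)
  qed
  then show "shift \<in> measurable borel_Z borel" by (rule measurable_restrict_space1)
qed

text \<open>The blocks are points distributed according to \<open>\<mu>\<close>, of which only the first
  \<open>l\<close> symbols are used. The second inequality leaves enough zeros between the blocks for gluing at
  all levels below \<open>k\<close>.\<close>

locale masked_blocks = invariant_measure \<mu> + odometer_skew_product \<mu> K for \<mu> K +
  fixes k l :: nat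
  assumes k: "k \<ge> 1" and l: "l + 10 ^ (2 * k) \<le> 10 ^ K"
begin

text \<open>The symbol at distance \<open>i\<close> from the present position, before the masks are
  applied.\<close>

definition raw :: "(nat \<Rightarrow> nat) \<times> (nat \<Rightarrow> bseq) \<Rightarrow> nat \<Rightarrow> bool" where
  "raw x i \<longleftrightarrow> (phase (fst x) + i) mod 10 ^ K < l \<and>
     snd x ((phase (fst x) + i) div 10 ^ K) ((phase (fst x) + i) mod 10 ^ K)"

definition point :: "(nat \<Rightarrow> nat) \<times> (nat \<Rightarrow> bseq) \<Rightarrow> bseq" where
  "point x i \<longleftrightarrow> raw x i \<and> \<not> masked k (fst x) i"

text \<open>At levels below \<open>k\<close> the separating zeros allow gluing, and masking is harmless by
  heredity; at the other levels the path that avoids the shortcut and starts at the residue of the level is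
  admissible because of the masks.\<close>

lemma point_in_Z:
  assumes "x \<in> space Omega"
  shows "point x \<in> Z"
  unfolding Z_def
proof
  fix m :: nat assume m: "m \<in> {1..}"
  show "point x \<in> Zn m"
  proof (cases "m < k")
    case True
    define y where "y = (\<lambda>i. i mod 10 ^ K < l \<and> snd x (i div 10 ^ K) (i mod 10 ^ K))"
    have "(10::nat) ^ (2 * m) \<le> 10 ^ (2 * k)" using True by (intro power_increasing) auto
    then have "(10::nat) ^ (2 * m) \<le> 10 ^ K - l" using l by linarith
    moreover have "snd x j \<in> Zn m" for j using assms m by (auto simp: space_Omega space_iid Z_def)
    moreover have "10 ^ K = l + (10 ^ K - l)" using l by linarith
    ultimately have "y \<in> Zn m" unfolding y_def by (intro Zn_glue)
    from Zn_shift[OF this, of "phase (fst x)"] show ?thesis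
      by (rule Zn_lower) (auto simp: y_def point_def raw_def)
  next
    case False
    then show ?thesis by (intro in_ZnI[where t = "fst x m"]) (auto simp: point_def masked_def)
  qed
qed

lemma point_step: "point (step x) = shift (point x)"
proof
  fix i
  let ?B = "10 ^ K :: nat" and ?p = "phase (fst x)"
  have p: "phase (fst (step x)) = (?p + 1) mod ?B" by (simp add: step_def phase_succ)
  have q: "?p + Suc i = ((?p + 1) mod ?B + i) + (?p + 1) div ?B * ?B"
    using mod_div_mult_eq[of "?p + 1" ?B] by linarith
  have d: "(?p + Suc i) div ?B = ((?p + 1) mod ?B + i) div ?B + (?p + 1) div ?B"
    unfolding q by (subst div_mult_self1) auto
  have m: "(?p + Suc i) mod ?B = ((?p + 1) mod ?B + i) mod ?B"
    unfolding q by (rule mod_mult_self1)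
  have "raw (step x) i \<longleftrightarrow> raw x (Suc i)"
    unfolding raw_def p d m by (simp add: step_def drop_seq_def)
  moreover have "masked k (fst (step x)) i \<longleftrightarrow> masked k (fst x) (Suc i)"
    unfolding masked_def step_def odometer_succ_def fst_conv gap_mod by simp
  ultimately show "point (step x) i = shift (point x) i" by (simp add: point_def shift_def)
qed

lemma fst_Omega_measurable [measurable]: "fst \<in> measurable Omega odometer"
  unfolding Omega_def by measurable

lemma snd_Omega_measurable [measurable]: "snd \<in> measurable Omega iid"
  unfolding Omega_def by measurable

lemma masked_Omega_measurable [measurable]: "Measurable.pred Omega (\<lambda>x. masked k (fst x) i)"
proof (rule measurable_compose[OF fst_Omega_measurable])
  show "Measurable.pred odometer (\<lambda>\<theta>. masked k \<theta> i)"
    using masked_measurable by (simp cong: measurable_cong_sets)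
qed

lemma coordinate_Omega_measurable [measurable]: "Measurable.pred Omega (\<lambda>x. snd x j p)"
proof -
  have "Measurable.pred \<mu> (\<lambda>x. x p)"
    using simple_functionD(2)[OF simple_function_coordinate[of p], of "{True}"]
    by (simp add: pred_def vimage_def Int_def conj_commute)
  then have "Measurable.pred iid (\<lambda>\<omega>. \<omega> j p)"
    by (rule measurable_compose[OF measurable_component_singleton[of j UNIV "\<lambda>_. \<mu>"], rotated]) simp
  then show ?thesis by (rule measurable_compose[OF snd_Omega_measurable])
qed

lemma raw_measurable [measurable]: "Measurable.pred Omega (\<lambda>x. raw x i)"
  unfolding raw_def
proof (rule measurable_compose_countable[where g = "\<lambda>x. phase (fst x)"
    and f = "\<lambda>p x. (p + i) mod 10 ^ K < l \<and> snd x ((p + i) div 10 ^ K) ((p + i) mod 10 ^ K)"])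
  show "(\<lambda>x. phase (fst x)) \<in> measurable Omega (count_space UNIV)"
    by (rule measurable_compose[OF fst_Omega_measurable phase_measurable])
qed measurable

lemma point_coordinate_measurable [measurable]: "Measurable.pred Omega (\<lambda>x. point x i)"
  unfolding point_def by measurable

lemma point_measurable [measurable]: "point \<in> measurable Omega borel_Z"
  by (rule measurable_restrict_space2)
    (auto intro: point_in_Z measurable_bseqI point_coordinate_measurable)

definition \<nu> :: "bseq measure" where
  "\<nu> = distr Omega borel_Z point"

lemma space_nu: "space \<nu> = Z"
  by (simp add: \<nu>_def space_restrict_space)

lemma nu_invariant: "\<nu> \<in> invariant_measures Z"
proof -
  have "prob_space \<nu>" unfolding \<nu>_def by (rule Om.prob_space_distr) measurable
  moreover have meas: "shift \<in> measurable \<nu> \<nu>"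
    using shift_measurable_borel_Z by (simp add: \<nu>_def)
  moreover have "distr \<nu> \<nu> shift = \<nu>"
  proof -
    have "distr \<nu> \<nu> shift = distr \<nu> borel_Z shift" by (rule distr_cong) (auto simp: \<nu>_def)
    also have "\<dots> = distr Omega borel_Z (shift \<circ> point)"
      unfolding \<nu>_def by (rule distr_distr[OF shift_measurable_borel_Z point_measurable])
    also have "shift \<circ> point = point \<circ> step" by (simp add: fun_eq_iff point_step)
    also have "distr Omega borel_Z (point \<circ> step) = distr (distr Omega Omega step) borel_Z point"
      by (rule distr_distr[symmetric]) measurable
    finally show ?thesis by (simp only: step_invariant \<nu>_def)
  qed
  ultimately show ?thesis by (simp add: invariant_measures_def borel_probs_def \<nu>_def)
qed

sublocale nu: invariant_measure \<nu>
  by unfold_locales (rule nu_invariant)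

lemma nu_ergodic: "\<nu> \<in> ergodic_measures Z"
  unfolding ergodic_measures_def mem_Collect_eq
proof (intro conjI nu_invariant ballI impI)
  fix A assume A: "A \<in> sets \<nu>" and inv: "shift -` A \<inter> space \<nu> = A"
  have [measurable]: "A \<in> sets borel_Z" using A by (simp add: \<nu>_def)
  define E where "E = point -` A \<inter> space Omega"
  have E: "E \<in> sets Omega" unfolding E_def by measurable
  have "step -` E \<inter> space Omega = E"
  proof -
    have "point (step x) \<in> A \<longleftrightarrow> point x \<in> A" if "x \<in> space Omega" for x
      using inv point_in_Z[OF that] unfolding point_step space_nu by blast
    moreover have "step x \<in> space Omega" if "x \<in> space Omega" for x
      using measurable_space[OF step_measurable that] .
    ultimately have "x \<in> step -` E \<inter> space Omega \<longleftrightarrow> x \<in> E" for x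
      unfolding E_def vimage_eq Int_iff by blast
    then show ?thesis by (rule set_eqI)
  qed
  then have "Om.prob E = 0 \<or> Om.prob E = 1" by (rule step_ergodic[OF E])
  moreover have "measure \<nu> A = Om.prob E" unfolding \<nu>_def E_def by (rule measure_distr) measurable
  ultimately show "measure \<nu> A = 0 \<or> measure \<nu> A = 1" by simp
qed

lemma prob_masked_Omega: "Om.prob {x \<in> space Omega. masked k (fst x) i} \<le> (1/5) ^ k * (5/4)"
proof -
  have set: "{\<theta>. masked k \<theta> i} \<in> sets odometer"
    using masked_measurable[of k i] by (simp add: pred_def space_PiM)
  have "Om.prob {x \<in> space Omega. masked k (fst x) i} = Om.prob ({\<theta>. masked k \<theta> i} \<times> space iid)"
    by (rule arg_cong[where f = Om.prob]) (auto simp: space_Omega)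
  also have "\<dots> = measure odometer {\<theta>. masked k \<theta> i} * measure iid (space iid)"
    unfolding Omega_def using set
    by (simp add: measure_def iid.emeasure_pair_measure_Times enn2real_mult del: sets_odometer)
  also have "\<dots> = measure odometer {\<theta>. masked k \<theta> i}" by (simp add: iid.prob_space)
  finally show ?thesis using prob_masked_le[OF k] by simp
qed

text \<open>Unless the window of length \<open>r\<close> is cut by the end of its block or hit by a mask, it shows a
  window of the \<open>\<mu>\<close>-random block.\<close>

lemma cylinder_probability_close:
  "\<bar>measure \<nu> (Z \<inter> cylinder w) - measure \<mu> (Z \<inter> cylinder w)\<bar>
    \<le> 2 * (10 ^ K - real l + real (length w)) / 10 ^ K + real (length w) * ((1/5) ^ k * (5/4))"
proof -
  define r where "r = length w"
  define B :: nat where "B = 10 ^ K"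
  define c where "c = measure \<mu> (Z \<inter> cylinder w)"
  have c: "0 \<le> c" "c \<le> 1" by (auto simp: c_def)
  (* the window lies within the first l symbols of the present block *)
  define fits where "fits = {x \<in> space Omega. phase (fst x) + r \<le> l}"
  have [measurable]: "(\<lambda>x. phase (fst x)) \<in> measurable Omega (count_space UNIV)"
    by (rule measurable_compose[OF fst_Omega_measurable phase_measurable])
  have fits: "fits \<in> sets Omega" unfolding fits_def by measurable
  define Y where "Y = {x \<in> space Omega. phase (fst x) + r \<le> l \<and> (\<forall>i<r. snd x 0 (phase (fst x) + i) = w ! i)}"
  have Y: "Y \<in> sets Omega"
  proof -
    have "Measurable.pred Omega (\<lambda>x. phase (fst x) + r \<le> l \<and> (\<forall>i<r. snd x 0 (phase (fst x) + i) = w ! i))"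
      by (rule measurable_compose_countable[where g = "\<lambda>x. phase (fst x)"
          and f = "\<lambda>p x. p + r \<le> l \<and> (\<forall>i<r. snd x 0 (p + i) = w ! i)"]) measurable
    then show ?thesis by (simp add: Y_def pred_def)
  qed
  define A where "A = {x \<in> space Omega. \<forall>i<r. point x i = w ! i}"
  have A: "A \<in> sets Omega" unfolding A_def by measurable
  define N where "N i = {x \<in> space Omega. masked k (fst x) i}" for i
  have N: "N i \<in> sets Omega" for i unfolding N_def by measurable
  have cons: "AE \<theta> in odometer. consistent \<theta>"
    unfolding consistent_def by (rule odometer_consistent)
  have phase: "phase \<theta> = \<theta> K" if "consistent \<theta>" for \<theta>
    using that by (metis consistent_def order_refl phase_def)
  have "measure \<nu> (Z \<inter> cylinder w) = Om.prob (point -` (Z \<inter> cylinder w) \<inter> space Omega)"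
    unfolding \<nu>_def by (rule measure_distr[OF point_measurable cylinder_Z_sets])
  also have "point -` (Z \<inter> cylinder w) \<inter> space Omega = A"
    using point_in_Z by (auto simp: A_def cylinder_eq r_def)
  finally have nuA: "measure \<nu> (Z \<inter> cylinder w) = Om.prob A" .
  have pY: "Om.prob Y = (\<Sum>t<10 ^ K. if t + r \<le> l then c else 0) / 10 ^ K"
  proof (rule prob_by_level[OF Y])
    show "0 \<le> (if t + r \<le> l then c else 0)" for t using c by simp
    show "AE \<theta> in odometer. measure iid (Pair \<theta> -` Y) = (if \<theta> K + r \<le> l then c else 0)"
      using cons
    proof eventually_elim
      case (elim \<theta>)
      let ?t = "\<theta> K"
      show ?case
      proof (cases "?t + r \<le> l")
        case True
        interpret seq: sequence_space \<mu> by unfold_locales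
        let ?D = "(shift ^^ ?t) -` (Z \<inter> cylinder w) \<inter> Z"
        have D: "?D \<in> sets \<mu>"
          using measurable_sets[OF measurable_iterate, of "Z \<inter> cylinder w" ?t] cylinder_Z_sets[of w]
          by (simp add: sets_mu)
        have "Pair \<theta> -` Y = {\<omega> \<in> space iid. \<omega> 0 \<in> ?D}"
          using True Z_shift[of _ ?t]
          by (auto simp: Y_def phase[OF elim] space_Omega space_iid cylinder_eq shift_iterate r_def)
        then have "measure iid (Pair \<theta> -` Y) = measure \<mu> ?D"
          using seq.emeasure_PiM_Collect_single[OF _ D, of 0] by (simp add: measure_def)
        also have "\<dots> = measure (distr \<mu> \<mu> (shift ^^ ?t)) (Z \<inter> cylinder w)"
          using cylinder_Z_sets[of w] by (subst measure_distr) (auto simp: sets_mu)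
        finally show ?thesis using True by (simp add: distr_iterate c_def)
      next
        case False
        then have "Pair \<theta> -` Y = {}" by (auto simp: Y_def phase[OF elim])
        then show ?thesis using False by simp
      qed
    qed
  qed
  have pf: "Om.prob fits = (\<Sum>t<10 ^ K. if t + r \<le> l then 1 else 0) / 10 ^ K"
  proof (rule prob_by_level[OF fits])
    show "AE \<theta> in odometer. measure iid (Pair \<theta> -` fits) = (if \<theta> K + r \<le> l then 1 else 0)"
      using cons
    proof eventually_elim
      case (elim \<theta>)
      have "Pair \<theta> -` fits = (if \<theta> K + r \<le> l then space iid else {})"
        by (auto simp: fits_def phase[OF elim] space_Omega)
      then show ?case by (simp add: iid.prob_space)
    qed
  qed auto
  define f where "f = Om.prob fits"
  define E where "E = real r * ((1/5) ^ k * (5/4))"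
  have Yf: "Om.prob Y = c * f"
    unfolding pY f_def pf by (simp add: sum_distrib_left if_distrib cong: if_cong)
  have f1: "0 \<le> f" "f \<le> 1" by (auto simp: f_def)
  have "real l - real r \<le> (\<Sum>t<10 ^ K. if t + r \<le> l then 1 else 0)"
  proof -
    have lB: "l \<le> 10 ^ K" using l by linarith
    have "real l - real r \<le> real (card {..<l - r})" by simp
    also have "\<dots> = (\<Sum>t<l - r. 1)" by simp
    also have "\<dots> = (\<Sum>t<l - r. if t + r \<le> l then 1 else 0)" by (rule sum.cong) auto
    also have "\<dots> \<le> (\<Sum>t<10 ^ K. if t + r \<le> l then 1 else (0::real))"
      using lB by (intro sum_mono2) auto
    finally show ?thesis .
  qed
  then have "(real l - real r) / 10 ^ K \<le> f" unfolding f_def pf by (rule divide_right_mono) simp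
  then have f2: "1 - f \<le> (10 ^ K - real l + real r) / 10 ^ K" by (simp add: field_simps)
  have sub: "sym_diff A Y \<subseteq> (space Omega - fits) \<union> (\<Union>i<r. N i)"
  proof -
    have "x \<in> A \<longleftrightarrow> x \<in> Y" if x: "x \<in> space Omega" "x \<in> fits" "\<And>i. i < r \<Longrightarrow> x \<notin> N i" for x
    proof -
      have p: "phase (fst x) + r \<le> l" using x(2) by (simp add: fits_def)
      have "point x i = snd x 0 (phase (fst x) + i)" if i: "i < r" for i
      proof -
        have "phase (fst x) + i < l" "phase (fst x) + i < 10 ^ K" using p i l by linarith+
        then show ?thesis using x(1) x(3)[OF i] by (simp add: point_def raw_def N_def)
      qed
      then show ?thesis using x(1) p by (auto simp: A_def Y_def)
    qed
    then show ?thesis using sets.sets_into_space[OF A] sets.sets_into_space[OF Y] by blast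
  qed
  have "Om.prob (sym_diff A Y) \<le> Om.prob ((space Omega - fits) \<union> (\<Union>i<r. N i))"
    by (rule Om.finite_measure_mono[OF sub]) (use fits N in auto)
  also have "\<dots> \<le> Om.prob (space Omega - fits) + Om.prob (\<Union>i<r. N i)"
    by (rule measure_Un_le) (use fits N in auto)
  also have "Om.prob (space Omega - fits) = 1 - f" unfolding f_def by (rule Om.prob_compl[OF fits])
  also have "Om.prob (\<Union>i<r. N i) \<le> (\<Sum>i<r. Om.prob (N i))"
    by (rule Om.finite_measure_subadditive_finite) (use N in auto)
  also have "\<dots> \<le> (\<Sum>i<r. (1/5) ^ k * (5/4))"
    unfolding N_def by (intro sum_mono prob_masked_Omega)
  finally have sd: "Om.prob (sym_diff A Y) \<le> 1 - f + E" by (simp add: E_def)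
  have "\<bar>Om.prob A - Om.prob Y\<bar> \<le> Om.prob (sym_diff A Y)"
    by (rule Om.measure_diff_le_sym_diff[OF A Y])
  moreover have "\<bar>Om.prob Y - c\<bar> \<le> 1 - f"
  proof -
    have "Om.prob Y - c = - (c * (1 - f))" by (simp add: Yf algebra_simps)
    moreover have "c * (1 - f) \<le> 1 * (1 - f)" using c f1 by (intro mult_right_mono) auto
    moreover have "0 \<le> c * (1 - f)" using c f1 by simp
    ultimately show ?thesis by (simp only: abs_minus_cancel abs_of_nonneg mult_1)
  qed
  moreover have "\<bar>Om.prob A - c\<bar> \<le> \<bar>Om.prob A - Om.prob Y\<bar> + \<bar>Om.prob Y - c\<bar>"
    by (rule order_trans[OF _ abs_triangle_ineq]) simp
  ultimately have "\<bar>Om.prob A - c\<bar> \<le> 2 * (1 - f) + E" using sd by simp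
  also have "\<dots> \<le> 2 * ((10 ^ K - real l + real r) / 10 ^ K) + E"
    using f2 by (intro add_right_mono mult_left_mono) auto
  finally show ?thesis unfolding nuA c_def r_def E_def by simp
qed

text \<open>A window of the length of \<open>n + 1\<close> blocks contains \<open>n\<close> whole blocks. They can be recovered from the masked
  window, the masks, the phase and the symbols that were masked out; the latter carry at most \<open>ln 2\<close>
  for each masked position.\<close>

lemma word_entropy_nu_ge:
  "real n * word_entropy \<mu> l \<le> word_entropy \<nu> (Suc n * 10 ^ K) + real (Suc n * 10 ^ K) * ((1/5) ^ k * (5/4) * ln 2)"
proof -
  define B :: nat where "B = 10 ^ K"
  define N where "N = Suc n * B"
  define X where "X x = map (\<lambda>i. point x i) [0..<N]" for x
  (* V records the symbols that the masks delete, F the masks and the phase. The present block may be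
     cut off at the left end of the window, so U' consists of the n blocks after it. *)
  define V where "V i x \<longleftrightarrow> raw x i \<and> masked k (fst x) i" for i x
  define R where "R i x \<longleftrightarrow> masked k (fst x) i" for i and x :: "(nat \<Rightarrow> nat) \<times> (nat \<Rightarrow> bseq)"
  define F where "F x = (map (\<lambda>i. R i x) [0..<N], phase (fst x))" for x
  define U where "U \<omega> = map (\<lambda>j. map (\<omega> j) [0..<l]) [0..<n]" for \<omega> :: "nat \<Rightarrow> bseq"
  define U' where "U' x = U (drop_seq 1 (snd x))" for x :: "(nat \<Rightarrow> nat) \<times> (nat \<Rightarrow> bseq)"
  have B0: "B > 0" by (simp add: B_def)
  have [measurable]: "Measurable.pred Omega (V i)" "Measurable.pred Omega (R i)" for i
    unfolding V_def R_def by measurable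
  have sV: "simple_function Omega (V i)" and sR: "simple_function Omega (R i)" for i
    by (intro Om.simple_function_pred; measurable)+
  have sX: "simple_function Omega X"
    unfolding X_def by (intro Om.simple_function_map_list Om.simple_function_pred) measurable
  have sphase: "simple_function Omega (\<lambda>x. phase (fst x))"
    unfolding simple_function_def
  proof (intro conjI ballI)
    show "finite ((\<lambda>x. phase (fst x)) ` space Omega)"
      by (rule finite_subset[of _ "{..<10 ^ K}"]) (auto simp: phase_less)
    show "(\<lambda>x. phase (fst x)) -` {t} \<inter> space Omega \<in> sets Omega" for t
      by (rule measurable_sets[OF measurable_compose[OF fst_Omega_measurable phase_measurable]]) simp
  qed
  have sF: "simple_function Omega F"
    unfolding F_def by (intro simple_function_Pair Om.simple_function_map_list sR sphase)
  have sword: "simple_function \<mu> (\<lambda>x. map x [0..<l])"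
    using simple_function_map_list[of l "\<lambda>i x. x i"] simple_function_coordinate by simp
  have sU: "simple_function iid U"
    unfolding U_def by (intro iid.simple_function_map_list simple_function_seq[OF sword])
  have sU1: "simple_function iid (\<lambda>\<omega>. U (drop_seq 1 \<omega>))"
    unfolding U_def drop_seq_def by (intro iid.simple_function_map_list simple_function_seq[OF sword])
  have sU': "simple_function Omega U'"
    unfolding U'_def using snd_Omega_measurable sU1 by (rule simple_function_comp)
  have HU: "shannon Omega U' = real n * word_entropy \<mu> l"
  proof -
    have "shannon Omega U' = shannon (distr Omega iid snd) (\<lambda>\<omega>. U (drop_seq 1 \<omega>))"
      unfolding U'_def using shannon_distr[OF snd_Omega_measurable sU1 prob_space_Omega] by simp
    also have "distr Omega iid snd = iid"
      unfolding Omega_def by (rule odometer.distr_pair_snd[OF prob_space_iid])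
    also have "shannon iid (\<lambda>\<omega>. U (drop_seq 1 \<omega>)) = shannon iid U"
      using shannon_distr[OF measurable_drop_seq sU prob_space_iid, of 1] by (simp add: distr_drop_seq)
    also have "\<dots> = real n * shannon \<mu> (\<lambda>x. map x [0..<l])"
      unfolding U_def by (rule shannon_iid[OF sword])
    finally show ?thesis by (simp add: word_entropy_def)
  qed
  have HX: "shannon Omega X = word_entropy \<nu> N"
  proof -
    have "simple_function \<nu> (\<lambda>x. map x [0..<N])"
      using nu.simple_function_map_list[of N "\<lambda>i x. x i"] nu.simple_function_coordinate by simp
    then have "simple_function borel_Z (\<lambda>x. map x [0..<N])"
      by (simp add: \<nu>_def simple_function_def)
    from shannon_distr[OF point_measurable this prob_space_Omega]
    show ?thesis by (simp add: word_entropy_def X_def[abs_def] \<nu>_def)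
  qed
  have indep: "shannon Omega (\<lambda>x. (U' x, F x)) = shannon Omega U' + shannon Omega F"
  proof (rule Om.shannon_indep[OF sU' sF])
    fix u f
    define E1 where "E1 = {\<omega> \<in> space iid. U (drop_seq 1 \<omega>) = u}"
    define E2 where "E2 = {\<theta>. (map (\<lambda>i. masked k \<theta> i) [0..<N], phase \<theta>) = f}"
    have E1: "E1 \<in> sets iid"
      using simple_functionD(2)[OF sU1, of "{u}"] by (simp add: E1_def vimage_def Int_def conj_commute)
    have E2: "E2 \<in> sets odometer"
    proof -
      have [measurable]: "Measurable.pred odometer (\<lambda>\<theta>. masked k \<theta> i)" for i
        using masked_measurable by (simp cong: measurable_cong_sets)
      have "{\<theta> \<in> space odometer. length (fst f) = N \<and> (\<forall>i\<in>{..<N}. masked k \<theta> i = fst f ! i) \<and> phase \<theta> = snd f} \<in> sets odometer"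
        by measurable
      also have "{\<theta> \<in> space odometer. length (fst f) = N \<and> (\<forall>i\<in>{..<N}. masked k \<theta> i = fst f ! i) \<and> phase \<theta> = snd f} = E2"
        unfolding E2_def by (cases f) (auto simp: list_eq_iff_nth_eq)
      finally show ?thesis .
    qed
    have times: "Om.prob (C \<times> D) = measure odometer C * measure iid D" if "C \<in> sets odometer" "D \<in> sets iid" for C D
      using that by (simp only: Omega_def measure_def iid.emeasure_pair_measure_Times enn2real_mult)
    have "{x \<in> space Omega. U' x = u \<and> F x = f} = E2 \<times> E1"
      "{x \<in> space Omega. U' x = u} = space odometer \<times> E1"
      "{x \<in> space Omega. F x = f} = E2 \<times> space iid"
      by (auto simp: E1_def E2_def U'_def F_def R_def space_Omega)
    then show "Om.prob {x \<in> space Omega. U' x = u \<and> F x = f} =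
        Om.prob {x \<in> space Omega. U' x = u} * Om.prob {x \<in> space Omega. F x = f}"
      using times[OF E2 E1] times[OF sets.top E1] times[OF E2 sets.top]
      by (simp only: odometer.prob_space iid.prob_space mult_1 mult_1_right mult.commute)
  qed
  have "shannon Omega (\<lambda>x. (U' x, F x)) \<le> shannon Omega (\<lambda>x. (map (\<lambda>i. V i x) [0..<N], (X x, F x)))"
  proof (rule Om.shannon_mono[OF simple_function_Pair[OF Om.simple_function_map_list[OF sV] simple_function_Pair[OF sX sF]]])
    fix x y
    assume eq: "(map (\<lambda>i. V i x) [0..<N], (X x, F x)) = (map (\<lambda>i. V i y) [0..<N], (X y, F y))"
    then have F: "F x = F y" by simp
    have V: "V i x = V i y" and X: "point x i = point y i" if "i < N" for i
      using eq that by (auto simp: X_def)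
    have raw: "raw x i = raw y i" if "i < N" for i
      using V[OF that] X[OF that] by (auto simp: V_def point_def)
    have ph: "phase (fst x) = phase (fst y)" using F by (simp add: F_def)
    have "snd x (Suc j) p = snd y (Suc j) p" if j: "j < n" and p: "p < l" for j p
    proof -
      define i where "i = Suc j * B + p - phase (fst x)"
      have pB: "p < B" using p l by (simp add: B_def)
      have phB: "phase (fst x) < B" using phase_less by (simp add: B_def)
      have i: "phase (fst x) + i = Suc j * B + p" using phB by (simp add: i_def)
      have "Suc j * B \<le> n * B" using j by (intro mult_right_mono) auto
      then have "i < N" using pB by (simp add: i_def N_def)
      from raw[OF this] show ?thesis
        using pB p B0 by (simp add: raw_def ph[symmetric] i B_def[symmetric] del: mult_Suc)
    qed
    then have "U' x = U' y" by (auto simp: U'_def U_def drop_seq_def)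
    then show "(U' x, F x) = (U' y, F y)" using F by simp
  qed
  also have "\<dots> \<le> shannon Omega (\<lambda>x. (X x, F x)) + (\<Sum>i<N. shannon Omega (\<lambda>x. (V i x, R i x)) - shannon Omega (R i))"
    by (rule Om.shannon_list_given_le[OF sV simple_function_Pair[OF sX sF]]) (auto simp: F_def)
  also have "(\<Sum>i<N. shannon Omega (\<lambda>x. (V i x, R i x)) - shannon Omega (R i)) \<le> (\<Sum>i<N. (1/5) ^ k * (5/4) * ln 2)"
  proof (rule sum_mono)
    fix i
    let ?A = "{x \<in> space Omega. V i x}" and ?D = "{x \<in> space Omega. R i x}"
    have "shannon Omega (\<lambda>x. (x \<in> ?A, x \<in> ?D)) - shannon Omega (\<lambda>x. x \<in> ?D) \<le> Om.prob ?D * ln 2"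
      by (rule Om.shannon_subevent_given_le) (measurable, auto simp: V_def R_def)
    also have "\<dots> \<le> (1/5) ^ k * (5/4) * ln 2"
      unfolding R_def using prob_masked_Omega by (intro mult_right_mono) auto
    also have "shannon Omega (\<lambda>x. (x \<in> ?A, x \<in> ?D)) = shannon Omega (\<lambda>x. (V i x, R i x))"
      by (rule Om.shannon_cong) auto
    also have "shannon Omega (\<lambda>x. x \<in> ?D) = shannon Omega (R i)"
      by (rule Om.shannon_cong) auto
    finally show "shannon Omega (\<lambda>x. (V i x, R i x)) - shannon Omega (R i) \<le> (1/5) ^ k * (5/4) * ln 2" .
  qed
  also have "shannon Omega (\<lambda>x. (X x, F x)) \<le> shannon Omega X + shannon Omega F"
    by (rule Om.shannon_subadditive[OF sX sF])
  finally show ?thesis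
    unfolding indep HU HX by (simp add: N_def B_def)
qed

text \<open>Divide the previous inequality by the length of the window and let the number of blocks
  grow.\<close>

lemma h_nu_ge: "real l / 10 ^ K * h - (1/5) ^ k * (5/4) * ln 2 \<le> nu.h"
proof (cases "l = 0")
  case True
  have "0 \<le> nu.h"
    by (rule LIMSEQ_le_const[OF nu.h_limit]) (auto simp: word_entropy_def nu.shannon_nonneg)
  then show ?thesis using True by (intro order_trans[OF _ \<open>0 \<le> nu.h\<close>]) simp
next
  case False
  define \<delta> where "\<delta> = (1/5) ^ k * (5/4) * ln (2::real)"
  have "(\<lambda>n. word_entropy \<nu> (Suc n * 10 ^ K) / real (Suc n * 10 ^ K)) \<longlonglongrightarrow> nu.h"
  proof (rule LIMSEQ_subseq_LIMSEQ[OF nu.h_limit, unfolded comp_def])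
    show "strict_mono (\<lambda>n. Suc n * 10 ^ K)" by (rule strict_monoI) simp
  qed
  moreover have "(\<lambda>n. real n / real (Suc n) * (word_entropy \<mu> l / 10 ^ K) - \<delta>) \<longlonglongrightarrow> 1 * (word_entropy \<mu> l / 10 ^ K) - \<delta>"
    by (intro tendsto_intros LIMSEQ_n_over_Suc_n)
  moreover have "real n / real (Suc n) * (word_entropy \<mu> l / 10 ^ K) - \<delta> \<le> word_entropy \<nu> (Suc n * 10 ^ K) / real (Suc n * 10 ^ K)" for n
  proof -
    have pos: "real (Suc n * 10 ^ K) > 0" unfolding of_nat_mult by (intro mult_pos_pos) auto
    have "real n * word_entropy \<mu> l - real (Suc n * 10 ^ K) * \<delta> \<le> word_entropy \<nu> (Suc n * 10 ^ K)"
      using word_entropy_nu_ge[of n] by (simp add: \<delta>_def)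
    then have "(real n * word_entropy \<mu> l - real (Suc n * 10 ^ K) * \<delta>) / real (Suc n * 10 ^ K)
        \<le> word_entropy \<nu> (Suc n * 10 ^ K) / real (Suc n * 10 ^ K)"
      using pos by (intro divide_right_mono) auto
    moreover have "(real n * word_entropy \<mu> l - real (Suc n * 10 ^ K) * \<delta>) / real (Suc n * 10 ^ K)
        = real n / real (Suc n) * (word_entropy \<mu> l / 10 ^ K) - \<delta>"
    proof -
      have frac: "(x * y - (s * t) * z) / (s * t) = x / s * (y / t) - z" if "s > 0" "t > 0" for s t x y z :: real
        using that by (simp add: field_simps)
      have "(real n * word_entropy \<mu> l - (real (Suc n) * real (10 ^ K)) * \<delta>) / (real (Suc n) * real (10 ^ K))
        = real n / real (Suc n) * (word_entropy \<mu> l / real (10 ^ K)) - \<delta>"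
        by (rule frac) auto
      then show ?thesis by (simp only: of_nat_mult of_nat_power of_nat_numeral)
    qed
    ultimately show ?thesis by simp
  qed
  ultimately have "1 * (word_entropy \<mu> l / 10 ^ K) - \<delta> \<le> nu.h"
    by (intro LIMSEQ_le[of _ _ "\<lambda>n. word_entropy \<nu> (Suc n * 10 ^ K) / real (Suc n * 10 ^ K)"]) auto
  moreover have "real l / 10 ^ K * h \<le> word_entropy \<mu> l / 10 ^ K"
    using h_le[of l] False by (simp add: field_simps)
  ultimately show ?thesis by (simp add: \<delta>_def)
qed

end

section \<open>Entropy density\<close>

definition cylinder_close :: "nat \<Rightarrow> real \<Rightarrow> bseq measure \<Rightarrow> bseq measure \<Rightarrow> bool" where
  "cylinder_close r d \<mu> \<nu> \<longleftrightarrow>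
     (\<forall>w. length w \<le> r \<longrightarrow> \<bar>measure \<nu> (Z \<inter> cylinder w) - measure \<mu> (Z \<inter> cylinder w)\<bar> < d)"

lemma cylinder_close_mono: "cylinder_close r d \<mu> \<nu> \<Longrightarrow> r' \<le> r \<Longrightarrow> d \<le> d' \<Longrightarrow> cylinder_close r' d' \<mu> \<nu>"
  unfolding cylinder_close_def by (meson le_trans less_le_trans)

lemma compact_Z: "compact Z"
proof -
  have "compact_space (euclidean :: bool topology)"
    unfolding compact_space_def by (simp add: compactin_euclidean_iff finite_imp_compact)
  then have "compact_space (product_topology (\<lambda>_ :: nat. euclidean :: bool topology) UNIV)"
    by (simp add: compact_space_product_topology)
  then have "compact (UNIV :: bseq set)"
    unfolding euclidean_product_topology compact_space_def by (simp add: compactin_euclidean_iff)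
  from closed_Int_compact[OF closed_Z this] show ?thesis by simp
qed

text \<open>Compactness of \<open>Z\<close>.\<close>

lemma uniformly_continuous_cylinders:
  fixes f :: "bseq \<Rightarrow> real"
  assumes f: "continuous_on Z f" and e: "e > 0"
  shows "\<exists>r. \<forall>x\<in>Z. \<forall>y\<in>Z. (\<forall>i<r. x i = y i) \<longrightarrow> \<bar>f x - f y\<bar> < e"
proof -
  have "\<exists>n. \<forall>y\<in>Z. y \<in> cylinder (map x [0..<n]) \<longrightarrow> \<bar>f y - f x\<bar> < e / 2" if x: "x \<in> Z" for x
  proof -
    obtain A where A: "open A" "A \<inter> Z = f -` ball (f x) (e / 2) \<inter> Z"
      using f unfolding continuous_on_open_invariant by (meson open_ball)
    have "x \<in> A" using A(2) x e by auto
    then obtain n where n: "cylinder (map x [0..<n]) \<subseteq> A" using open_contains_cylinder[OF A(1)] by metis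
    have "\<bar>f y - f x\<bar> < e / 2" if "y \<in> Z" "y \<in> cylinder (map x [0..<n])" for y
    proof -
      have "y \<in> A \<inter> Z" using n that by blast
      then have "y \<in> f -` ball (f x) (e / 2)" unfolding A(2) by blast
      then show ?thesis by (simp add: dist_real_def abs_minus_commute)
    qed
    then show ?thesis by blast
  qed
  then obtain n where n: "\<And>x y. x \<in> Z \<Longrightarrow> y \<in> Z \<Longrightarrow> y \<in> cylinder (map x [0..<n x]) \<Longrightarrow> \<bar>f y - f x\<bar> < e / 2"
    by metis
  have cover: "Z \<subseteq> (\<Union>x\<in>Z. cylinder (map x [0..<n x]))" using in_cylinder_initial by blast
  obtain D where D: "D \<subseteq> Z" "finite D" "Z \<subseteq> (\<Union>x\<in>D. cylinder (map x [0..<n x]))"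
    by (rule compactE_image[OF compact_Z _ cover]) (rule open_cylinder)
  define r where "r = Max (insert 0 (n ` D))"
  have r: "n x \<le> r" if "x \<in> D" for x using D(2) that by (auto simp: r_def)
  show ?thesis
  proof (intro exI[of _ r] ballI impI)
    fix x y assume xy: "x \<in> Z" "y \<in> Z" "\<forall>i<r. x i = y i"
    obtain z where z: "z \<in> D" "x \<in> cylinder (map z [0..<n z])" using D(3) xy(1) by blast
    have "\<forall>i<n z. y i = z i"
    proof (intro allI impI)
      fix i assume i: "i < n z"
      then have "x i = y i" using r[OF z(1)] xy(3) by simp
      moreover have "x i = z i" using z(2) i by (simp add: cylinder_eq)
      ultimately show "y i = z i" by simp
    qed
    then have "y \<in> cylinder (map z [0..<n z])" by (simp add: cylinder_eq)
    then have "\<bar>f x - f z\<bar> < e / 2" "\<bar>f y - f z\<bar> < e / 2" using n z D(1) xy by blast+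
    then show "\<bar>f x - f y\<bar> < e" by linarith
  qed
qed

abbreviation words_n :: "nat \<Rightarrow> bool list set" where
  "words_n r \<equiv> {w. length w = r}"

lemma finite_words_n: "finite (words_n r)"
  using finite_lists_length_eq[of "UNIV :: bool set" r] by simp

context invariant_measure
begin

lemma simple_function_initial_word: "simple_function \<mu> (\<lambda>x. map x [0..<r])"
  using simple_function_map_list[of r "\<lambda>i x. x i"] simple_function_coordinate by simp

lemma fibre_initial_word: "length w = r \<Longrightarrow> (\<lambda>x. map x [0..<r]) -` {w} \<inter> space \<mu> = Z \<inter> cylinder w"
  by (auto simp: cylinder_def)

lemma word_entropy_cylinders: "word_entropy \<mu> r = (\<Sum>w\<in>words_n r. eta (prob (Z \<inter> cylinder w)))"
  unfolding word_entropy_def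
  by (subst shannon_superset[OF finite_words_n]) (auto simp: fibre_initial_word simp del: space_mu)

lemma integral_initial_word:
  fixes g :: "bool list \<Rightarrow> real"
  shows "(\<integral>x. g (map x [0..<r]) \<partial>\<mu>) = (\<Sum>w\<in>words_n r. prob (Z \<inter> cylinder w) * g w)"
proof -
  let ?X = "\<lambda>x::bseq. map x [0..<r]"
  have "(\<integral>x. g (?X x) \<partial>\<mu>) = (\<Sum>w\<in>?X ` space \<mu>. prob (?X -` {w} \<inter> space \<mu>) * g w)"
    by (rule sum_over_fibres[symmetric, OF simple_function_initial_word])
  also have "\<dots> = (\<Sum>w\<in>words_n r. prob (?X -` {w} \<inter> space \<mu>) * g w)"
  proof (intro sum.mono_neutral_left finite_words_n ballI)
    fix w assume "w \<in> words_n r - ?X ` space \<mu>"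
    then have "?X -` {w} \<inter> space \<mu> = {}" by blast
    then show "prob (?X -` {w} \<inter> space \<mu>) * g w = 0" by simp
  qed auto
  also have "\<dots> = (\<Sum>w\<in>words_n r. prob (Z \<inter> cylinder w) * g w)"
    by (rule sum.cong) (simp_all add: fibre_initial_word del: space_mu)
  finally show ?thesis .
qed

lemma integral_near_initial_word:
  fixes f :: "bseq \<Rightarrow> real"
  assumes f: "continuous_on Z f" and near: "\<And>x. x \<in> Z \<Longrightarrow> \<bar>f x - g (map x [0..<r])\<bar> \<le> e"
  shows "\<bar>(\<integral>x. f x \<partial>\<mu>) - (\<integral>x. g (map x [0..<r]) \<partial>\<mu>)\<bar> \<le> e"
proof -
  have fm: "f \<in> borel_measurable \<mu>"
    using borel_measurable_continuous_on_restrict[OF f] by (simp add: sets_mu cong: measurable_cong_sets)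
  have gs: "simple_function \<mu> (\<lambda>x. g (map x [0..<r]))"
    using simple_function_compose[OF simple_function_initial_word, of g r] by (simp add: comp_def)
  have gm: "(\<lambda>x. g (map x [0..<r])) \<in> borel_measurable \<mu>"
    by (rule borel_measurable_simple_function[OF gs])
  have "finite ((\<lambda>x. g (map x [0..<r])) ` space \<mu>)" by (rule simple_functionD(1)[OF gs])
  then have "bounded ((\<lambda>x. g (map x [0..<r])) ` space \<mu>)" by (rule finite_imp_bounded)
  then obtain b where b: "\<And>x. x \<in> space \<mu> \<Longrightarrow> norm (g (map x [0..<r])) \<le> b"
    by (auto simp: bounded_iff)
  have gi: "integrable \<mu> (\<lambda>x. g (map x [0..<r]))"
    by (rule integrable_const_bound[of _ b]) (use b gm in auto)
  have fi: "integrable \<mu> f"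
  proof (rule integrable_const_bound[of _ "b + e"])
    show "AE x in \<mu>. norm (f x) \<le> b + e"
    proof (rule AE_I2)
      fix x assume "x \<in> space \<mu>"
      then show "norm (f x) \<le> b + e" using b[of x] near[of x] by simp
    qed
  qed (rule fm)
  have "\<bar>(\<integral>x. f x \<partial>\<mu>) - (\<integral>x. g (map x [0..<r]) \<partial>\<mu>)\<bar> = \<bar>\<integral>x. f x - g (map x [0..<r]) \<partial>\<mu>\<bar>"
    using fi gi by simp
  also have "\<dots> \<le> (\<integral>x. \<bar>f x - g (map x [0..<r])\<bar> \<partial>\<mu>)" by (rule integral_abs_bound)
  also have "\<dots> \<le> e"
    by (rule integral_le_const) (use fi gi near in auto)
  finally show ?thesis .
qed

lemma integral_close:
  fixes f :: "bseq \<Rightarrow> real"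
  assumes f: "continuous_on Z f" and e: "e > 0"
  shows "\<exists>r d. d > 0 \<and> (\<forall>\<nu>\<in>invariant_measures Z. cylinder_close r d \<mu> \<nu> \<longrightarrow> \<bar>(\<integral>x. f x \<partial>\<nu>) - (\<integral>x. f x \<partial>\<mu>)\<bar> < e)"
proof -
  obtain r where r: "\<forall>x\<in>Z. \<forall>y\<in>Z. (\<forall>i<r. x i = y i) \<longrightarrow> \<bar>f x - f y\<bar> < e / 4"
    using uniformly_continuous_cylinders[OF f, of "e / 4"] e by auto
  define g where "g w = (if Z \<inter> cylinder w = {} then 0 else f (SOME y. y \<in> Z \<inter> cylinder w))" for w
  have near: "\<bar>f x - g (map x [0..<r])\<bar> \<le> e / 4" if x: "x \<in> Z" for x
  proof -
    let ?w = "map x [0..<r]"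
    define y where "y = (SOME y. y \<in> Z \<inter> cylinder ?w)"
    have "x \<in> Z \<inter> cylinder ?w" using x in_cylinder_initial by blast
    then have y: "y \<in> Z \<inter> cylinder ?w" unfolding y_def by (rule someI[where P = "\<lambda>y. y \<in> Z \<inter> cylinder ?w"])
    then have "g ?w = f y" by (auto simp: g_def y_def)
    moreover have "\<forall>i<r. x i = y i" using y by (simp add: cylinder_eq)
    ultimately show ?thesis using r x y by (simp add: less_imp_le)
  qed
  define C where "C = (\<Sum>w\<in>words_n r. \<bar>g w\<bar>)"
  have C: "C \<ge> 0" unfolding C_def by (rule sum_nonneg) simp
  define d where "d = e / (4 * (C + 1))"
  have d: "d > 0" using e C by (simp add: d_def)
  have "\<bar>(\<integral>x. f x \<partial>\<nu>) - (\<integral>x. f x \<partial>\<mu>)\<bar> < e"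
    if nu: "\<nu> \<in> invariant_measures Z" and close: "cylinder_close r d \<mu> \<nu>" for \<nu>
  proof -
    interpret nu: invariant_measure \<nu> by unfold_locales (rule nu)
    have "(\<integral>x. g (map x [0..<r]) \<partial>\<nu>) - (\<integral>x. g (map x [0..<r]) \<partial>\<mu>)
      = (\<Sum>w\<in>words_n r. (measure \<nu> (Z \<inter> cylinder w) - prob (Z \<inter> cylinder w)) * g w)"
      by (simp add: integral_initial_word nu.integral_initial_word sum_subtractf left_diff_distrib)
    also have "\<bar>\<dots>\<bar> \<le> (\<Sum>w\<in>words_n r. \<bar>(measure \<nu> (Z \<inter> cylinder w) - prob (Z \<inter> cylinder w)) * g w\<bar>)"
      by (rule sum_abs)
    also have "\<dots> \<le> (\<Sum>w\<in>words_n r. d * \<bar>g w\<bar>)"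
    proof (rule sum_mono)
      fix w assume "w \<in> words_n r"
      then have "\<bar>measure \<nu> (Z \<inter> cylinder w) - prob (Z \<inter> cylinder w)\<bar> \<le> d"
        using close by (simp add: cylinder_close_def less_imp_le)
      then show "\<bar>(measure \<nu> (Z \<inter> cylinder w) - prob (Z \<inter> cylinder w)) * g w\<bar> \<le> d * \<bar>g w\<bar>"
        unfolding abs_mult by (rule mult_right_mono) simp
    qed
    also have "\<dots> = d * C" by (simp add: C_def sum_distrib_left)
    also have "\<dots> \<le> d * (C + 1)" using d by simp
    also have "\<dots> = e / 4" using C by (simp add: d_def field_simps)
    finally have "\<bar>(\<integral>x. g (map x [0..<r]) \<partial>\<nu>) - (\<integral>x. g (map x [0..<r]) \<partial>\<mu>)\<bar> \<le> e / 4" .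
    with integral_near_initial_word[OF f near] nu.integral_near_initial_word[OF f near]
    show ?thesis using e by linarith
  qed
  then show ?thesis using d by blast
qed

text \<open>The weak* topology is generated by conditions on finitely many integrals of continuous functions,
  and these are controlled by the measures of finitely many cylinders.\<close>

lemma weak_star_neighbourhood:
  assumes U: "openin (subtopology (weak_star Z) (invariant_measures Z)) U" and mu: "\<mu> \<in> U"
  shows "\<exists>r d. d > 0 \<and> (\<forall>\<nu>\<in>invariant_measures Z. cylinder_close r d \<mu> \<nu> \<longrightarrow> \<nu> \<in> U)"
proof -
  obtain T where T: "openin (weak_star Z) T" "U = T \<inter> invariant_measures Z"
    using U by (auto simp: openin_subtopology)
  define nbhd where "nbhd T \<longleftrightarrow> (\<mu> \<in> T \<longrightarrow> (\<exists>r d. d > 0 \<and> (\<forall>\<nu>\<in>invariant_measures Z. cylinder_close r d \<mu> \<nu> \<longrightarrow> \<nu> \<in> T)))" for T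
  have "generate_topology_on {{\<mu> \<in> borel_probs Z. (\<integral>x. f x \<partial>\<mu>) \<in> V} | (f :: bseq \<Rightarrow> real) V. continuous_on Z f \<and> open V} T"
    using T(1) unfolding weak_star_def by (rule openin_topology_generated_by)
  then have "nbhd T"
  proof induction
    case Empty
    then show ?case by (simp add: nbhd_def)
  next
    case (Int a b)
    show ?case unfolding nbhd_def
    proof
      assume "\<mu> \<in> a \<inter> b"
      then obtain r d r' d' where *: "d > 0" "\<forall>\<nu>\<in>invariant_measures Z. cylinder_close r d \<mu> \<nu> \<longrightarrow> \<nu> \<in> a"
        "d' > 0" "\<forall>\<nu>\<in>invariant_measures Z. cylinder_close r' d' \<mu> \<nu> \<longrightarrow> \<nu> \<in> b"
        using Int.IH by (auto simp: nbhd_def)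
      show "\<exists>r d. d > 0 \<and> (\<forall>\<nu>\<in>invariant_measures Z. cylinder_close r d \<mu> \<nu> \<longrightarrow> \<nu> \<in> a \<inter> b)"
      proof (intro exI[of _ "max r r'"] exI[of _ "min d d'"] conjI ballI impI)
        show "0 < min d d'" using * by simp
        fix \<nu> assume nu: "\<nu> \<in> invariant_measures Z" and c: "cylinder_close (max r r') (min d d') \<mu> \<nu>"
        have "cylinder_close r d \<mu> \<nu>" "cylinder_close r' d' \<mu> \<nu>"
          using cylinder_close_mono[OF c] by auto
        then show "\<nu> \<in> a \<inter> b" using * nu by blast
      qed
    qed
  next
    case (UN \<K>)
    show ?case unfolding nbhd_def
    proof
      assume "\<mu> \<in> \<Union>\<K>"
      then obtain a where a: "a \<in> \<K>" "\<mu> \<in> a" by blast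
      then obtain r d where "d > 0" "\<forall>\<nu>\<in>invariant_measures Z. cylinder_close r d \<mu> \<nu> \<longrightarrow> \<nu> \<in> a"
        using UN.IH[OF a(1)] by (auto simp: nbhd_def)
      then show "\<exists>r d. d > 0 \<and> (\<forall>\<nu>\<in>invariant_measures Z. cylinder_close r d \<mu> \<nu> \<longrightarrow> \<nu> \<in> \<Union>\<K>)"
        using a(1) by blast
    qed
  next
    case (Basis s)
    then obtain f :: "bseq \<Rightarrow> real" and V where s: "s = {\<mu> \<in> borel_probs Z. (\<integral>x. f x \<partial>\<mu>) \<in> V}"
      and f: "continuous_on Z f" and V: "open V" by blast
    show ?case unfolding nbhd_def
    proof
      assume "\<mu> \<in> s"
      then have "(\<integral>x. f x \<partial>\<mu>) \<in> V" by (simp add: s)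
      then obtain e where e: "e > 0" "\<And>y. dist y (\<integral>x. f x \<partial>\<mu>) < e \<Longrightarrow> y \<in> V"
        using V unfolding open_dist by blast
      obtain r d where rd: "d > 0" "\<forall>\<nu>\<in>invariant_measures Z. cylinder_close r d \<mu> \<nu> \<longrightarrow> \<bar>(\<integral>x. f x \<partial>\<nu>) - (\<integral>x. f x \<partial>\<mu>)\<bar> < e"
        using integral_close[OF f e(1)] by blast
      show "\<exists>r d. d > 0 \<and> (\<forall>\<nu>\<in>invariant_measures Z. cylinder_close r d \<mu> \<nu> \<longrightarrow> \<nu> \<in> s)"
      proof (intro exI[of _ r] exI[of _ d] conjI rd(1) ballI impI)
        fix \<nu> assume nu: "\<nu> \<in> invariant_measures Z" "cylinder_close r d \<mu> \<nu>"
        then have "(\<integral>x. f x \<partial>\<nu>) \<in> V" using rd(2) by (intro e(2)) (simp add: dist_real_def)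
        then show "\<nu> \<in> s" using nu(1) by (simp add: s invariant_measures_def)
      qed
    qed
  qed
  then show ?thesis using mu T(2) by (auto simp: nbhd_def)
qed

lemma word_entropy_close:
  assumes e: "e > 0"
  shows "\<exists>d>0. \<forall>\<nu>\<in>invariant_measures Z. cylinder_close r d \<mu> \<nu> \<longrightarrow> word_entropy \<nu> r \<le> word_entropy \<mu> r + e"
proof -
  define e' where "e' = e / real (card (words_n r) + 1)"
  have e': "e' > 0" using e by (simp add: e'_def)
  have "\<exists>d>0. \<forall>p\<in>{0..1}. dist p (prob (Z \<inter> cylinder w)) < d \<longrightarrow> dist (eta p) (eta (prob (Z \<inter> cylinder w))) < e'" for w
    using continuous_on_eta e' unfolding continuous_on_iff by simp
  then obtain d where d: "\<And>w. d w > 0" "\<And>w p. p \<in> {0..1} \<Longrightarrow> dist p (prob (Z \<inter> cylinder w)) < d w \<Longrightarrow>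
    dist (eta p) (eta (prob (Z \<inter> cylinder w))) < e'" by metis
  define D where "D = Min (insert 1 (d ` words_n r))"
  have D: "D > 0" "\<And>w. length w = r \<Longrightarrow> D \<le> d w"
    unfolding D_def using finite_words_n[of r] d(1) by (auto simp: Min_gr_iff)
  show ?thesis
  proof (intro exI[of _ D] conjI D(1) ballI impI)
    fix \<nu> assume nu: "\<nu> \<in> invariant_measures Z" and close: "cylinder_close r D \<mu> \<nu>"
    interpret nu: invariant_measure \<nu> by unfold_locales (rule nu)
    have "word_entropy \<nu> r \<le> (\<Sum>w\<in>words_n r. eta (prob (Z \<inter> cylinder w)) + e')"
      unfolding nu.word_entropy_cylinders
    proof (rule sum_mono)
      fix w assume w: "w \<in> words_n r"
      then have "\<bar>measure \<nu> (Z \<inter> cylinder w) - prob (Z \<inter> cylinder w)\<bar> < d w"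
        using close D(2)[of w] by (auto simp: cylinder_close_def intro: less_le_trans)
      then have "dist (eta (measure \<nu> (Z \<inter> cylinder w))) (eta (prob (Z \<inter> cylinder w))) < e'"
        by (intro d(2)) (auto simp: dist_real_def)
      then show "eta (measure \<nu> (Z \<inter> cylinder w)) \<le> eta (prob (Z \<inter> cylinder w)) + e'"
        by (simp add: dist_real_def)
    qed
    also have "\<dots> = word_entropy \<mu> r + real (card (words_n r)) * e'"
      by (simp add: word_entropy_cylinders sum.distrib)
    also have "real (card (words_n r)) * e' \<le> e" using e by (simp add: e'_def field_simps)
    finally show "word_entropy \<nu> r \<le> word_entropy \<mu> r + e" by simp
  qed
qed

lemma h_nonneg: "0 \<le> h"
  by (rule LIMSEQ_le_const[OF h_limit]) (auto simp: word_entropy_def shannon_nonneg)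

text \<open>Choice of parameters: first \<open>k\<close>, so that the masks of levels at least \<open>k\<close> are rare, then the block
  length \<open>10 ^ K\<close>, so large that the \<open>10 ^ (2 * k)\<close> zeros between the blocks are negligible.\<close>

lemma ergodic_approximation:
  assumes d: "d > 0" and \<epsilon>: "\<epsilon> > 0"
  shows "\<exists>\<nu>\<in>ergodic_measures Z. cylinder_close r d \<mu> \<nu> \<and> h - \<epsilon> < invariant_measure.h \<nu>"
proof -
  define c where "c = min d \<epsilon>"
  have c: "c > 0" "c \<le> d" "c \<le> \<epsilon>" using d \<epsilon> by (auto simp: c_def)
  have cancel: "u * (c / (4 * u)) = c / 4" if "u > 0" for u :: real using that by simp
  define a where "a = c / (4 * (real r + 1))"
  have "a > 0" using c by (simp add: a_def)
  then obtain k0 where k0: "(1/5::real) ^ k0 < a" using real_arch_pow_inv[of a "1/5"] by auto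
  define k where "k = Suc k0"
  have "(1/5::real) ^ k \<le> (1/5) ^ k0" unfolding k_def by (rule power_decreasing) auto
  then have k2: "(1/5::real) ^ k < a" using k0 by (rule le_less_trans)
  have k1: "k \<ge> 1" by (simp add: k_def)

  define A where "A = (10::real) ^ (2 * k) + real r + 1"
  have A: "A \<ge> 1" "10 ^ (2 * k) \<le> A" "10 ^ (2 * k) + real r \<le> A"
    by (auto simp: A_def)
  define b where "b = c / (4 * A * (h + 1))"
  have "b > 0" using c A h_nonneg by (simp add: b_def)
  then obtain K0 where K0: "(1/10::real) ^ K0 < b" using real_arch_pow_inv[of b "1/10"] by auto
  define K where "K = K0 + 2 * k"
  define q where "q = (1/10::real) ^ K"
  have q: "q > 0" "q < b" "q = 1 / 10 ^ K"
  proof -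
    show "q > 0" by (simp add: q_def)
    have "q \<le> (1/10) ^ K0" unfolding q_def K_def by (rule power_decreasing) auto
    then show "q < b" using K0 by simp
    show "q = 1 / 10 ^ K" by (simp add: q_def power_divide)
  qed
  define l :: nat where "l = 10 ^ K - 10 ^ (2 * k)"
  have le: "(10::nat) ^ (2 * k) \<le> 10 ^ K" by (rule power_increasing) (auto simp: K_def)
  interpret masked_blocks \<mu> K k l
    by unfold_locales (use k1 le in \<open>auto simp: l_def\<close>)
  have l: "real l = 10 ^ K - 10 ^ (2 * k)" using le by (simp add: l_def of_nat_diff)
  have qA: "A * q * (h + 1) < c / 4"
  proof -
    have "A * (h + 1) > 0" using A h_nonneg by simp
    then have "(A * (h + 1)) * q < (A * (h + 1)) * b" using q by (intro mult_strict_left_mono)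
    also have "\<dots> = c / 4"
      using cancel[OF \<open>A * (h + 1) > 0\<close>] by (simp only: b_def mult.assoc)
    finally show ?thesis by (simp add: mult.commute mult.left_commute)
  qed
  have "A * q * 1 \<le> A * q * (h + 1)" using A q h_nonneg by (intro mult_left_mono) auto
  then have qA1: "A * q < c / 4" using qA by simp
  have "cylinder_close r d \<mu> \<nu>"
    unfolding cylinder_close_def
  proof (intro allI impI)
    fix w :: "bool list" assume w: "length w \<le> r"
    have "\<bar>measure \<nu> (Z \<inter> cylinder w) - measure \<mu> (Z \<inter> cylinder w)\<bar>
        \<le> 2 * (10 ^ K - real l + real (length w)) / 10 ^ K + real (length w) * ((1/5) ^ k * (5/4))"
      by (rule cylinder_probability_close)
    also have "2 * (10 ^ K - real l + real (length w)) / 10 ^ K = 2 * ((10 ^ (2 * k) + real (length w)) * q)"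
      by (simp add: l q(3))
    also have "(10 ^ (2 * k) + real (length w)) * q \<le> A * q"
      using w q A by (intro mult_right_mono) auto
    also have "real (length w) * ((1/5) ^ k * (5/4)) \<le> (real r + 1) * (a * (5/4))"
      using w k2 \<open>a > 0\<close> by (intro mult_mono) auto
    also have "\<dots> = ((real r + 1) * a) * (5/4)" by (rule mult.assoc[symmetric])
    also have "(real r + 1) * a = c / 4" unfolding a_def by (rule cancel) simp
    finally show "\<bar>measure \<nu> (Z \<inter> cylinder w) - measure \<mu> (Z \<inter> cylinder w)\<bar> < d"
      using qA1 c by linarith
  qed
  moreover have "h - \<epsilon> < nu.h"
  proof -
    have "real l / 10 ^ K * h = h - 10 ^ (2 * k) * q * h"
      by (simp add: l q(3) diff_divide_distrib algebra_simps)
    moreover have "10 ^ (2 * k) * q * h \<le> A * q * (h + 1)"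
      using A q h_nonneg by (intro mult_mono) auto
    moreover have "(1/5) ^ k * (5/4) * ln 2 \<le> a * (5/4) * (1::real)"
      using k2 ln_2_less_1 \<open>a > 0\<close> by (intro mult_mono) auto
    moreover have "a \<le> c / 4" using c unfolding a_def by (intro divide_left_mono) auto
    ultimately show ?thesis using h_nu_ge qA c by linarith
  qed
  ultimately show ?thesis using nu_ergodic by blast
qed

end

text \<open>The construction bounds the entropy of \<open>\<nu>\<close> from below. From above it is bounded by
  the entropy per symbol of the words of one fixed length \<open>n\<close>, chosen in advance such that for
  \<open>\<mu>\<close> this quantity is close to its limit, and then by closeness on the cylinders of length
  \<open>n\<close>.\<close>

lemma entropy_dense_Z: "entropy_dense Z"
  unfolding entropy_dense_def
proof (intro ballI allI impI)
  fix \<mu> U and \<epsilon> :: real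
  assume mu: "\<mu> \<in> invariant_measures Z"
    and U: "openin (subtopology (weak_star Z) (invariant_measures Z)) U \<and> \<mu> \<in> U" and \<epsilon>: "\<epsilon> > 0"
  interpret invariant_measure \<mu> by unfold_locales (rule mu)
  obtain r1 d1 where 1: "d1 > 0" "\<forall>\<nu>\<in>invariant_measures Z. cylinder_close r1 d1 \<mu> \<nu> \<longrightarrow> \<nu> \<in> U"
    using weak_star_neighbourhood U by blast
  have "\<exists>N. \<forall>n\<ge>N. norm (word_entropy \<mu> n / real n - h) < \<epsilon> / 4"
    using LIMSEQ_D[OF h_limit, of "\<epsilon> / 4"] \<epsilon> by simp
  then obtain N where N: "\<forall>n\<ge>N. norm (word_entropy \<mu> n / real n - h) < \<epsilon> / 4" ..
  define n where "n = max N 1"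
  have n: "n \<ge> 1" "n \<ge> N" by (auto simp: n_def)
  have near: "word_entropy \<mu> n / real n < h + \<epsilon> / 4"
    using N[rule_format, OF n(2)] unfolding real_norm_def abs_less_iff by linarith
  obtain d2 where 2: "d2 > 0" "\<forall>\<nu>\<in>invariant_measures Z. cylinder_close n d2 \<mu> \<nu> \<longrightarrow> word_entropy \<nu> n \<le> word_entropy \<mu> n + \<epsilon> / 4"
    using word_entropy_close[of "\<epsilon> / 4" n] \<epsilon> by auto
  have "min d1 d2 > 0" using 1 2 by simp
  from ergodic_approximation[OF this \<epsilon>, of "max r1 n"] obtain \<nu>
    where nu: "\<nu> \<in> ergodic_measures Z" "cylinder_close (max r1 n) (min d1 d2) \<mu> \<nu>"
      "h - \<epsilon> < invariant_measure.h \<nu>" by blast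
  have inv: "\<nu> \<in> invariant_measures Z" using nu(1) by (simp add: ergodic_measures_def)
  interpret nu: invariant_measure \<nu> by unfold_locales (rule inv)
  have "cylinder_close r1 d1 \<mu> \<nu>" "cylinder_close n d2 \<mu> \<nu>"
    using cylinder_close_mono[OF nu(2)] by auto
  then have "\<nu> \<in> U" and le: "word_entropy \<nu> n \<le> word_entropy \<mu> n + \<epsilon> / 4"
    using 1 2 inv by blast+
  have "nu.h \<le> word_entropy \<nu> n / real n" by (rule nu.h_le[OF n(1)])
  also have "\<dots> \<le> (word_entropy \<mu> n + \<epsilon> / 4) / real n" using le by (rule divide_right_mono) simp
  also have "\<dots> = word_entropy \<mu> n / real n + \<epsilon> / 4 / real n" by (rule add_divide_distrib)
  also have "\<epsilon> / 4 / real n \<le> \<epsilon> / 4" using n(1) \<epsilon> by (simp add: divide_le_eq)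
  finally have "\<bar>nu.h - h\<bar> < \<epsilon>" using nu(3) near \<epsilon> by linarith
  then have "\<bar>ks_entropy \<nu> shift - ks_entropy \<mu> shift\<bar> < ereal \<epsilon>"
    by (simp add: ks_entropy_eq nu.ks_entropy_eq)
  then show "\<exists>\<nu>\<in>U \<inter> ergodic_measures Z. \<bar>ks_entropy \<nu> shift - ks_entropy \<mu> shift\<bar> < ereal \<epsilon>"
    using \<open>\<nu> \<in> U\<close> nu(1) by blast
qed

theorem proposition22:
  shows "shift_space Z \<and> hereditary Z \<and> topologically_mixing Z \<and> proximal Z \<and>
    topological_entropy Z > 0 \<and> entropy_dense Z"
  using shift_space_Z hereditary_Z topologically_mixing_Z proximal_Z topological_entropy_Z_pos
    entropy_dense_Z by blast

end
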